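(* The image of the map $\pi_n:R_n\to\prod_{i=1}^{n-1}Gr(i,n)$, $(V_{i,j})_{1\le i\le j\le n-1}\mapsto(V_{1,1},\dots,V_{n-1,n-1})$, is equal to $\mathcal F^a_n$. The variety $R_n$ is smooth and the map $\pi_n:R_n\to\mathcal F^a_n$ is a birational isomorphism.
   Context: Ground field $\mathbb C$. $W$ is a vector space with basis $w_1,\dots,w_n$, $Gr(d,n)$ is the Grassmannian of $d$-dimensional subspaces of $W$, and $pr_d(\sum c_iw_i)=\sum_{i\ne d}c_iw_i$. $\mathcal F^a_n$ is the variety of $(V_1,\dots,V_{n-1})\in\prod_{d=1}^{n-1}Gr(d,n)$ with $pr_{d+1}V_d\subset V_{d+1}$ for $d=1,\dots,n-2$. $R_n$ is the variety of collections $(V_{i,j})_{1\le i\le j\le n-1}$ of subspaces of $W$ such that $\dim V_{i,j}=i$, $V_{i,j}\subset W_{i,j}:=\mathrm{span}(w_1,\dots,w_i,w_{j+1},\dots,w_n)$, and $pr_{j+1}V_{i,j}\subset V_{i,j+1}\subset V_{i+1,j+1}$ for all $1\le i\le j\le n-2$. *)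

theory Defs
  imports "HOL-Analysis.Analysis" "HOL-Library.Function_Algebras"
begin

section \<open>Varieties given by affine charts\<close>

definition affine_space :: "'e set \<Rightarrow> ('e \<Rightarrow> complex) set" where
  "affine_space E = {x. \<forall>e. e \<notin> E \<longrightarrow> x e = 0}"

text \<open>Since the ground field is infinite, polynomials in the variables \<open>x\<^sub>e\<close> (\<open>e \<in> E\<close>)
  are identified with polynomial functions.\<close>

inductive_set polyfun :: "'e set \<Rightarrow> (('e \<Rightarrow> complex) \<Rightarrow> complex) set" for E where
  const: "(\<lambda>x. c) \<in> polyfun E"
| var: "e \<in> E \<Longrightarrow> (\<lambda>x. x e) \<in> polyfun E"
| add: "p \<in> polyfun E \<Longrightarrow> q \<in> polyfun E \<Longrightarrow> (\<lambda>x. p x + q x) \<in> polyfun E"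
| mult: "p \<in> polyfun E \<Longrightarrow> q \<in> polyfun E \<Longrightarrow> (\<lambda>x. p x * q x) \<in> polyfun E"

definition partial_deriv :: "'e \<Rightarrow> (('e \<Rightarrow> complex) \<Rightarrow> complex) \<Rightarrow> ('e \<Rightarrow> complex) \<Rightarrow> complex" where
  "partial_deriv e f x = deriv (\<lambda>t. f (x(e := t))) (x e)"

text \<open>A chart is a finite set \<open>E\<close> of variables with an injective parametrization of a piece of
  the variety by \<open>affine_space E\<close>; the transition maps of an atlas are meant to be regular on
  open subsets. The only atlases used below are those of products of Grassmannians.\<close>

type_synonym ('e, 'p) atlas = "('e set \<times> (('e \<Rightarrow> complex) \<Rightarrow> 'p)) set"

text \<open>The Zariski topology is generated by the principal open subsets of the charts.\<close>

definition zariski :: "('e, 'p) atlas \<Rightarrow> 'p topology" where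
  "zariski A = topology_generated_by
     {\<phi> ` {x \<in> affine_space E. g x \<noteq> 0} | E \<phi> g. (E, \<phi>) \<in> A \<and> g \<in> polyfun E}"

text \<open>Below, a locally closed subset \<open>X\<close> of the variety with atlas \<open>A\<close> is regarded as a variety
  with its reduced structure.\<close>

definition regular_on :: "('e, 'p) atlas \<Rightarrow> 'p set \<Rightarrow> ('p \<Rightarrow> complex) \<Rightarrow> bool" where
  "regular_on A X f \<longleftrightarrow>
     (\<forall>P\<in>X. \<exists>U. openin (zariski A) U \<and> P \<in> U \<and>
        (\<exists>(E, \<phi>)\<in>A. \<exists>p\<in>polyfun E. \<exists>q\<in>polyfun E.
           \<forall>Q\<in>X \<inter> U. \<exists>x\<in>affine_space E. Q = \<phi> x \<and> q x \<noteq> 0 \<and> f Q = p x / q x))"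

definition morphism ::
    "('e, 'p) atlas \<Rightarrow> 'p set \<Rightarrow> ('f, 'q) atlas \<Rightarrow> 'q set \<Rightarrow> ('p \<Rightarrow> 'q) \<Rightarrow> bool" where
  "morphism A X B Y f \<longleftrightarrow>
     continuous_map (subtopology (zariski A) X) (subtopology (zariski B) Y) f \<and>
     (\<forall>V h. openin (subtopology (zariski B) Y) V \<and> regular_on B V h \<longrightarrow>
        regular_on A {P \<in> X. f P \<in> V} (h \<circ> f))"

definition isomorphism ::
    "('e, 'p) atlas \<Rightarrow> 'p set \<Rightarrow> ('f, 'q) atlas \<Rightarrow> 'q set \<Rightarrow> ('p \<Rightarrow> 'q) \<Rightarrow> bool" where
  "isomorphism A X B Y f \<longleftrightarrow> morphism A X B Y f \<and>
     (\<exists>g. morphism B Y A X g \<and> (\<forall>P\<in>X. g (f P) = P) \<and> (\<forall>Q\<in>Y. f (g Q) = Q))"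

definition dense_open :: "('e, 'p) atlas \<Rightarrow> 'p set \<Rightarrow> 'p set \<Rightarrow> bool" where
  "dense_open A X U \<longleftrightarrow> openin (subtopology (zariski A) X) U \<and>
     subtopology (zariski A) X closure_of U = X"

definition birational_isomorphism ::
    "('e, 'p) atlas \<Rightarrow> 'p set \<Rightarrow> ('f, 'q) atlas \<Rightarrow> 'q set \<Rightarrow> ('p \<Rightarrow> 'q) \<Rightarrow> bool" where
  "birational_isomorphism A X B Y f \<longleftrightarrow> morphism A X B Y f \<and>
     (\<exists>U V. dense_open A X U \<and> dense_open B Y V \<and> isomorphism A U B V f)"

text \<open>Smoothness over the ground field at the point \<open>\<phi> x\<close>: on some principal open neighbourhood
  \<open>g \<noteq> 0\<close> in a chart, \<open>X\<close> is \<open>Spec\<close> of \<open>\<complex>[x\<^sub>e]\<^sub>g / (f\<^sub>0, \<dots>, f\<^sub>c\<^sub>-\<^sub>1)\<close>, where the Jacobian matrix of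
  \<open>f\<^sub>0, \<dots>, f\<^sub>c\<^sub>-\<^sub>1\<close> has rank \<open>c\<close> at \<open>x\<close>. The last conjunct but one says that these polynomials generate
  the whole ideal of \<open>X\<close> in the localization at \<open>g\<close>.\<close>

definition smooth_at :: "('e, 'p) atlas \<Rightarrow> 'p set \<Rightarrow> 'p \<Rightarrow> bool" where
  "smooth_at A X P \<longleftrightarrow>
     (\<exists>(E, \<phi>)\<in>A. \<exists>x\<in>affine_space E. \<exists>g\<in>polyfun E. \<exists>(c::nat) f.
        P = \<phi> x \<and> g x \<noteq> 0 \<and> (\<forall>i<c. f i \<in> polyfun E) \<and>
        {y \<in> affine_space E. g y \<noteq> 0 \<and> \<phi> y \<in> X} =
          {y \<in> affine_space E. g y \<noteq> 0 \<and> (\<forall>i<c. f i y = 0)} \<and>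
        (\<forall>h\<in>polyfun E. (\<forall>y\<in>affine_space E. g y \<noteq> 0 \<and> \<phi> y \<in> X \<longrightarrow> h y = 0) \<longrightarrow>
           (\<exists>m a. (\<forall>i<c. a i \<in> polyfun E) \<and>
              (\<forall>y. g y ^ m * h y = (\<Sum>i<c. a i y * f i y)))) \<and>
        (\<forall>l. (\<forall>e\<in>E. (\<Sum>i<c. l i * partial_deriv e (f i) x) = 0) \<longrightarrow> (\<forall>i<c. l i = 0)))"

definition smooth_variety :: "('e, 'p) atlas \<Rightarrow> 'p set \<Rightarrow> bool" where
  "smooth_variety A X \<longleftrightarrow> (\<forall>P\<in>X. smooth_at A X P)"


section \<open>Products of Grassmannians\<close>

text \<open>\<open>W\<close> is realized inside the complex vector space \<open>nat \<Rightarrow> complex\<close>.\<close>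

interpretation cfun: vector_space "\<lambda>(c::complex) (v::nat \<Rightarrow> complex) i. c * v i"
  by unfold_locales (auto simp: fun_eq_iff algebra_simps)

definition w_vec :: "nat \<Rightarrow> nat \<Rightarrow> complex" where
  "w_vec i = (\<lambda>j. if j = i then 1 else 0)"

definition W_space :: "nat \<Rightarrow> (nat \<Rightarrow> complex) set" where
  "W_space n = cfun.span (w_vec ` {1..n})"

definition pr :: "nat \<Rightarrow> (nat \<Rightarrow> complex) \<Rightarrow> nat \<Rightarrow> complex" where
  "pr d v = v(d := 0)"

definition Gr :: "nat \<Rightarrow> nat \<Rightarrow> (nat \<Rightarrow> complex) set set" where
  "Gr d n = {V. cfun.subspace V \<and> V \<subseteq> W_space n \<and> cfun.dim V = d}"

definition Gr_prod :: "nat \<Rightarrow> 'k set \<Rightarrow> ('k \<Rightarrow> nat) \<Rightarrow> ('k \<Rightarrow> (nat \<Rightarrow> complex) set) set" where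
  "Gr_prod n K d = (\<Pi>\<^sub>E k\<in>K. Gr (d k) n)"

text \<open>The standard atlas of \<open>Gr_prod n K d\<close>: a chart is given by subsets \<open>I k\<close> of \<open>{1..n}\<close> of size
  \<open>d k\<close>. It parametrizes the tuples of subspaces \<open>V k\<close> complementary to the span of the \<open>w_vec j\<close>
  with \<open>j \<notin> I k\<close>, the coordinates \<open>x (k, i, j)\<close> being the entries of the unique basis of \<open>V k\<close>
  of the form \<open>w_vec i + (\<Sum>j\<in>{1..n} - I k. x (k, i, j) w_vec j)\<close>, \<open>i \<in> I k\<close>.\<close>

definition Gr_chart_vars :: "nat \<Rightarrow> 'k set \<Rightarrow> ('k \<Rightarrow> nat set) \<Rightarrow> ('k \<times> nat \<times> nat) set" where
  "Gr_chart_vars n K I = {(k, i, j). k \<in> K \<and> i \<in> I k \<and> j \<in> {1..n} - I k}"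

definition Gr_chart ::
    "nat \<Rightarrow> 'k set \<Rightarrow> ('k \<Rightarrow> nat set) \<Rightarrow> ('k \<times> nat \<times> nat \<Rightarrow> complex) \<Rightarrow> 'k \<Rightarrow> (nat \<Rightarrow> complex) set"
  where
  "Gr_chart n K I x = (\<lambda>k\<in>K. cfun.span
     ((\<lambda>i. w_vec i + (\<Sum>j\<in>{1..n} - I k. (\<lambda>l. x (k, i, j) * w_vec j l))) ` I k))"

definition Gr_atlas ::
    "nat \<Rightarrow> 'k set \<Rightarrow> ('k \<Rightarrow> nat) \<Rightarrow> ('k \<times> nat \<times> nat, 'k \<Rightarrow> (nat \<Rightarrow> complex) set) atlas" where
  "Gr_atlas n K d = {(Gr_chart_vars n K I, Gr_chart n K I) | I.
     \<forall>k\<in>K. I k \<subseteq> {1..n} \<and> card (I k) = d k}"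


section \<open>The degenerate flag variety and its resolution\<close>

definition Fa_variety :: "nat \<Rightarrow> (nat \<Rightarrow> (nat \<Rightarrow> complex) set) set" where
  "Fa_variety n = {V \<in> Gr_prod n {1..n-1} (\<lambda>d. d).
     \<forall>d\<in>{1..n-2}. pr (d + 1) ` V d \<subseteq> V (d + 1)}"

definition R_index :: "nat \<Rightarrow> (nat \<times> nat) set" where
  "R_index n = {(i, j). 1 \<le> i \<and> i \<le> j \<and> j \<le> n - 1}"

definition W_sub :: "nat \<Rightarrow> nat \<Rightarrow> nat \<Rightarrow> (nat \<Rightarrow> complex) set" where
  "W_sub n i j = cfun.span (w_vec ` ({1..i} \<union> {j+1..n}))"

definition R_variety :: "nat \<Rightarrow> (nat \<times> nat \<Rightarrow> (nat \<Rightarrow> complex) set) set" where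
  "R_variety n = {V \<in> Gr_prod n (R_index n) fst.
     (\<forall>(i, j)\<in>R_index n. V (i, j) \<subseteq> W_sub n i j) \<and>
     (\<forall>i j. 1 \<le> i \<and> i \<le> j \<and> j \<le> n - 2 \<longrightarrow>
        pr (j + 1) ` V (i, j) \<subseteq> V (i, j + 1) \<and> V (i, j + 1) \<subseteq> V (i + 1, j + 1))}"

definition proj_R ::
    "nat \<Rightarrow> (nat \<times> nat \<Rightarrow> (nat \<Rightarrow> complex) set) \<Rightarrow> nat \<Rightarrow> (nat \<Rightarrow> complex) set" where
  "proj_R n V = (\<lambda>i\<in>{1..n-1}. V (i, i))"

end

theory Submission
  imports Defs
begin

text \<open>
  Set \<open>V\<^sub>0\<^sub>,\<^sub>j = 0\<close> and \<open>V\<^sub>i\<^sub>,\<^sub>n = span (w\<^sub>1, \<dots>, w\<^sub>i)\<close>. Then \<open>R\<^sub>n\<close> is given by the conditions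
  \<open>V\<^sub>i\<^sub>-\<^sub>1\<^sub>,\<^sub>j \<subseteq> V\<^sub>i\<^sub>,\<^sub>j \<subseteq> V\<^sub>i\<^sub>,\<^sub>j\<^sub>+\<^sub>1 \<oplus> \<langle>w\<^sub>j\<^sub>+\<^sub>1\<rangle>\<close>, where the outer spaces have dimensions \<open>i - 1\<close> and \<open>i + 1\<close>:
  it is a tower of projective lines. Around each of its points there is a chart whose index sets
  satisfy the analogous inclusions, and in such a chart \<open>R\<^sub>n\<close> is the graph of a polynomial map in one
  free entry for each \<open>(i, j)\<close>; hence it is smooth. The map \<open>\<pi>\<^sub>n\<close> is an isomorphism over the locus
  where each \<open>V\<^sub>i\<close> is complementary to \<open>span (w\<^sub>i\<^sub>+\<^sub>1, \<dots>, w\<^sub>n)\<close>, with inverse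
  \<open>V\<^sub>i\<^sub>,\<^sub>j = pr\<^sub>i\<^sub>+\<^sub>1 \<cdots> pr\<^sub>j V\<^sub>i\<close>. This locus is dense because, by the Cauchy determinant, a single point of
  it lies in all adapted charts, and each of these meets \<open>R\<^sub>n\<close> in an affine space.
\<close>

section \<open>Polynomial and rational functions\<close>

text \<open>Smoothness and density share one tool: a polynomial retraction \<open>r\<close> of an
  adapted chart onto R_n that depends on the free entries only. It exists because the equations,
  ordered by i + (n - j), express every entry at (i, j) through the neighbours (i, j + 1) and (i -
  1, j) and one free entry; the inclusions of index sets keep these expressions free of
  denominators. Open sets and regular functions let each point choose its own chart, so charts must
  be compared. The chart changes are composed of Gauss-Jordan pivots, exchanging one index at a
  time, instead of quotients of minors. Irreducibility is never invoked. Two polynomials, each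
  nonzero somewhere, are both nonzero at some point of a line; this is why every adapted chart has
  to contain an explicit point of R_n in the standard chart. Density in F^a_n is then inherited
  through the surjection.\<close>

lemma polyfun_minus: "p \<in> polyfun E \<Longrightarrow> q \<in> polyfun E \<Longrightarrow> (\<lambda>x. p x - q x) \<in> polyfun E"
  using polyfun.add[OF _ polyfun.mult[OF polyfun.const[of "-1"]], of p E q] by simp

lemma polyfun_cong_vars:
  assumes "p \<in> polyfun E" "\<And>e. e \<in> E \<Longrightarrow> x e = y e"
  shows "p x = p y"
  using assms by (induction p rule: polyfun.induct) auto

lemma polyfun_comp:
  assumes "p \<in> polyfun E" "\<And>e. e \<in> E \<Longrightarrow> \<rho> e \<in> polyfun F"
  shows "(\<lambda>x. p (\<lambda>e. \<rho> e x)) \<in> polyfun F"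
  using assms by (induction p rule: polyfun.induct) (auto intro: polyfun.intros)

lemma polyfun_mono: "p \<in> polyfun F \<Longrightarrow> F \<subseteq> E \<Longrightarrow> p \<in> polyfun E"
  by (induction p rule: polyfun.induct) (auto intro: polyfun.intros)

text \<open>Congruence modulo the ideal of all \<open>y e - \<rho> e y\<close> is preserved by sums
  and, by telescoping, by products. It yields the ideal generators in
  \<open>smooth_at_graph\<close>.\<close>

lemma polyfun_taylor:
  assumes "p \<in> polyfun E" "finite E" "\<And>e. e \<in> E \<Longrightarrow> \<rho> e \<in> polyfun E"
  shows "\<exists>a. (\<forall>e. a e \<in> polyfun E) \<and>
    (\<forall>y. p y - p (\<lambda>e. \<rho> e y) = (\<Sum>e\<in>E. a e y * (y e - \<rho> e y)))"
  using assms(1)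
proof (induction p rule: polyfun.induct)
  case (const c)
  show ?case by (rule exI[of _ "\<lambda>_ _. 0"]) (auto intro: polyfun.intros)
next
  case (var e0)
  have "(\<Sum>e\<in>E. (if e = e0 then 1 else 0) * (y e - \<rho> e y)) = y e0 - \<rho> e0 y" for y
  proof -
    have "(\<Sum>e\<in>E. (if e = e0 then 1 else 0) * (y e - \<rho> e y))
        = (\<Sum>e\<in>E. if e = e0 then y e - \<rho> e y else 0)"
      by (intro sum.cong) auto
    then show ?thesis using var assms(2) by simp
  qed
  moreover have "(\<lambda>_. if e = e0 then 1 else 0) \<in> polyfun E" for e
    by (rule polyfun.const)
  ultimately show ?case
    by (intro exI[of _ "\<lambda>e _. if e = e0 then 1 else 0"]) auto
next
  case (add p q)
  then obtain a b where a: "\<And>e. a e \<in> polyfun E" "\<And>e. b e \<in> polyfun E"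
    and eq: "\<And>y. p y - p (\<lambda>e. \<rho> e y) = (\<Sum>e\<in>E. a e y * (y e - \<rho> e y))"
      "\<And>y. q y - q (\<lambda>e. \<rho> e y) = (\<Sum>e\<in>E. b e y * (y e - \<rho> e y))"
    by blast
  have "(p y + q y) - (p (\<lambda>e. \<rho> e y) + q (\<lambda>e. \<rho> e y))
      = (\<Sum>e\<in>E. (a e y + b e y) * (y e - \<rho> e y))" for y
    by (simp add: distrib_right sum.distrib flip: eq)
  then show ?case using a
    by (intro exI[of _ "\<lambda>e y. a e y + b e y"]) (auto intro: polyfun.intros)
next
  case (mult p q)
  then obtain a b where a: "\<And>e. a e \<in> polyfun E" "\<And>e. b e \<in> polyfun E"
    and eq: "\<And>y. p y - p (\<lambda>e. \<rho> e y) = (\<Sum>e\<in>E. a e y * (y e - \<rho> e y))"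
      "\<And>y. q y - q (\<lambda>e. \<rho> e y) = (\<Sum>e\<in>E. b e y * (y e - \<rho> e y))"
    by blast
  have "p y * q y - p (\<lambda>e. \<rho> e y) * q (\<lambda>e. \<rho> e y)
      = (\<Sum>e\<in>E. (a e y * q y + p (\<lambda>e. \<rho> e y) * b e y) * (y e - \<rho> e y))" for y
  proof -
    have "p y * q y - p (\<lambda>e. \<rho> e y) * q (\<lambda>e. \<rho> e y)
       = (p y - p (\<lambda>e. \<rho> e y)) * q y + p (\<lambda>e. \<rho> e y) * (q y - q (\<lambda>e. \<rho> e y))"
      by (simp add: algebra_simps)
    also have "\<dots> = (\<Sum>e\<in>E. (a e y * q y + p (\<lambda>e. \<rho> e y) * b e y) * (y e - \<rho> e y))"
      unfolding eq by (simp add: sum_distrib_left sum_distrib_right sum.distrib[symmetric] algebra_simps)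
    finally show ?thesis .
  qed
  moreover have "(\<lambda>y. a e y * q y + p (\<lambda>e. \<rho> e y) * b e y) \<in> polyfun E" for e
    by (intro polyfun.intros a mult polyfun_comp[OF mult(1) assms(3)]) 
  ultimately show ?case
    by (intro exI[of _ "\<lambda>e y. a e y * q y + p (\<lambda>e. \<rho> e y) * b e y"]) auto
qed

lemma polyfun_line:
  assumes "p \<in> polyfun E"
  shows "\<exists>P. \<forall>t. p (\<lambda>e. x e + t * (y e - x e)) = poly P t"
  using assms
proof (induction p rule: polyfun.induct)
  case (const c)
  show ?case by (rule exI[of _ "[:c:]"]) simp
next
  case (var e)
  show ?case by (rule exI[of _ "[:x e, y e - x e:]"]) simp
next
  case (add p q)
  then show ?case by (metis poly_add)
next
  case (mult p q)
  then show ?case by (metis poly_mult)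
qed

text \<open>Stands in for irreducibility of affine space: on the line through \<open>x\<close> and
  \<open>y\<close> both functions restrict to nonzero univariate polynomials, whose product has
  finitely many roots.\<close>

lemma polyfun_common_nonzero:
  assumes "p \<in> polyfun E" "q \<in> polyfun E" "p x \<noteq> 0" "q y \<noteq> 0"
  obtains z where "p z \<noteq> 0" "q z \<noteq> 0"
proof -
  obtain P Q where P: "\<And>t. p (\<lambda>e. x e + t * (y e - x e)) = poly P t"
    and Q: "\<And>t. q (\<lambda>e. x e + t * (y e - x e)) = poly Q t"
    using polyfun_line[OF assms(1)] polyfun_line[OF assms(2)] by metis
  \<comment> \<open>Parameter 0 is the point \<open>x\<close>, parameter 1 the point
    \<open>y\<close>.\<close>
  have "poly P 0 \<noteq> 0" "poly Q 1 \<noteq> 0"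
    using P[of 0] Q[of 1] assms(3,4) by auto
  then have "P * Q \<noteq> 0" by auto
  then have "finite {t. poly (P * Q) t = 0}" by (rule poly_roots_finite)
  then obtain t where "poly (P * Q) t \<noteq> 0"
    using infinite_UNIV_char_0 by (metis (mono_tags, lifting) UNIV_eq_I mem_Collect_eq)
  then show ?thesis using that P Q by (metis mult_eq_0_iff poly_mult)
qed

text \<open>A regular germ at \<open>x\<close>. The formula is required on the whole set where
  \<open>q\<close> is nonzero, so shrinking a neighbourhood amounts to multiplying the denominator
  by another polynomial.\<close>

definition rat_at :: "'e set \<Rightarrow> ('e \<Rightarrow> complex) \<Rightarrow> (('e \<Rightarrow> complex) \<Rightarrow> complex) \<Rightarrow> bool" where
  "rat_at E x f \<longleftrightarrow>
     (\<exists>p\<in>polyfun E. \<exists>q\<in>polyfun E. q x \<noteq> 0 \<and> (\<forall>y. q y \<noteq> 0 \<longrightarrow> f y = p y / q y))"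

lemma rat_at_polyfun: "p \<in> polyfun E \<Longrightarrow> rat_at E x p"
  unfolding rat_at_def by (rule bexI[of _ p], rule bexI[of _ "\<lambda>_. 1"]) (auto intro: polyfun.const)

lemma rat_at_add:
  assumes "rat_at E x f" "rat_at E x h"
  shows "rat_at E x (\<lambda>y. f y + h y)"
proof -
  obtain p q where pq: "p \<in> polyfun E" "q \<in> polyfun E" "q x \<noteq> 0" "\<And>y. q y \<noteq> 0 \<Longrightarrow> f y = p y / q y"
    using assms(1) unfolding rat_at_def by blast
  obtain r s where rs: "r \<in> polyfun E" "s \<in> polyfun E" "s x \<noteq> 0" "\<And>y. s y \<noteq> 0 \<Longrightarrow> h y = r y / s y"
    using assms(2) unfolding rat_at_def by blast
  show ?thesis unfolding rat_at_def
    by (rule bexI[of _ "\<lambda>y. p y * s y + r y * q y"], rule bexI[of _ "\<lambda>y. q y * s y"])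
      (use pq rs in \<open>auto intro!: polyfun.intros simp: field_simps\<close>)
qed

lemma rat_at_mult:
  assumes "rat_at E x f" "rat_at E x h"
  shows "rat_at E x (\<lambda>y. f y * h y)"
proof -
  obtain p q where pq: "p \<in> polyfun E" "q \<in> polyfun E" "q x \<noteq> 0" "\<And>y. q y \<noteq> 0 \<Longrightarrow> f y = p y / q y"
    using assms(1) unfolding rat_at_def by blast
  obtain r s where rs: "r \<in> polyfun E" "s \<in> polyfun E" "s x \<noteq> 0" "\<And>y. s y \<noteq> 0 \<Longrightarrow> h y = r y / s y"
    using assms(2) unfolding rat_at_def by blast
  show ?thesis unfolding rat_at_def
    by (rule bexI[of _ "\<lambda>y. p y * r y"], rule bexI[of _ "\<lambda>y. q y * s y"])
      (use pq rs in \<open>auto intro!: polyfun.intros\<close>)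
qed

lemma rat_at_divide:
  assumes "rat_at E x f" "rat_at E x h" "h x \<noteq> 0"
  shows "rat_at E x (\<lambda>y. f y / h y)"
proof -
  obtain p q where pq: "p \<in> polyfun E" "q \<in> polyfun E" "q x \<noteq> 0" "\<And>y. q y \<noteq> 0 \<Longrightarrow> f y = p y / q y"
    using assms(1) unfolding rat_at_def by blast
  obtain r s where rs: "r \<in> polyfun E" "s \<in> polyfun E" "s x \<noteq> 0" "\<And>y. s y \<noteq> 0 \<Longrightarrow> h y = r y / s y"
    using assms(2) unfolding rat_at_def by blast
  have "r x \<noteq> 0" using rs assms(3) by auto
  then show ?thesis unfolding rat_at_def
    by (intro bexI[of _ "\<lambda>y. p y * (s y * s y)"] bexI[of _ "\<lambda>y. q y * (s y * r y)"])
      (use pq rs in \<open>auto intro!: polyfun.intros\<close>)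
qed

lemma rat_at_comp_polyfun:
  assumes "p \<in> polyfun E" "\<And>e. e \<in> E \<Longrightarrow> rat_at F x (\<rho> e)"
  shows "rat_at F x (\<lambda>y. p (\<lambda>e. \<rho> e y))"
  using assms
proof (induction p rule: polyfun.induct)
  case (const c)
  show ?case by (intro rat_at_polyfun polyfun.const)
qed (auto intro: rat_at_add rat_at_mult)

text \<open>Locality of germs on a neighbourhood cut out by a function that is itself only rational,
  as happens to denominators under composition.\<close>

lemma rat_at_cong:
  assumes "rat_at F x f" "rat_at F x h" "h x \<noteq> 0" "\<And>y. h y \<noteq> 0 \<Longrightarrow> f' y = f y"
  shows "rat_at F x f'"
proof -
  obtain p q where pq: "p \<in> polyfun F" "q \<in> polyfun F" "q x \<noteq> 0" "\<And>y. q y \<noteq> 0 \<Longrightarrow> f y = p y / q y"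
    using assms(1) unfolding rat_at_def by blast
  obtain r s where rs: "r \<in> polyfun F" "s \<in> polyfun F" "s x \<noteq> 0" "\<And>y. s y \<noteq> 0 \<Longrightarrow> h y = r y / s y"
    using assms(2) unfolding rat_at_def by blast
  have "r x \<noteq> 0" using rs assms(3) by auto
  \<comment> \<open>The extra factor \<open>r y * s y\<close> is nonzero only where
    \<open>h y \<noteq> 0\<close>.\<close>
  then show ?thesis unfolding rat_at_def
    by (intro bexI[of _ "\<lambda>y. p y * (r y * s y)"] bexI[of _ "\<lambda>y. q y * (r y * s y)"])
      (use pq rs assms(4) in \<open>auto intro!: polyfun.intros\<close>)
qed

lemma rat_at_comp:
  assumes "rat_at E (\<lambda>e. \<rho> e x) f" "\<And>e. e \<in> E \<Longrightarrow> rat_at F x (\<rho> e)"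
  shows "rat_at F x (\<lambda>y. f (\<lambda>e. \<rho> e y))"
proof -
  obtain p q where pq: "p \<in> polyfun E" "q \<in> polyfun E" "q (\<lambda>e. \<rho> e x) \<noteq> 0"
      "\<And>y. q y \<noteq> 0 \<Longrightarrow> f y = p y / q y"
    using assms(1) unfolding rat_at_def by blast
  let ?q = "\<lambda>y. q (\<lambda>e. \<rho> e y)"
  have q: "rat_at F x ?q" using pq(2) assms(2) by (rule rat_at_comp_polyfun)
  let ?p = "\<lambda>y. p (\<lambda>e. \<rho> e y)"
  have p: "rat_at F x ?p" using pq(1) assms(2) by (rule rat_at_comp_polyfun)
  have "rat_at F x (\<lambda>y. ?p y / ?q y)"
    using rat_at_divide[of F x ?p ?q] p q pq(3) by simp
  then show ?thesis
    by (rule rat_at_cong[where h = ?q]) (use q pq in auto)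
qed

lemma rat_at_nonzero:
  assumes "rat_at E x f" "f x \<noteq> 0"
  obtains g where "g \<in> polyfun E" "g x \<noteq> 0" "\<And>y. g y \<noteq> 0 \<Longrightarrow> f y \<noteq> 0"
proof -
  obtain p q where pq: "p \<in> polyfun E" "q \<in> polyfun E" "q x \<noteq> 0" "\<And>y. q y \<noteq> 0 \<Longrightarrow> f y = p y / q y"
    using assms(1) unfolding rat_at_def by blast
  show ?thesis
    by (rule that[of "\<lambda>y. p y * q y"]) (use pq assms(2) in \<open>auto intro: polyfun.intros\<close>)
qed

section \<open>Subspaces in graph form\<close>

abbreviation "cscale \<equiv> (\<lambda>(c::complex) (v::nat \<Rightarrow> complex) i. c * v i)"

lemma sum_fun_apply: "(\<Sum>j\<in>S. f j) l = (\<Sum>j\<in>S. f j l)"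
  for f :: "'a \<Rightarrow> 'b \<Rightarrow> complex"
  by (induction S rule: infinite_finite_induct) auto

text \<open>The row space of a matrix with identity block in the columns \<open>J\<close>, encoded
  by equations instead of spanning rows, so that membership and inclusion become identities between
  entries.\<close>

definition graph_space :: "nat \<Rightarrow> nat set \<Rightarrow> (nat \<Rightarrow> nat \<Rightarrow> complex) \<Rightarrow> (nat \<Rightarrow> complex) set" where
  "graph_space n J m = {v. (\<forall>l. l \<notin> {1..n} \<longrightarrow> v l = 0) \<and>
     (\<forall>l\<in>{1..n} - J. v l = (\<Sum>i\<in>J. v i * m i l))}"

definition graph_row :: "nat \<Rightarrow> nat set \<Rightarrow> (nat \<Rightarrow> nat \<Rightarrow> complex) \<Rightarrow> nat \<Rightarrow> nat \<Rightarrow> complex" where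
  "graph_row n J m i = (\<lambda>l. if l = i then 1 else if l \<in> {1..n} - J then m i l else 0)"

lemma subspace_iff:
  "cfun.subspace S \<longleftrightarrow> 0 \<in> S \<and> (\<forall>u\<in>S. \<forall>v\<in>S. u + v \<in> S) \<and> (\<forall>c. \<forall>v\<in>S. (\<lambda>i. c * v i) \<in> S)"
  by (auto simp: cfun.subspace_def)

lemma subspace_graph_space: "cfun.subspace (graph_space n J m)"
  unfolding subspace_iff graph_space_def
  by (auto simp: sum.distrib distrib_right sum_distrib_left mult.assoc)

lemma graph_row_eq:
  assumes "i \<in> J"
  shows "w_vec i + (\<Sum>j\<in>{1..n} - J. (\<lambda>l. m i j * w_vec j l)) = graph_row n J m i"
proof
  fix l
  have "(\<Sum>j\<in>{1..n} - J. m i j * w_vec j l) = (if l \<in> {1..n} - J then m i l else 0)"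
  proof -
    have "(\<Sum>j\<in>{1..n} - J. m i j * w_vec j l) = (\<Sum>j\<in>{1..n} - J. if l = j then m i j else 0)"
      by (intro sum.cong) (auto simp: w_vec_def)
    then show ?thesis by simp
  qed
  then show "(w_vec i + (\<Sum>j\<in>{1..n} - J. (\<lambda>l. m i j * w_vec j l))) l = graph_row n J m i l"
    using assms by (auto simp: sum_fun_apply graph_row_def w_vec_def)
qed

lemma graph_row_in:
  assumes "J \<subseteq> {1..n}" "i \<in> J"
  shows "graph_row n J m i \<in> graph_space n J m"
proof -
  have fin: "finite J" using assms(1) finite_subset by blast
  have "(\<Sum>a\<in>J. graph_row n J m i a * m a l) = m i l" for l
  proof -
    have "(\<Sum>a\<in>J. graph_row n J m i a * m a l) = (\<Sum>a\<in>J. if a = i then m a l else 0)"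
      by (intro sum.cong) (auto simp: graph_row_def)
    then show ?thesis using fin assms(2) by simp
  qed
  then show ?thesis using assms by (auto simp: graph_space_def graph_row_def)
qed

lemma graph_space_decomp:
  assumes "J \<subseteq> {1..n}" "v \<in> graph_space n J m"
  shows "v = (\<Sum>i\<in>J. (\<lambda>l. v i * graph_row n J m i l))"
proof
  fix l
  have fin: "finite J" using assms(1) finite_subset by blast
  have *: "(\<Sum>i\<in>J. v i * graph_row n J m i l)
      = (if l \<in> J then v l else if l \<in> {1..n} then (\<Sum>i\<in>J. v i * m i l) else 0)"
  proof (cases "l \<in> J")
    case True
    then have "(\<Sum>i\<in>J. v i * graph_row n J m i l) = (\<Sum>i\<in>J. if l = i then v i else 0)"
      by (intro sum.cong) (auto simp: graph_row_def)
    then show ?thesis using True fin by simp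
  next
    case False
    then show ?thesis
      by (auto intro!: sum.cong sum.neutral simp: graph_row_def)
  qed
  then show "v l = (\<Sum>i\<in>J. (\<lambda>l. v i * graph_row n J m i l)) l"
    using assms(2) by (auto simp: sum_fun_apply graph_space_def)
qed

lemma span_graph_rows:
  assumes "J \<subseteq> {1..n}"
  shows "cfun.span (graph_row n J m ` J) = graph_space n J m"
proof
  show "cfun.span (graph_row n J m ` J) \<subseteq> graph_space n J m"
    by (rule cfun.span_minimal) (use graph_row_in[OF assms] subspace_graph_space in auto)
  show "graph_space n J m \<subseteq> cfun.span (graph_row n J m ` J)"
  proof
    fix v assume "v \<in> graph_space n J m"
    then show "v \<in> cfun.span (graph_row n J m ` J)"
      by (subst graph_space_decomp[OF assms])
        (auto intro!: cfun.span_sum cfun.span_scale intro: cfun.span_base)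
  qed
qed

lemma graph_space_eqI_zero:
  assumes "J \<subseteq> {1..n}" "v \<in> graph_space n J m" "\<And>i. i \<in> J \<Longrightarrow> v i = 0"
  shows "v = 0"
  using graph_space_decomp[OF assms(1,2)] assms(3) by (simp add: fun_eq_iff sum_fun_apply)

lemma independent_graph_rows:
  assumes "J \<subseteq> {1..n}"
  shows "cfun.independent (graph_row n J m ` J)" "card (graph_row n J m ` J) = card J"
proof -
  have fin: "finite J" using assms(1) finite_subset by blast
  have row: "graph_row n J m i a = (if a = i then 1 else 0)" if "a \<in> J" for i a
    using that by (auto simp: graph_row_def)
  have inj: "inj_on (graph_row n J m) J"
    by (rule inj_onI) (metis row zero_neq_one)
  then show "card (graph_row n J m ` J) = card J" by (rule card_image)
  show "cfun.independent (graph_row n J m ` J)"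
  proof (rule cfun.independent_if_scalars_zero)
    show "finite (graph_row n J m ` J)" using fin by simp
    fix f x assume 0: "(\<Sum>x\<in>graph_row n J m ` J. (\<lambda>i. f x * x i)) = 0" and "x \<in> graph_row n J m ` J"
    then obtain a where a: "a \<in> J" "x = graph_row n J m a" by blast
    have "0 = (\<Sum>x\<in>graph_row n J m ` J. (\<lambda>i. f x * x i)) a" by (simp add: 0)
    also have "\<dots> = (\<Sum>i\<in>J. f (graph_row n J m i) * graph_row n J m i a)"
      using inj by (simp add: sum_fun_apply sum.reindex)
    also have "\<dots> = (\<Sum>i\<in>J. if a = i then f (graph_row n J m i) else 0)"
      using row a by (intro sum.cong) auto
    also have "\<dots> = f x" using a fin by simp
    finally show "f x = 0" by simp
  qed
qed

lemma dim_graph_space: "J \<subseteq> {1..n} \<Longrightarrow> cfun.dim (graph_space n J m) = card J"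
  using independent_graph_rows[of J n m] span_graph_rows[of J n m]
    cfun.dim_span_eq_card_independent by metis

text \<open>The two rows with index \<open>i\<close> differ by a vector of the common space that
  vanishes on \<open>J\<close>, hence by zero.\<close>

lemma graph_space_coeff_unique:
  assumes "J \<subseteq> {1..n}" "graph_space n J m = graph_space n J m'" "i \<in> J" "l \<in> {1..n} - J"
  shows "m i l = m' i l"
proof -
  have "graph_row n J m i \<in> graph_space n J m" "graph_row n J m' i \<in> graph_space n J m"
    using graph_row_in[OF assms(1,3)] assms(2) by auto
  then have "graph_row n J m i - graph_row n J m' i \<in> graph_space n J m"
    by (rule cfun.subspace_diff[OF subspace_graph_space])
  moreover have "(graph_row n J m i - graph_row n J m' i) a = 0" if "a \<in> J" for a
    using that by (auto simp: graph_row_def)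
  ultimately have "graph_row n J m i - graph_row n J m' i = 0"
    using graph_space_eqI_zero[OF assms(1)] by blast
  then have "graph_row n J m i l = graph_row n J m' i l" by simp
  then show ?thesis using assms(3,4) by (auto simp: graph_row_def split: if_splits)
qed

section \<open>Coordinate subspaces and dimension counts\<close>

definition coord_space :: "nat set \<Rightarrow> (nat \<Rightarrow> complex) set" where
  "coord_space S = {v. \<forall>l. l \<notin> S \<longrightarrow> v l = 0}"

lemma coord_space_eq_graph: "S \<subseteq> {1..n} \<Longrightarrow> coord_space S = graph_space n S (\<lambda>_ _. 0)"
  by (fastforce simp: coord_space_def graph_space_def subset_eq)

lemma span_w_vec:
  assumes "S \<subseteq> {1..n}" shows "cfun.span (w_vec ` S) = coord_space S"
proof -
  have "graph_row n S (\<lambda>_ _. 0) i = w_vec i" for i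
    by (auto simp: graph_row_def w_vec_def)
  then show ?thesis
    using span_graph_rows[OF assms, of "\<lambda>_ _. 0"] coord_space_eq_graph[OF assms] by simp
qed

lemma W_space_eq: "W_space n = coord_space {1..n}"
  unfolding W_space_def by (rule span_w_vec[of _ n]) simp

lemma W_sub_eq: "i \<le> n \<Longrightarrow> W_sub n i j = coord_space ({1..i} \<union> {j+1..n})"
  unfolding W_sub_def by (rule span_w_vec[of _ n]) auto

lemma dim_coord_space: "S \<subseteq> {1..n} \<Longrightarrow> cfun.dim (coord_space S) = card S"
  by (simp add: coord_space_eq_graph dim_graph_space)

lemma graph_space_subset_W: "graph_space n J m \<subseteq> W_space n"
  by (auto simp: graph_space_def W_space_eq coord_space_def)

lemma finite_independent_W:
  assumes "cfun.independent B" "B \<subseteq> W_space n"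
  shows "finite B"
proof -
  have "finite (w_vec ` {1..n})" by simp
  from cfun.independent_span_bound[OF this assms(1)] show ?thesis
    using assms(2) unfolding W_space_def by blast
qed

lemma subspace_dim_equal:
  assumes "cfun.subspace S" "S \<subseteq> T" "T \<subseteq> W_space n" "cfun.dim S = cfun.dim T"
  shows "S = T"
proof -
  obtain B where B: "B \<subseteq> S" "cfun.independent B" "S \<subseteq> cfun.span B" "card B = cfun.dim S"
    by (rule cfun.basis_exists)
  obtain B' where B': "B \<subseteq> B'" "B' \<subseteq> T" "cfun.independent B'" "T \<subseteq> cfun.span B'"
    using cfun.maximal_independent_subset_extend[of B T] B(1,2) assms(2) by blast
  have "finite B'" using finite_independent_W B' assms(3) by blast
  moreover have "card B' = cfun.dim T" using B' cfun.basis_card_eq_dim by blast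
  ultimately have "B = B'" using B(4) B'(1) assms(4) by (metis card_subset_eq)
  moreover have "cfun.span B \<subseteq> S" using B(1) assms(1) by (rule cfun.span_minimal)
  ultimately show ?thesis using B' assms(2) by blast
qed

text \<open>Projection to the coordinates in \<open>J\<close> is injective on \<open>B\<close> and,
  by equality of dimensions, onto \<open>coord_space J\<close>; the preimages of the
  \<open>w_vec j\<close> are the rows of the matrix.\<close>

lemma graph_space_if_injective:
  assumes "cfun.subspace B" "B \<subseteq> W_space n" "J \<subseteq> {1..n}" "cfun.dim B = card J"
    and inj: "\<And>v. v \<in> B \<Longrightarrow> (\<And>j. j \<in> J \<Longrightarrow> v j = 0) \<Longrightarrow> v = 0"
  obtains m where "B = graph_space n J m"
proof -
  define P :: "(nat \<Rightarrow> complex) \<Rightarrow> nat \<Rightarrow> complex" where "P v = (\<lambda>l. if l \<in> J then v l else 0)" for v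
  interpret P: Vector_Spaces.linear cscale cscale P
    by unfold_locales (auto simp: P_def fun_eq_iff algebra_simps)
  have injP: "inj_on P B"
  proof (rule inj_onI)
    fix u v assume uv: "u \<in> B" "v \<in> B" "P u = P v"
    have "u - v \<in> B" using uv assms(1) by (simp add: cfun.subspace_diff)
    moreover have "(u - v) j = 0" if "j \<in> J" for j
      using fun_cong[OF uv(3), of j] that by (simp add: P_def)
    ultimately have "u - v = 0" by (rule inj)
    then show "u = v" by simp
  qed
  obtain b where b: "b \<subseteq> B" "cfun.independent b" "B \<subseteq> cfun.span b" "card b = cfun.dim B"
    by (rule cfun.basis_exists)
  have spb: "cfun.span b = B" using cfun.span_minimal[OF b(1) assms(1)] b(3) by blast
  have ind: "cfun.independent (P ` b)" using b(2) injP spb by (intro P.independent_injective_image) auto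
  have "card (P ` b) = card b" using injP b(1) by (metis card_image inj_on_subset)
  then have "cfun.dim (cfun.span (P ` b)) = cfun.dim (coord_space J)"
    using cfun.dim_span_eq_card_independent[OF ind] b(4) assms(4) dim_coord_space[OF assms(3)] by simp
  moreover have "cfun.span (P ` b) \<subseteq> coord_space J"
    unfolding P.span_image by (auto simp: P_def coord_space_def)
  ultimately have "cfun.span (P ` b) = coord_space J"
    using assms(3) by (intro subspace_dim_equal[where n = n]) (auto simp: W_space_eq coord_space_def)
  then have PB: "P ` B = coord_space J" using P.span_image spb by simp
  have "\<forall>j\<in>J. \<exists>u\<in>B. P u = w_vec j"
  proof
    fix j assume "j \<in> J"
    then have "w_vec j \<in> P ` B" unfolding PB by (auto simp: coord_space_def w_vec_def)
    then show "\<exists>u\<in>B. P u = w_vec j" by (metis imageE)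
  qed
  then obtain u where u: "\<And>j. j \<in> J \<Longrightarrow> u j \<in> B" "\<And>j. j \<in> J \<Longrightarrow> P (u j) = w_vec j"
    by metis
  have "graph_row n J u j = u j" if "j \<in> J" for j
  proof
    fix l
    have "u j l = w_vec j l" if "l \<in> J"
      using fun_cong[OF u(2)[OF \<open>j \<in> J\<close>], of l] that by (simp add: P_def)
    moreover have "u j l = 0" if "l \<notin> {1..n}"
      using u(1)[OF \<open>j \<in> J\<close>] assms(2) that by (auto simp: W_space_eq coord_space_def)
    ultimately show "graph_row n J u j l = u j l"
      using \<open>j \<in> J\<close> by (auto simp: graph_row_def w_vec_def)
  qed
  then have "graph_row n J u ` J \<subseteq> B" using u(1) by auto
  then have "graph_space n J u \<subseteq> B"
    using cfun.span_minimal[OF _ assms(1)] span_graph_rows[OF assms(3)] by metis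
  then have "graph_space n J u = B"
    using dim_graph_space[OF assms(3)] assms(2,4) subspace_graph_space by (metis subspace_dim_equal)
  then show ?thesis using that by blast
qed

lemma exists_subspace_between:
  assumes "cfun.subspace A" "cfun.subspace C" "A \<subseteq> C" "C \<subseteq> W_space n"
    and "cfun.dim A \<le> d" "d \<le> cfun.dim C"
  obtains S where "cfun.subspace S" "A \<subseteq> S" "S \<subseteq> C" "cfun.dim S = d"
proof -
  obtain B where B: "B \<subseteq> A" "cfun.independent B" "A \<subseteq> cfun.span B" "card B = cfun.dim A"
    by (rule cfun.basis_exists)
  obtain B' where B': "B \<subseteq> B'" "B' \<subseteq> C" "cfun.independent B'" "C \<subseteq> cfun.span B'"
    using cfun.maximal_independent_subset_extend[of B C] B(1,2) assms(3) by blast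
  have fin: "finite B'" using finite_independent_W B' assms(4) by blast
  have "card B' = cfun.dim C" using B' cfun.basis_card_eq_dim by blast
  then obtain T where T: "B \<subseteq> T" "T \<subseteq> B'" "card T = d"
    using exists_subset_between[of B d B'] B B' assms(5,6) fin by auto
  have "cfun.independent T" using T(2) B'(3) cfun.independent_mono by blast
  then have "cfun.dim (cfun.span T) = d" using T(3) by (simp add: cfun.dim_eq_card_independent)
  moreover have "A \<subseteq> cfun.span T" using B(3) T(1) cfun.span_mono by blast
  moreover have "cfun.span T \<subseteq> C" using T(2) B'(2) assms(2) by (intro cfun.span_minimal) auto
  ultimately show ?thesis using that by blast
qed

text \<open>One vector of \<open>C\<close> with nonzero coordinate \<open>a\<close> spans
  \<open>C\<close> together with the section, as subtracting a multiple of it clears that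
  coordinate.\<close>

lemma dim_hyperplane_section:
  assumes "cfun.subspace C" "C \<subseteq> W_space n"
  shows "cfun.dim C \<le> Suc (cfun.dim {v \<in> C. v a = 0})"
proof -
  let ?C = "{v \<in> C. v a = 0}"
  obtain B where B: "B \<subseteq> ?C" "cfun.independent B" "?C \<subseteq> cfun.span B" "card B = cfun.dim ?C"
    by (rule cfun.basis_exists)
  have fin: "finite B" using B(1,2) assms(2) by (intro finite_independent_W) auto
  show ?thesis
  proof (cases "\<exists>v\<in>C. v a \<noteq> 0")
    case False
    then have "?C = C" by auto
    then show ?thesis by simp
  next
    case True
    then obtain v where v: "v \<in> C" "v a \<noteq> 0" by blast
    have "C \<subseteq> cfun.span (insert v B)"
    proof
      fix u assume u: "u \<in> C"
      let ?k = "u a / v a"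
      have "(\<lambda>i. ?k * v i) \<in> C" using v(1) assms(1) unfolding subspace_iff by blast
      then have "u - (\<lambda>i. ?k * v i) \<in> ?C"
        using u v(2) by (auto simp: cfun.subspace_diff[OF assms(1)])
      then have "u - (\<lambda>i. ?k * v i) \<in> cfun.span (insert v B)"
        using B(3) cfun.span_mono[of B "insert v B"] by blast
      moreover have "(\<lambda>i. ?k * v i) \<in> cfun.span (insert v B)"
        by (intro cfun.span_scale cfun.span_base) simp
      ultimately have "(u - (\<lambda>i. ?k * v i)) + (\<lambda>i. ?k * v i) \<in> cfun.span (insert v B)"
        by (rule cfun.span_add)
      then show "u \<in> cfun.span (insert v B)" by simp
    qed
    then have "cfun.dim C \<le> card (insert v B)" using fin by (intro cfun.dim_le_card) auto
    also have "\<dots> \<le> Suc (card B)" by (rule card_insert_le_m1) auto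
    finally show ?thesis using B(4) by simp
  qed
qed

lemma dim_linear_image_le:
  assumes "Vector_Spaces.linear cscale cscale f" "A \<subseteq> W_space n" "cfun.subspace A"
  shows "cfun.dim (f ` A) \<le> cfun.dim A"
proof -
  interpret f: Vector_Spaces.linear cscale cscale f by fact
  obtain B where B: "B \<subseteq> A" "cfun.independent B" "A \<subseteq> cfun.span B" "card B = cfun.dim A"
    by (rule cfun.basis_exists)
  have fin: "finite B" using B(1,2) assms(2) by (intro finite_independent_W) auto
  have "f ` A \<subseteq> cfun.span (f ` B)" unfolding f.span_image using B(3) by blast
  then have "cfun.dim (f ` A) \<le> card (f ` B)" using fin by (intro cfun.dim_le_card) auto
  also have "\<dots> \<le> card B" using fin by (rule card_image_le)
  finally show ?thesis using B(4) by simp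
qed

section \<open>Charts of products of Grassmannians\<close>

lemma graph_space_cong:
  assumes "\<And>i l. i \<in> J \<Longrightarrow> l \<in> {1..n} - J \<Longrightarrow> m i l = m' i l"
  shows "graph_space n J m = graph_space n J m'"
proof -
  have "(\<Sum>i\<in>J. v i * m i l) = (\<Sum>i\<in>J. v i * m' i l)" if "l \<in> {1..n} - J" for v l
    using assms that by (intro sum.cong) auto
  then show ?thesis unfolding graph_space_def by (metis (no_types, lifting))
qed

definition chart_index :: "nat \<Rightarrow> 'k set \<Rightarrow> ('k \<Rightarrow> nat) \<Rightarrow> ('k \<Rightarrow> nat set) \<Rightarrow> bool" where
  "chart_index n K d I \<longleftrightarrow> (\<forall>k\<in>K. I k \<subseteq> {1..n} \<and> card (I k) = d k)"

lemma Gr_atlas_iff: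
  "(E, \<phi>) \<in> Gr_atlas n K d \<longleftrightarrow>
     (\<exists>I. chart_index n K d I \<and> E = Gr_chart_vars n K I \<and> \<phi> = Gr_chart n K I)"
  by (auto simp: Gr_atlas_def chart_index_def)

lemma Gr_chart_apply:
  assumes "chart_index n K d I" "k \<in> K"
  shows "Gr_chart n K I x k = graph_space n (I k) (\<lambda>i j. x (k, i, j))"
proof -
  have "(\<lambda>i. w_vec i + (\<Sum>j\<in>{1..n} - I k. (\<lambda>l. x (k, i, j) * w_vec j l))) ` I k
      = graph_row n (I k) (\<lambda>i j. x (k, i, j)) ` I k"
    by (intro image_cong refl graph_row_eq)
  then show ?thesis
    using assms span_graph_rows[of "I k" n] by (simp add: Gr_chart_def chart_index_def)
qed

lemma Gr_chart_eqI:
  assumes "\<And>k. k \<in> K \<Longrightarrow> Gr_chart n K I x k = Gr_chart n K I' x' k"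
  shows "Gr_chart n K I x = Gr_chart n K I' x'"
proof
  fix k show "Gr_chart n K I x k = Gr_chart n K I' x' k"
    using assms[of k] by (cases "k \<in> K") (auto simp: Gr_chart_def)
qed

lemma Gr_chart_in_Gr_prod:
  assumes "chart_index n K d I"
  shows "Gr_chart n K I x \<in> Gr_prod n K d"
proof -
  have "Gr_chart n K I x k \<in> Gr (d k) n" if "k \<in> K" for k
    using assms that
    by (auto simp: Gr_def Gr_chart_apply[OF assms that] subspace_graph_space dim_graph_space chart_index_def
        dest: subsetD[OF graph_space_subset_W])
  then show ?thesis by (auto simp: Gr_prod_def Gr_chart_def)
qed

lemma inj_on_Gr_chart:
  assumes "chart_index n K d I"
  shows "inj_on (Gr_chart n K I) (affine_space (Gr_chart_vars n K I))"
proof (rule inj_onI)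
  fix x y assume xy: "x \<in> affine_space (Gr_chart_vars n K I)" "y \<in> affine_space (Gr_chart_vars n K I)"
    "Gr_chart n K I x = Gr_chart n K I y"
  have "x (k, i, j) = y (k, i, j)" for k i j
  proof (cases "(k, i, j) \<in> Gr_chart_vars n K I")
    case True
    then have "k \<in> K" "i \<in> I k" "j \<in> {1..n} - I k" by (auto simp: Gr_chart_vars_def)
    moreover have "I k \<subseteq> {1..n}" using assms \<open>k \<in> K\<close> by (auto simp: chart_index_def)
    moreover have "graph_space n (I k) (\<lambda>i j. x (k, i, j)) = graph_space n (I k) (\<lambda>i j. y (k, i, j))"
      using fun_cong[OF xy(3), of k] Gr_chart_apply[OF assms \<open>k \<in> K\<close>] by simp
    ultimately show ?thesis using graph_space_coeff_unique by blast
  next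
    case False
    then show ?thesis using xy by (auto simp: affine_space_def)
  qed
  then show "x = y" by (auto simp: fun_eq_iff)
qed

text \<open>The Gauss-Jordan exchange of \<open>i\<close> for \<open>j\<close>: row \<open>i\<close>
  divided by \<open>m i j\<close> becomes row \<open>j\<close>, and it is used to clear column
  \<open>j\<close> in the other rows.\<close>

definition pivot :: "(nat \<Rightarrow> nat \<Rightarrow> complex) \<Rightarrow> nat \<Rightarrow> nat \<Rightarrow> nat \<Rightarrow> nat \<Rightarrow> complex" where
  "pivot m i j a b =
     (if a = j then (if b = i then 1 / m i j else m i b / m i j)
      else if b = i then - m a j / m i j else m a b - m a j * m i b / m i j)"

text \<open>Only the equation at \<open>j\<close> changes its role: it is solved for
  \<open>v i\<close>, and the result is substituted into the others.\<close>

lemma graph_space_pivot: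
  assumes J: "J \<subseteq> {1..n}" "i \<in> J" "j \<in> {1..n} - J" and nz: "m i j \<noteq> 0"
  shows "graph_space n J m = graph_space n (insert j (J - {i})) (pivot m i j)"
proof -
  define J0 where "J0 = J - {i}"
  have fin: "finite J0" using J(1) finite_subset by (auto simp: J0_def)
  have J0: "J = insert i J0" "i \<notin> J0" "j \<notin> J0" "i \<noteq> j" using J by (auto simp: J0_def)
  have "v \<in> graph_space n J m \<longleftrightarrow> v \<in> graph_space n (insert j J0) (pivot m i j)" for v
  proof -
    define s where "s l = (\<Sum>a\<in>J0. v a * m a l)" for l
    have old: "(\<Sum>a\<in>J. v a * m a l) = v i * m i l + s l" for l
      using fin J0 by (simp add: s_def)
    have new_sum: "(\<Sum>a\<in>J0. v a * pivot m i j a l)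
        = (if l = i then - s j / m i j else s l - s j * m i l / m i j)" for l
    proof -
      have "(\<Sum>a\<in>J0. v a * pivot m i j a l) = (\<Sum>a\<in>J0. if l = i then - (v a * m a j) / m i j
          else v a * m a l - v a * m a j * m i l / m i j)"
        using J0 by (intro sum.cong) (auto simp: pivot_def right_diff_distrib)
      then show ?thesis
        by (simp add: s_def sum_subtractf sum_divide_distrib[symmetric] sum_distrib_right sum_negf)
    qed
    have new: "(\<Sum>a\<in>insert j J0. v a * pivot m i j a l)
        = (if l = i then (v j - s j) / m i j else (v j - s j) / m i j * m i l + s l)" for l
      using fin J0 nz by (simp add: new_sum) (simp add: pivot_def field_simps)
    have step: "v j = v i * m i j + s j \<longleftrightarrow> v i = (v j - s j) / m i j"
      using nz by (auto simp: field_simps)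
    have vars: "{1..n} - J = insert j ({1..n} - insert i (insert j J0))"
      "{1..n} - insert j J0 = insert i ({1..n} - insert i (insert j J0))"
      using J J0 by auto
    have i: "l \<noteq> i" if "l \<in> {1..n} - insert i (insert j J0)" for l using that by auto
    show ?thesis
      unfolding graph_space_def mem_Collect_eq old new vars ball_simps
      using step i by (smt (verit, best))
  qed
  then show ?thesis unfolding J0_def by blast
qed

text \<open>Otherwise row \<open>i\<close> of the first matrix vanishes on all of \<open>J'\<close>
  yet belongs to the second graph, so it would be zero although its entry at \<open>i\<close> is
  1.\<close>

lemma exists_pivot:
  assumes "J \<subseteq> {1..n}" "J' \<subseteq> {1..n}" "graph_space n J m = graph_space n J' m'" "i \<in> J - J'"
  obtains j where "j \<in> J' - J" "m i j \<noteq> 0"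
proof -
  have "\<exists>j\<in>J' - J. m i j \<noteq> 0"
  proof (rule ccontr)
    assume "\<not> (\<exists>j\<in>J' - J. m i j \<noteq> 0)"
    then have "graph_row n J m i l = 0" if "l \<in> J'" for l
      using that assms(4) by (auto simp: graph_row_def)
    moreover have "graph_row n J m i \<in> graph_space n J' m'"
      using graph_row_in[of J n i m] assms by auto
    ultimately have "graph_row n J m i = 0" by (intro graph_space_eqI_zero[OF assms(2)])
    then have "graph_row n J m i i = 0" by simp
    then show False by (simp add: graph_row_def)
  qed
  then show ?thesis using that by blast
qed

text \<open>One exchange as a change of coordinates: the pivot entry is the only denominator, so the
  new coordinates are rational where it is nonzero.\<close>

lemma Gr_chart_pivot:
  assumes I: "chart_index n K d I" and k: "k \<in> K" "i \<in> I k" "j \<in> {1..n} - I k" and "x (k, i, j) \<noteq> 0"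
  defines "I1 \<equiv> I(k := insert j (I k - {i}))"
  shows "chart_index n K d I1"
    and "\<exists>\<sigma>. (\<forall>e. rat_at (Gr_chart_vars n K I) x (\<sigma> e)) \<and>
      (\<forall>y. (\<lambda>e. \<sigma> e y) \<in> affine_space (Gr_chart_vars n K I1)) \<and>
      (\<forall>y. y (k, i, j) \<noteq> 0 \<longrightarrow> Gr_chart n K I y = Gr_chart n K I1 (\<lambda>e. \<sigma> e y))"
proof -
  have Ik: "I k \<subseteq> {1..n}" "finite (I k)" "card (I k) = d k"
    using I k finite_subset[of "I k"] by (auto simp: chart_index_def)
  have "card (insert j (I k - {i})) = card (I k)"
    using k Ik by (metis card_Suc_Diff1 card_insert_disjoint finite_Diff DiffD1 DiffD2)
  then show I1: "chart_index n K d I1"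
    using I k Ik by (auto simp: chart_index_def I1_def)
  \<comment> \<open>The value 0 off the new chart variables puts the result into
    \<open>affine_space\<close>, where charts are injective.\<close>
  define \<sigma> where "\<sigma> = (\<lambda>(k', a, b) y. if (k', a, b) \<in> Gr_chart_vars n K I1
     then (if k' = k then pivot (\<lambda>a b. y (k, a, b)) i j a b else y (k', a, b)) else (0::complex))"
  have "rat_at (Gr_chart_vars n K I) x (\<sigma> (k', a, b))" for k' a b
  proof (cases "(k', a, b) \<in> Gr_chart_vars n K I1")
    case False
    then show ?thesis by (auto simp: \<sigma>_def intro: rat_at_polyfun polyfun.const)
  next
    case True
    show ?thesis
    proof (cases "k' = k")
      case False
      then show ?thesis using True
        by (auto simp: \<sigma>_def Gr_chart_vars_def I1_def intro!: rat_at_polyfun polyfun.var)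
    next
      case k': True
      let ?E = "Gr_chart_vars n K I"
      have v: "rat_at ?E x (\<lambda>y. y (k, a, b))" if "a \<in> I k" "b \<in> {1..n} - I k" for a b
        using that k by (intro rat_at_polyfun polyfun.var) (auto simp: Gr_chart_vars_def)
      have c: "rat_at ?E x (\<lambda>y. c)" for c by (intro rat_at_polyfun polyfun.const)
      have neg: "rat_at ?E x (\<lambda>y. - f y)" if "rat_at ?E x f" for f
        using rat_at_mult[OF c[of "-1"] that] by simp
      have dv: "rat_at ?E x (\<lambda>y. f y / y (k, i, j))" if "rat_at ?E x f" for f
        using rat_at_divide[OF that v[OF k(2,3)]] assms(5) by simp
      have sub: "rat_at ?E x (\<lambda>y. f y - h y)" if "rat_at ?E x f" "rat_at ?E x h" for f h
        using rat_at_add[OF that(1) neg[OF that(2)]] by simp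
      have ab: "a \<in> insert j (I k - {i})" "b \<in> {1..n}" "b \<notin> insert j (I k - {i})"
        using True k' by (auto simp: Gr_chart_vars_def I1_def)
      have eq: "\<sigma> (k', a, b) = (\<lambda>y. pivot (\<lambda>a b. y (k, a, b)) i j a b)"
        using True k' by (simp add: \<sigma>_def)
      consider "a = j" "b = i" | "a = j" "b \<noteq> i" | "a \<noteq> j" "b = i" | "a \<noteq> j" "b \<noteq> i" by blast
      then show ?thesis
      proof cases
        case 1
        then show ?thesis unfolding eq pivot_def using dv[OF c[of 1]] by simp
      next
        case 2
        then show ?thesis unfolding eq pivot_def using dv[OF v[of i b]] k ab by auto
      next
        case 3
        then show ?thesis unfolding eq pivot_def using dv[OF neg[OF v[of a j]]] k ab by auto
      next
        case 4
        then have "a \<in> I k" "b \<in> {1..n} - I k" using ab by auto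
        then show ?thesis unfolding eq pivot_def
          using sub[OF v[of a b] dv[OF rat_at_mult[OF v[of a j] v[of i b]]]] k ab 4 by auto
      qed
    qed
  qed
  moreover have "(\<lambda>e. \<sigma> e y) \<in> affine_space (Gr_chart_vars n K I1)" for y
    by (auto simp: affine_space_def \<sigma>_def split: prod.splits)
  moreover have "Gr_chart n K I y = Gr_chart n K I1 (\<lambda>e. \<sigma> e y)" if nz: "y (k, i, j) \<noteq> 0" for y
  proof (rule Gr_chart_eqI)
    fix k' assume k': "k' \<in> K"
    show "Gr_chart n K I y k' = Gr_chart n K I1 (\<lambda>e. \<sigma> e y) k'"
    proof (cases "k' = k")
      case False
      then have "graph_space n (I k') (\<lambda>i j. y (k', i, j)) = graph_space n (I k') (\<lambda>i j. \<sigma> (k', i, j) y)"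
        using k' by (intro graph_space_cong) (auto simp: \<sigma>_def Gr_chart_vars_def I1_def)
      then show ?thesis
        unfolding Gr_chart_apply[OF I k'] Gr_chart_apply[OF I1 k'] using False by (simp add: I1_def)
    next
      case True
      have "graph_space n (I k) (\<lambda>i j. y (k, i, j))
          = graph_space n (I1 k) (pivot (\<lambda>a b. y (k, a, b)) i j)"
        using graph_space_pivot[OF Ik(1) k(2,3)] nz by (simp add: I1_def)
      also have "\<dots> = graph_space n (I1 k) (\<lambda>i j. \<sigma> (k, i, j) y)"
        using k' True by (intro graph_space_cong) (auto simp: \<sigma>_def Gr_chart_vars_def)
      finally show ?thesis
        unfolding Gr_chart_apply[OF I k'] Gr_chart_apply[OF I1 k'] using True by simp
    qed
  qed
  ultimately show "\<exists>\<sigma>. (\<forall>e. rat_at (Gr_chart_vars n K I) x (\<sigma> e)) \<and>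
      (\<forall>y. (\<lambda>e. \<sigma> e y) \<in> affine_space (Gr_chart_vars n K I1)) \<and>
      (\<forall>y. y (k, i, j) \<noteq> 0 \<longrightarrow> Gr_chart n K I y = Gr_chart n K I1 (\<lambda>e. \<sigma> e y))"
    by (intro exI[of _ \<sigma>]) (auto simp: split_paired_all)
qed

text \<open>By the exchange property, two charts around a common point are connected by pivots at
  entries that do not vanish at this point.\<close>

lemma Gr_chart_transition:
  assumes "finite K" and I': "chart_index n K d I'"
  assumes "chart_index n K d I" "Gr_chart n K I x = Gr_chart n K I' x'"
  shows "\<exists>g\<in>polyfun (Gr_chart_vars n K I). \<exists>\<sigma>. g x \<noteq> 0 \<and>
    (\<forall>e. rat_at (Gr_chart_vars n K I) x (\<sigma> e)) \<and>
    (\<forall>y. (\<lambda>e. \<sigma> e y) \<in> affine_space (Gr_chart_vars n K I')) \<and>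
    (\<forall>y. g y \<noteq> 0 \<longrightarrow> Gr_chart n K I y = Gr_chart n K I' (\<lambda>e. \<sigma> e y))"
  using assms(3,4)
proof (induction "\<Sum>k\<in>K. card (I k - I' k)" arbitrary: I x rule: less_induct)
  case less
  let ?E = "Gr_chart_vars n K I" and ?E' = "Gr_chart_vars n K I'"
  show ?case
  proof (cases "\<forall>k\<in>K. I k = I' k")
    case True
    then have E: "?E = ?E'" by (auto simp: Gr_chart_vars_def)
    define \<sigma> where "\<sigma> e y = (if e \<in> ?E' then y e else (0::complex))" for e and y :: "_ \<Rightarrow> complex"
    have "rat_at ?E x (\<sigma> e)" for e
      unfolding \<sigma>_def E by (cases "e \<in> ?E'") (auto intro: rat_at_polyfun polyfun.intros)
    moreover have "(\<lambda>e. \<sigma> e y) \<in> affine_space ?E'" for y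
      by (auto simp: \<sigma>_def affine_space_def)
    moreover have "Gr_chart n K I y = Gr_chart n K I' (\<lambda>e. \<sigma> e y)" for y
    proof (rule Gr_chart_eqI)
      fix k assume k: "k \<in> K"
      show "Gr_chart n K I y k = Gr_chart n K I' (\<lambda>e. \<sigma> e y) k"
        unfolding Gr_chart_apply[OF less.prems(1) k] Gr_chart_apply[OF I' k] bspec[OF True k]
        using k by (intro graph_space_cong) (auto simp: \<sigma>_def Gr_chart_vars_def)
    qed
    ultimately show ?thesis
      by (intro bexI[of _ "\<lambda>_. 1"] exI[of _ \<sigma>]) (auto intro: polyfun.const)
  next
    case False
    then obtain k where k: "k \<in> K" "I k \<noteq> I' k" by blast
    have Ik: "I k \<subseteq> {1..n}" "I' k \<subseteq> {1..n}" "card (I k) = card (I' k)" "finite (I k)" "finite (I' k)"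
      using less.prems(1) I' k(1) finite_subset[of _ "{1..n}"] by (auto simp: chart_index_def)
    then obtain i where i: "i \<in> I k - I' k"
      using k(2) by (metis card_subset_eq subset_iff DiffI)
    have "graph_space n (I k) (\<lambda>i j. x (k, i, j)) = graph_space n (I' k) (\<lambda>i j. x' (k, i, j))"
      using fun_cong[OF less.prems(2), of k] Gr_chart_apply[OF less.prems(1) k(1)] Gr_chart_apply[OF I' k(1)]
      by simp
    from exists_pivot[OF Ik(1,2) this i]
    obtain j where j: "j \<in> I' k - I k" "x (k, i, j) \<noteq> 0" by blast
    define I1 where "I1 = I(k := insert j (I k - {i}))"
    have iI: "i \<in> I k" and jI: "j \<in> {1..n} - I k" using i j Ik by auto
    note piv = Gr_chart_pivot[where x = x and I = I and k = k, OF less.prems(1) k(1) iI jI j(2), folded I1_def]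
    obtain \<sigma>1 where \<sigma>1: "\<And>e. rat_at ?E x (\<sigma>1 e)"
      "\<And>y. y (k, i, j) \<noteq> 0 \<Longrightarrow> Gr_chart n K I y = Gr_chart n K I1 (\<lambda>e. \<sigma>1 e y)"
      using piv(2) by blast
    \<comment> \<open>The new index \<open>j\<close> lies in \<open>I' k\<close> and does not enter
      the difference, while \<open>i\<close> leaves it: the induction measure drops.\<close>
    have "card (I1 k - I' k) < card (I k - I' k)"
    proof (rule psubset_card_mono)
      show "I1 k - I' k \<subset> I k - I' k" using i j by (auto simp: I1_def)
    qed (use Ik in auto)
    moreover have "card (I1 k' - I' k') \<le> card (I k' - I' k')" if "k' \<in> K" for k'
      using calculation by (cases "k' = k") (auto simp: I1_def)
    ultimately have "(\<Sum>k\<in>K. card (I1 k - I' k)) < (\<Sum>k\<in>K. card (I k - I' k))"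
      using k(1) assms(1) by (intro sum_strict_mono_ex1) auto
    \<comment> \<open>The pivoted coordinates describe the same point, so the induction hypothesis
      applies to them.\<close>
    moreover have "Gr_chart n K I1 (\<lambda>e. \<sigma>1 e x) = Gr_chart n K I' x'"
      using \<sigma>1(2) j(2) less.prems(2) by simp
    ultimately obtain g \<sigma> where g: "g \<in> polyfun (Gr_chart_vars n K I1)" "g (\<lambda>e. \<sigma>1 e x) \<noteq> 0"
      and \<sigma>: "\<And>e. rat_at (Gr_chart_vars n K I1) (\<lambda>e. \<sigma>1 e x) (\<sigma> e)"
      "\<And>y. (\<lambda>e. \<sigma> e y) \<in> affine_space ?E'"
      "\<And>y. g y \<noteq> 0 \<Longrightarrow> Gr_chart n K I1 y = Gr_chart n K I' (\<lambda>e. \<sigma> e y)"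
      using less.hyps[of I1 "\<lambda>e. \<sigma>1 e x"] piv(1) by blast
    \<comment> \<open>Pulled back through the pivot, \<open>g\<close> is only rational;
      \<open>h\<close> is a polynomial whose nonvanishing implies that of \<open>g\<close>.\<close>
    have "rat_at ?E x (\<lambda>y. g (\<lambda>e. \<sigma>1 e y))" using g(1) \<sigma>1(1) by (rule rat_at_comp_polyfun)
    then obtain h where h: "h \<in> polyfun ?E" "h x \<noteq> 0" "\<And>y. h y \<noteq> 0 \<Longrightarrow> g (\<lambda>e. \<sigma>1 e y) \<noteq> 0"
      using g(2) by (rule rat_at_nonzero) blast
    have "rat_at ?E x (\<lambda>y. \<sigma> e (\<lambda>e. \<sigma>1 e y))" for e
      by (rule rat_at_comp[where \<rho> = \<sigma>1 and f = "\<sigma> e", OF \<sigma>(1) \<sigma>1(1)])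
    moreover have "(k, i, j) \<in> ?E" using k iI jI by (auto simp: Gr_chart_vars_def)
    ultimately show ?thesis
      using h j(2) \<sigma>(2,3) \<sigma>1(2)
      by (intro bexI[of _ "\<lambda>y. y (k, i, j) * h y"] exI[of _ "\<lambda>e y. \<sigma> e (\<lambda>e. \<sigma>1 e y)"])
        (auto intro!: polyfun.intros)
  qed
qed

text \<open>An open set can be tested near a point in any chart around it, whichever charts
  generated the set. Unions and intersections are formal; a basic set of another chart is carried
  over by \<open>Gr_chart_transition\<close>.\<close>

lemma zariski_open_chart:
  assumes "finite K" "chart_index n K d I" "openin (zariski (Gr_atlas n K d)) U"
    and "Gr_chart n K I x \<in> U"
  obtains g where "g \<in> polyfun (Gr_chart_vars n K I)" "g x \<noteq> 0"
    "\<And>y. g y \<noteq> 0 \<Longrightarrow> Gr_chart n K I y \<in> U"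
proof -
  have "generate_topology_on {\<phi> ` {x \<in> affine_space E. g x \<noteq> 0} | E \<phi> g.
      (E, \<phi>) \<in> Gr_atlas n K d \<and> g \<in> polyfun E} U"
    using assms(3) unfolding zariski_def by (simp add: openin_topology_generated_by_iff)
  then have "\<exists>g\<in>polyfun (Gr_chart_vars n K I). g x \<noteq> 0 \<and> (\<forall>y. g y \<noteq> 0 \<longrightarrow> Gr_chart n K I y \<in> U)"
    using assms(4)
  proof (induction U rule: generate_topology_on.induct)
    case Empty
    then show ?case by simp
  next
    case (Int a b)
    then obtain g h where "g \<in> polyfun (Gr_chart_vars n K I)" "g x \<noteq> 0"
      "\<And>y. g y \<noteq> 0 \<Longrightarrow> Gr_chart n K I y \<in> a" "h \<in> polyfun (Gr_chart_vars n K I)" "h x \<noteq> 0"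
      "\<And>y. h y \<noteq> 0 \<Longrightarrow> Gr_chart n K I y \<in> b" by blast
    then show ?case
      by (intro bexI[of _ "\<lambda>y. g y * h y"]) (auto intro: polyfun.mult)
  next
    case (UN S)
    from UN.prems obtain k where "k \<in> S" "Gr_chart n K I x \<in> k" by blast
    with UN.IH[OF this] show ?case by blast
  next
    case (Basis s)
    then obtain I' g where I': "chart_index n K d I'" "g \<in> polyfun (Gr_chart_vars n K I')"
      "s = Gr_chart n K I' ` {x \<in> affine_space (Gr_chart_vars n K I'). g x \<noteq> 0}"
      unfolding Gr_atlas_iff by blast
    then obtain x' where x': "Gr_chart n K I x = Gr_chart n K I' x'"
      "x' \<in> affine_space (Gr_chart_vars n K I')" "g x' \<noteq> 0"
      using Basis by auto
    let ?E = "Gr_chart_vars n K I"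
    obtain h \<sigma> where h: "h \<in> polyfun ?E" "h x \<noteq> 0" "\<And>e. rat_at ?E x (\<sigma> e)"
      "\<And>y. (\<lambda>e. \<sigma> e y) \<in> affine_space (Gr_chart_vars n K I')"
      "\<And>y. h y \<noteq> 0 \<Longrightarrow> Gr_chart n K I y = Gr_chart n K I' (\<lambda>e. \<sigma> e y)"
      using Gr_chart_transition[OF assms(1) I'(1) assms(2) x'(1)] by blast
    \<comment> \<open>Injectivity of the chart \<open>I'\<close> identifies the transported
      coordinates with \<open>x'\<close>, where \<open>g\<close> does not vanish.\<close>
    have "(\<lambda>e. \<sigma> e x) = x'"
      using inj_on_Gr_chart[OF I'(1)] h(2,4,5) x'(1,2) unfolding inj_on_def by metis
    then have "g (\<lambda>e. \<sigma> e x) \<noteq> 0" using x' by simp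
    moreover have "rat_at ?E x (\<lambda>y. g (\<lambda>e. \<sigma> e y))" using I'(2) h(3) by (rule rat_at_comp_polyfun)
    ultimately obtain f where f: "f \<in> polyfun ?E" "f x \<noteq> 0" "\<And>y. f y \<noteq> 0 \<Longrightarrow> g (\<lambda>e. \<sigma> e y) \<noteq> 0"
      using rat_at_nonzero[where f = "\<lambda>y. g (\<lambda>e. \<sigma> e y)"] by blast
    show ?case
      by (rule bexI[of _ "\<lambda>y. h y * f y"]) (use h f I'(3) in \<open>auto intro: polyfun.mult\<close>)
  qed
  then show ?thesis using that by blast
qed

lemma openin_zariski_basic:
  assumes "(E, \<phi>) \<in> A" "g \<in> polyfun E"
  shows "openin (zariski A) (\<phi> ` {x \<in> affine_space E. g x \<noteq> 0})"
  unfolding zariski_def using assms by (intro topology_generated_by_Basis) blast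

lemma Gr_chart_in_topspace:
  assumes "chart_index n K d I" "x \<in> affine_space (Gr_chart_vars n K I)"
  shows "Gr_chart n K I x \<in> topspace (zariski (Gr_atlas n K d))"
proof -
  have "(Gr_chart_vars n K I, Gr_chart n K I) \<in> Gr_atlas n K d"
    using assms(1) Gr_atlas_iff by blast
  from openin_subset[OF openin_zariski_basic[OF this polyfun.const[of 1]]]
  show ?thesis using assms(2) by auto
qed

section \<open>Morphisms and smoothness in charts\<close>

text \<open>Polynomial expressions in one pair of charts per point suffice. Open sets pull back by
  \<open>zariski_open_chart\<close>; a regular function may be given in a different target chart, so
  it is first moved by \<open>Gr_chart_transition\<close> and then composed with
  \<open>\<rho>\<close>.\<close>

lemma morphism_chartwise:
  fixes A :: "('e, 'p) atlas" and f :: "'p \<Rightarrow> 'k \<Rightarrow> (nat \<Rightarrow> complex) set"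
  assumes K: "finite K" and fXY: "f ` X \<subseteq> Y"
    and loc: "\<And>P. P \<in> X \<Longrightarrow> \<exists>(E, \<phi>)\<in>A. \<exists>x\<in>affine_space E. \<exists>I \<rho>. P = \<phi> x \<and> chart_index n K d I \<and>
      (\<forall>e. \<rho> e \<in> polyfun E) \<and> (\<forall>y. (\<lambda>e. \<rho> e y) \<in> affine_space (Gr_chart_vars n K I)) \<and>
      (\<forall>y\<in>affine_space E. \<phi> y \<in> X \<longrightarrow> f (\<phi> y) = Gr_chart n K I (\<lambda>e. \<rho> e y))"
  shows "morphism A X (Gr_atlas n K d) Y f"
proof -
  let ?B = "Gr_atlas n K d"
  have open_nbhd: "\<exists>N. openin (zariski A) N \<and> P \<in> N \<and> (\<forall>Q\<in>X \<inter> N. f Q \<in> U)"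
    if P: "P \<in> X" and U: "openin (zariski ?B) U" "f P \<in> U" for P U
  proof -
    obtain E \<phi> x I \<rho> where c: "(E, \<phi>) \<in> A" "x \<in> affine_space E" "P = \<phi> x" "chart_index n K d I"
      "\<And>e. \<rho> e \<in> polyfun E" "\<And>y. y \<in> affine_space E \<Longrightarrow> \<phi> y \<in> X \<Longrightarrow> f (\<phi> y) = Gr_chart n K I (\<lambda>e. \<rho> e y)"
      using loc[OF P] by blast
    obtain g where g: "g \<in> polyfun (Gr_chart_vars n K I)" "g (\<lambda>e. \<rho> e x) \<noteq> 0"
      "\<And>y. g y \<noteq> 0 \<Longrightarrow> Gr_chart n K I y \<in> U"
      using zariski_open_chart[OF K c(4) U(1)] U(2) c(2,3,6) P by metis
    have "openin (zariski A) (\<phi> ` {y \<in> affine_space E. g (\<lambda>e. \<rho> e y) \<noteq> 0})"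
      by (rule openin_zariski_basic[OF c(1) polyfun_comp[OF g(1) c(5)]])
    then show ?thesis using c g by (intro exI conjI) auto
  qed
  have "continuous_map (subtopology (zariski A) X) (subtopology (zariski ?B) Y) f"
    unfolding continuous_map_def
  proof (intro conjI allI impI)
    show "f \<in> topspace (subtopology (zariski A) X) \<rightarrow> topspace (subtopology (zariski ?B) Y)"
    proof
      fix P assume "P \<in> topspace (subtopology (zariski A) X)"
      then have P: "P \<in> X" by simp
      then obtain E \<phi> x I \<rho> where c: "(E, \<phi>) \<in> A" "x \<in> affine_space E" "P = \<phi> x" "chart_index n K d I"
        "\<And>y. (\<lambda>e. \<rho> e y) \<in> affine_space (Gr_chart_vars n K I)"
        "\<And>y. y \<in> affine_space E \<Longrightarrow> \<phi> y \<in> X \<Longrightarrow> f (\<phi> y) = Gr_chart n K I (\<lambda>e. \<rho> e y)"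
        using loc[OF P] by blast
      then show "f P \<in> topspace (subtopology (zariski ?B) Y)"
        using P fXY Gr_chart_in_topspace[OF c(4,5)] by auto
    qed
    fix V assume "openin (subtopology (zariski ?B) Y) V"
    then obtain U where U: "openin (zariski ?B) U" "V = U \<inter> Y" by (auto simp: openin_subtopology)
    let ?S = "{P \<in> topspace (subtopology (zariski A) X). f P \<in> V}"
    show "openin (subtopology (zariski A) X) ?S"
    proof (subst openin_subopen, intro ballI)
      fix P assume P: "P \<in> ?S"
      then have "P \<in> X" "f P \<in> U" using U by auto
      then obtain N where N: "openin (zariski A) N" "P \<in> N" "\<forall>Q\<in>X \<inter> N. f Q \<in> U"
        using open_nbhd U(1) by blast
      then have "openin (subtopology (zariski A) X) (N \<inter> X)" by (auto simp: openin_subtopology)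
      moreover have "N \<inter> X \<subseteq> ?S" using N U(2) fXY openin_subset[OF N(1)] by auto
      ultimately show "\<exists>T. openin (subtopology (zariski A) X) T \<and> P \<in> T \<and> T \<subseteq> ?S"
        using N(2) \<open>P \<in> X\<close> by blast
    qed
  qed
  moreover have "regular_on A {P \<in> X. f P \<in> V} (h \<circ> f)"
    if h: "regular_on ?B V h" for V h
    unfolding regular_on_def
  proof
    fix P assume "P \<in> {P \<in> X. f P \<in> V}"
    then have P: "P \<in> X" "f P \<in> V" by auto
    from bspec[OF h[unfolded regular_on_def] P(2)]
    obtain U E' \<phi>' p q where U: "openin (zariski ?B) U" "f P \<in> U" and at: "(E', \<phi>') \<in> ?B"
      and pq: "p \<in> polyfun E'" "q \<in> polyfun E'"
      and eq: "\<forall>Q\<in>V \<inter> U. \<exists>x\<in>affine_space E'. Q = \<phi>' x \<and> q x \<noteq> 0 \<and> h Q = p x / q x"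
      by (elim exE conjE bexE case_prodE) simp
    from at obtain J where J: "chart_index n K d J"
      and E': "E' = Gr_chart_vars n K J" "\<phi>' = Gr_chart n K J"
      unfolding Gr_atlas_iff by blast
    note pq = pq[unfolded E'] and eq = eq[unfolded E', rule_format]
    \<comment> \<open>The target chart \<open>I\<close> obtained here belongs to \<open>f\<close>,
      whereas \<open>J\<close> above belongs to \<open>h\<close>; they may differ.\<close>
    obtain E \<phi> x I \<rho> where c: "(E, \<phi>) \<in> A" "x \<in> affine_space E" "P = \<phi> x" "chart_index n K d I"
      "\<And>e. \<rho> e \<in> polyfun E" "\<And>y. y \<in> affine_space E \<Longrightarrow> \<phi> y \<in> X \<Longrightarrow> f (\<phi> y) = Gr_chart n K I (\<lambda>e. \<rho> e y)"
      using loc[OF P(1)] by blast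
    let ?E' = "Gr_chart_vars n K I" and ?x = "\<lambda>e. \<rho> e x"
    have fP: "f P = Gr_chart n K I ?x" using c P by auto
    obtain x' where x': "x' \<in> affine_space (Gr_chart_vars n K J)" "f P = Gr_chart n K J x'" "q x' \<noteq> 0"
      using eq[of "f P"] P U by blast
    obtain g \<sigma> where g: "g \<in> polyfun ?E'" "g ?x \<noteq> 0"
      and \<sigma>: "\<And>e. rat_at ?E' ?x (\<sigma> e)" "\<And>y. (\<lambda>e. \<sigma> e y) \<in> affine_space (Gr_chart_vars n K J)"
        "\<And>y. g y \<noteq> 0 \<Longrightarrow> Gr_chart n K I y = Gr_chart n K J (\<lambda>e. \<sigma> e y)"
      using Gr_chart_transition[OF K J c(4), of ?x x'] fP x'(2) by auto
    note inj = inj_on_Gr_chart[OF J, unfolded inj_on_def, rule_format]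
    have "(\<lambda>e. \<sigma> e ?x) = x'" using inj[OF \<sigma>(2) x'(1)] \<sigma>(3)[OF g(2)] fP x'(2) by simp
    then have "q (\<lambda>e. \<sigma> e ?x) \<noteq> 0" using x'(3) by simp
    moreover have p\<sigma>: "rat_at ?E' ?x (\<lambda>y. p (\<lambda>e. \<sigma> e y))"
      by (rule rat_at_comp_polyfun[OF pq(1) \<sigma>(1)])
    moreover have q\<sigma>: "rat_at ?E' ?x (\<lambda>y. q (\<lambda>e. \<sigma> e y))"
      by (rule rat_at_comp_polyfun[OF pq(2) \<sigma>(1)])
    ultimately have "rat_at ?E' ?x (\<lambda>y. p (\<lambda>e. \<sigma> e y) / q (\<lambda>e. \<sigma> e y))"
      using rat_at_divide[where f = "\<lambda>y. p (\<lambda>e. \<sigma> e y)" and h = "\<lambda>y. q (\<lambda>e. \<sigma> e y)"] by blast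
    then obtain r s where rs: "r \<in> polyfun ?E'" "s \<in> polyfun ?E'" "s ?x \<noteq> 0"
      "\<And>y. s y \<noteq> 0 \<Longrightarrow> p (\<lambda>e. \<sigma> e y) / q (\<lambda>e. \<sigma> e y) = r y / s y"
      unfolding rat_at_def by blast
    obtain N where N: "openin (zariski A) N" "P \<in> N" "\<forall>Q\<in>X \<inter> N. f Q \<in> U"
      using open_nbhd[OF P(1) U] by blast
    \<comment> \<open>Where \<open>t\<close> is nonzero, the chart change is valid and
      \<open>r / s\<close> represents \<open>h\<close>.\<close>
    define t where "t = (\<lambda>y. g (\<lambda>e. \<rho> e y) * s (\<lambda>e. \<rho> e y))"
    have "t \<in> polyfun E" unfolding t_def
      by (intro polyfun.mult polyfun_comp[OF g(1)] polyfun_comp[OF rs(2)] c(5))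
    then have D: "openin (zariski A) (\<phi> ` {y \<in> affine_space E. t y \<noteq> 0})"
      using c(1) by (rule openin_zariski_basic[rotated])
    let ?N = "N \<inter> \<phi> ` {y \<in> affine_space E. t y \<noteq> 0}"
    have "openin (zariski A) ?N" using N(1) D by (rule openin_Int)
    moreover have "P \<in> ?N" using N(2) c(2,3) g(2) rs(3) by (auto simp: t_def)
    moreover have "\<forall>Q\<in>{P \<in> X. f P \<in> V} \<inter> ?N. \<exists>y\<in>affine_space E. Q = \<phi> y \<and>
        s (\<lambda>e. \<rho> e y) \<noteq> 0 \<and> (h \<circ> f) Q = r (\<lambda>e. \<rho> e y) / s (\<lambda>e. \<rho> e y)"
    proof
      fix Q assume Q: "Q \<in> {P \<in> X. f P \<in> V} \<inter> ?N"
      obtain y where y: "y \<in> affine_space E" "Q = \<phi> y" "t y \<noteq> 0" using Q by blast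
      let ?y = "\<lambda>e. \<rho> e y"
      have nz: "g ?y \<noteq> 0" "s ?y \<noteq> 0" using y(3) by (auto simp: t_def)
      have fQ: "f Q = Gr_chart n K J (\<lambda>e. \<sigma> e ?y)" using c(6)[OF y(1)] y(2) Q \<sigma>(3)[OF nz(1)] by simp
      have "f Q \<in> V \<inter> U" using Q N(3) by auto
      then obtain z where z: "z \<in> affine_space (Gr_chart_vars n K J)" "f Q = Gr_chart n K J z"
        "h (f Q) = p z / q z" using eq by blast
      have "z = (\<lambda>e. \<sigma> e ?y)" using inj[OF z(1) \<sigma>(2)] z(2) fQ by simp
      then show "\<exists>y\<in>affine_space E. Q = \<phi> y \<and>
        s (\<lambda>e. \<rho> e y) \<noteq> 0 \<and> (h \<circ> f) Q = r (\<lambda>e. \<rho> e y) / s (\<lambda>e. \<rho> e y)"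
        using y nz z(3) rs(4)[OF nz(2)] by auto
    qed
    moreover have "(\<lambda>y. r (\<lambda>e. \<rho> e y)) \<in> polyfun E" by (rule polyfun_comp[OF rs(1) c(5)])
    moreover have "(\<lambda>y. s (\<lambda>e. \<rho> e y)) \<in> polyfun E" by (rule polyfun_comp[OF rs(2) c(5)])
    ultimately show "\<exists>U. openin (zariski A) U \<and> P \<in> U \<and>
        (\<exists>(E, \<phi>)\<in>A. \<exists>p\<in>polyfun E. \<exists>q\<in>polyfun E.
           \<forall>Q\<in>{P \<in> X. f P \<in> V} \<inter> U. \<exists>x\<in>affine_space E. Q = \<phi> x \<and> q x \<noteq> 0 \<and> (h \<circ> f) Q = p x / q x)"
      using c(1)
      by (intro exI[of _ ?N] conjI bexI[of _ "(E, \<phi>)"] case_prodI bexI[of _ "\<lambda>y. r (\<lambda>e. \<rho> e y)"]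
          bexI[of _ "\<lambda>y. s (\<lambda>e. \<rho> e y)"])
  qed
  ultimately show ?thesis unfolding morphism_def by blast
qed

text \<open>If the variety is, in a chart, the graph of a polynomial map \<open>r\<close> in the variables \<open>F\<close>, then
  the equations \<open>y\<^sub>e = r\<^sub>e y\<close> for \<open>e \<in> E - F\<close> have an identity matrix as a Jacobian minor, and by
  Taylor expansion they generate the ideal of the variety.\<close>

lemma smooth_at_graph:
  assumes chart: "(E, \<phi>) \<in> A" and fin: "finite E" and F: "F \<subseteq> E"
    and r: "\<And>e. (\<lambda>y. r y e) \<in> polyfun F" "\<And>y. r y \<in> affine_space E" "\<And>y e. e \<in> F \<Longrightarrow> r y e = y e"
    and X: "\<And>y. y \<in> affine_space E \<Longrightarrow> \<phi> y \<in> X \<longleftrightarrow> r y = y"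
    and x: "r x = x"
  shows "smooth_at A X (\<phi> x)"
proof -
  define c where "c = card (E - F)"
  obtain \<epsilon> where \<epsilon>: "bij_betw \<epsilon> {..<c} (E - F)"
    using fin ex_bij_betw_nat_finite[of "E - F"] by (auto simp: c_def atLeast0LessThan)
  have rE: "(\<lambda>y. r y e) \<in> polyfun E" for e using r(1) F by (rule polyfun_mono)
  \<comment> \<open>\<open>r\<close> reads only the variables in \<open>F\<close>, and these it
    leaves fixed.\<close>
  have rr: "r (r y) = r y" for y
  proof
    fix e show "r (r y) e = r y e" using polyfun_cong_vars[OF r(1)] r(3) by metis
  qed
  define f where "f i y = y (\<epsilon> i) - r y (\<epsilon> i)" for i :: nat and y
  have \<epsilon>i: "\<epsilon> i \<in> E - F" if "i < c" for i using \<epsilon> that by (auto simp: bij_betw_def)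
  have f: "f i \<in> polyfun E" if "i < c" for i
    unfolding f_def using \<epsilon>i[OF that] by (intro polyfun_minus polyfun.var rE) auto
  have zero: "r y = y \<longleftrightarrow> (\<forall>i<c. f i y = 0)" if y: "y \<in> affine_space E" for y
  proof
    assume z: "\<forall>i<c. f i y = 0"
    show "r y = y"
    proof
      fix e
      consider "e \<notin> E" | "e \<in> F" | "e \<in> E - F" by blast
      then show "r y e = y e"
      proof cases
        case 1
        then show ?thesis using r(2) y by (auto simp: affine_space_def)
      next
        case 3
        then obtain i where "i < c" "e = \<epsilon> i" using \<epsilon> by (auto simp: bij_betw_def)
        then show ?thesis using z by (auto simp: f_def)
      qed (simp add: r(3))
    qed
  qed (auto simp: f_def)
  \<comment> \<open>The localization is at the constant 1: the equations generate the ideal on the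
    whole chart.\<close>
  have ideal: "\<exists>m a. (\<forall>i<c. a i \<in> polyfun E) \<and> (\<forall>y. 1 ^ m * h y = (\<Sum>i<c. a i y * f i y))"
    if h: "h \<in> polyfun E" and van: "\<And>y. y \<in> affine_space E \<Longrightarrow> \<phi> y \<in> X \<Longrightarrow> h y = 0" for h
  proof -
    obtain a where a: "\<And>e. a e \<in> polyfun E"
      "\<And>y. h y - h (\<lambda>e. r y e) = (\<Sum>e\<in>E. a e y * (y e - r y e))"
      using polyfun_taylor[OF h fin, of "\<lambda>e y. r y e"] rE by blast
    have "h y = (\<Sum>i<c. a (\<epsilon> i) y * f i y)" for y
    proof -
      \<comment> \<open>Since \<open>r y\<close> represents a point of \<open>X\<close>, the
        expansion around it has no constant term.\<close>
      have "h (r y) = 0" using van r(2) X[OF r(2)] rr by blast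
      then have "h y = (\<Sum>e\<in>E. a e y * (y e - r y e))" using a(2)[of y] by simp
      also have "\<dots> = (\<Sum>e\<in>E - F. a e y * (y e - r y e))"
        using fin by (intro sum.mono_neutral_right) (auto simp: r(3))
      also have "\<dots> = (\<Sum>i<c. a (\<epsilon> i) y * f i y)"
        using sum.reindex_bij_betw[OF \<epsilon>, of "\<lambda>e. a e y * (y e - r y e)"] by (simp add: f_def)
      finally show ?thesis .
    qed
    then show ?thesis using a(1) by (intro exI[of _ 0] exI[of _ "\<lambda>i. a (\<epsilon> i)"]) auto
  qed
  have jac: "\<forall>i<c. l i = 0" if l: "\<forall>e\<in>E. (\<Sum>i<c. l i * partial_deriv e (f i) x) = 0" for l
  proof (intro allI impI)
    fix j assume j: "j < c"
    have d: "partial_deriv (\<epsilon> j) (f i) x = (if i = j then 1 else 0)" if i: "i < c" for i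
    proof -
      \<comment> \<open>The variable \<open>\<epsilon> j\<close> lies outside \<open>F\<close>, so
        varying it does not affect \<open>r\<close>.\<close>
      have const: "r (x(\<epsilon> j := t)) e = r x e" for t e
        by (rule polyfun_cong_vars[OF r(1)]) (use \<epsilon>i[OF j] in auto)
      have "\<epsilon> i = \<epsilon> j \<longleftrightarrow> i = j" using \<epsilon> i j by (auto simp: bij_betw_def inj_on_def)
      then have "f i (x(\<epsilon> j := t)) = (if i = j then t else x (\<epsilon> i)) - r x (\<epsilon> i)" for t
        by (simp add: f_def const)
      then have "partial_deriv (\<epsilon> j) (f i) x = deriv (\<lambda>t. (if i = j then t else x (\<epsilon> i)) - r x (\<epsilon> i)) (x (\<epsilon> j))"
        by (simp add: partial_deriv_def)
      also have "\<dots> = (if i = j then 1 else 0)"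
        by (rule DERIV_imp_deriv) (auto intro!: derivative_eq_intros)
      finally show ?thesis .
    qed
    have "0 = (\<Sum>i<c. l i * partial_deriv (\<epsilon> j) (f i) x)" using l \<epsilon>i[OF j] by simp
    also have "\<dots> = (\<Sum>i<c. if i = j then l i else 0)" by (intro sum.cong) (auto simp: d)
    also have "\<dots> = l j" using j by simp
    finally show "l j = 0" by simp
  qed
  have "x \<in> affine_space E" using r(2)[of x] x by simp
  moreover have "{y \<in> affine_space E. (1::complex) \<noteq> 0 \<and> \<phi> y \<in> X} =
      {y \<in> affine_space E. (1::complex) \<noteq> 0 \<and> (\<forall>i<c. f i y = 0)}"
    using X zero by auto
  ultimately show ?thesis unfolding smooth_at_def
    using chart f ideal jac
    by (intro bexI[of _ "(E, \<phi>)"] case_prodI bexI[of _ x] bexI[of _ "\<lambda>_. 1"] exI[of _ c] exI[of _ f] conjI)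
      (auto intro: polyfun.const)
qed

text \<open>Iterating \<open>S\<close> from the free values settles all entries of rank below
  \<open>m\<close> after \<open>m\<close> rounds, since by \<open>tri\<close> an entry depends only
  on free ones and on those of smaller rank. After \<open>N\<close> rounds a fixed point is reached
  that is polynomial in the free variables.\<close>

lemma triangular_system:
  fixes S :: "('e \<Rightarrow> complex) \<Rightarrow> 'e \<Rightarrow> complex" and rk :: "'e \<Rightarrow> nat"
  assumes F: "F \<subseteq> E"
    and aff: "\<And>y. S y \<in> affine_space E" and free: "\<And>y e. e \<in> F \<Longrightarrow> S y e = y e"
    and tri: "\<And>u v e. u \<in> affine_space E \<Longrightarrow> v \<in> affine_space E \<Longrightarrow> e \<in> E \<Longrightarrow>
       (\<And>e'. e' \<in> F \<Longrightarrow> u e' = v e') \<Longrightarrow> (\<And>e'. e' \<in> E \<Longrightarrow> rk e' < rk e \<Longrightarrow> u e' = v e') \<Longrightarrow> S u e = S v e"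
    and poly: "\<And>\<rho>. (\<And>e. (\<lambda>y. \<rho> y e) \<in> polyfun F) \<Longrightarrow> (\<And>e. (\<lambda>y. S (\<rho> y) e) \<in> polyfun F)"
    and bound: "\<And>e. e \<in> E \<Longrightarrow> rk e < N"
  obtains r where "\<And>e. (\<lambda>y. r y e) \<in> polyfun F" "\<And>y. r y \<in> affine_space E"
    "\<And>y e. e \<in> F \<Longrightarrow> r y e = y e" "\<And>y. y \<in> affine_space E \<Longrightarrow> S y = y \<longleftrightarrow> r y = y"
proof -
  \<comment> \<open>The starting value 0 of the bound entries is arbitrary; the iteration overwrites
    it.\<close>
  define s0 where "s0 y e = (if e \<in> F then y e else (0::complex))" for y :: "'e \<Rightarrow> complex" and e
  define R where "R m y = (S ^^ m) (s0 y)" for m y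
  have R0: "R 0 y = s0 y" and RS: "R (Suc m) y = S (R m y)" for m y by (auto simp: R_def)
  have RF: "R m y e = y e" if "e \<in> F" for m y e
    by (induction m) (use that free in \<open>auto simp: R0 RS s0_def\<close>)
  have Raff: "R m y \<in> affine_space E" for m y
    using F aff by (cases m) (auto simp: R0 RS s0_def affine_space_def)
  have "(\<lambda>y. R m y e) \<in> polyfun F" for m e
  proof (induction m arbitrary: e)
    case 0
    show ?case by (cases "e \<in> F") (auto simp: R0 s0_def intro: polyfun.intros)
  next
    case (Suc m)
    show ?case unfolding RS using Suc by (rule poly)
  qed
  \<comment> \<open>Uniqueness: every fixed point with the given free values is the one found by the
    iteration.\<close>
  moreover have agree: "R m y e = u e"
    if u: "u \<in> affine_space E" "S u = u" "\<And>e. e \<in> F \<Longrightarrow> u e = y e" and e: "e \<in> E" "rk e < m" for m y u e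
    using e
  proof (induction m arbitrary: e)
    case (Suc m)
    have "S (R m y) e = S u e"
      by (rule tri[OF Raff u(1) Suc.prems(1)]) (use RF u(3) Suc in auto)
    then show ?case by (simp add: RS u(2))
  qed simp
  \<comment> \<open>Existence: once the rank is exceeded, the iterates stop changing.\<close>
  moreover have stable: "R (Suc m) y e = R m y e" if "e \<in> E" "rk e < m" for m y e
    using that
  proof (induction m arbitrary: e)
    case (Suc m)
    have "S (R (Suc m) y) e = S (R m y) e"
      by (rule tri[OF Raff Raff Suc.prems(1)]) (use RF Suc in auto)
    then show ?case by (simp add: RS)
  qed simp
  have eqI: "u = v" if "u \<in> affine_space E" "v \<in> affine_space E" "\<And>e. e \<in> E \<Longrightarrow> u e = v e" for u v
    using that by (fastforce simp: affine_space_def)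
  have "S y = y \<longleftrightarrow> R N y = y" if y: "y \<in> affine_space E" for y
  proof
    assume Sy: "S y = y"
    show "R N y = y" by (rule eqI[OF Raff y]) (use agree[OF y Sy] bound in auto)
  next
    assume R: "R N y = y"
    have "S (R N y) = R N y" by (rule eqI[OF aff Raff]) (use stable bound in \<open>auto simp: RS\<close>)
    then show "S y = y" by (simp add: R)
  qed
  ultimately show ?thesis using that[of "R N"] Raff RF by blast
qed

section \<open>Surjectivity of the projection\<close>

interpretation pr: Vector_Spaces.linear cscale cscale "pr d" for d
  by unfold_locales (auto simp: pr_def fun_eq_iff)

lemma pr_apply: "pr d v l = (if l = d then 0 else v l)"
  by (simp add: pr_def)

lemma Gr_D:
  assumes "V \<in> Gr d n"
  shows "cfun.subspace V" "V \<subseteq> W_space n" "cfun.dim V = d"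
  using assms by (auto simp: Gr_def)

lemma R_D:
  assumes "V \<in> R_variety n" "1 \<le> i" "i \<le> j" "j < n"
  shows "V (i, j) \<in> Gr i n" "V (i, j) \<subseteq> coord_space ({1..i} \<union> {j+1..n})"
    and "j + 1 < n \<Longrightarrow> v \<in> V (i, j) \<Longrightarrow> pr (j + 1) v \<in> V (i, j + 1)"
    and "j + 1 < n \<Longrightarrow> V (i, j + 1) \<subseteq> V (i + 1, j + 1)"
proof -
  have ij: "(i, j) \<in> R_index n" using assms by (auto simp: R_index_def)
  show "V (i, j) \<in> Gr i n"
    using assms(1) ij by (auto simp: R_variety_def Gr_prod_def dest: PiE_mem)
  have "V (i, j) \<subseteq> W_sub n i j" using assms(1) ij unfolding R_variety_def by blast
  then show "V (i, j) \<subseteq> coord_space ({1..i} \<union> {j+1..n})" using assms by (simp add: W_sub_eq)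
  show "pr (j + 1) v \<in> V (i, j + 1)" if "j + 1 < n" "v \<in> V (i, j)"
    using assms that unfolding R_variety_def by (auto simp: image_subset_iff)
  show "V (i, j + 1) \<subseteq> V (i + 1, j + 1)" if "j + 1 < n"
    using assms that unfolding R_variety_def by auto
qed

lemma R_variety_I:
  assumes "V \<in> Gr_prod n (R_index n) fst"
    and "\<And>i j. 1 \<le> i \<Longrightarrow> i \<le> j \<Longrightarrow> j < n \<Longrightarrow> V (i, j) \<subseteq> coord_space ({1..i} \<union> {j+1..n})"
    and "\<And>i j v. 1 \<le> i \<Longrightarrow> i \<le> j \<Longrightarrow> j + 1 < n \<Longrightarrow> v \<in> V (i, j) \<Longrightarrow> pr (j + 1) v \<in> V (i, j + 1)"
    and "\<And>i j v. 1 \<le> i \<Longrightarrow> i \<le> j \<Longrightarrow> j + 1 < n \<Longrightarrow> v \<in> V (i, j + 1) \<Longrightarrow> v \<in> V (i + 1, j + 1)"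
  shows "V \<in> R_variety n"
  unfolding R_variety_def mem_Collect_eq
proof (intro conjI ballI allI impI)
  show "V \<in> Gr_prod n (R_index n) fst" by fact
  fix p assume "p \<in> R_index n"
  then show "case p of (i, j) \<Rightarrow> V (i, j) \<subseteq> W_sub n i j"
    using assms(2) by (cases p) (force simp: R_index_def W_sub_eq)
next
  fix i j assume ij: "1 \<le> i \<and> i \<le> j \<and> j \<le> n - 2"
  then show "pr (j + 1) ` V (i, j) \<subseteq> V (i, j + 1)" using assms(3) by force
  show "V (i, j + 1) \<subseteq> V (i + 1, j + 1)" using ij assms(4) by force
qed

lemma proj_R_in_Fa:
  assumes V: "V \<in> R_variety n"
  shows "proj_R n V \<in> Fa_variety n"
  unfolding Fa_variety_def mem_Collect_eq
proof (intro conjI ballI)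
  show "proj_R n V \<in> Gr_prod n {1..n-1} (\<lambda>d. d)"
    using R_D(1)[OF V] by (auto simp: Gr_prod_def proj_R_def)
  fix d assume d: "d \<in> {1..n-2}"
  then have "1 \<le> d" "d + 1 < n" unfolding atLeastAtMost_iff by arith+
  then show "pr (d + 1) ` proj_R n V d \<subseteq> proj_R n V (d + 1)"
    using R_D(3,4)[OF V, of d d] by (auto simp: proj_R_def)
qed

text \<open>Constructs \<open>V\<^sub>i\<^sub>,\<^sub>j\<close> by recursion on \<open>j - i\<close>: the conditions on \<open>V\<^sub>i\<^sub>,\<^sub>j\<^sub>+\<^sub>1\<close> are
  \<open>pr\<^sub>j\<^sub>+\<^sub>1 V\<^sub>i\<^sub>,\<^sub>j \<subseteq> V\<^sub>i\<^sub>,\<^sub>j\<^sub>+\<^sub>1 \<subseteq> V\<^sub>i\<^sub>+\<^sub>1\<^sub>,\<^sub>j\<^sub>+\<^sub>1 \<inter> W\<^sub>i\<^sub>,\<^sub>j\<^sub>+\<^sub>1\<close>, and the right-hand side is cut out of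
  \<open>V\<^sub>i\<^sub>+\<^sub>1\<^sub>,\<^sub>j\<^sub>+\<^sub>1\<close> by the vanishing of the coordinate \<open>i + 1\<close>.\<close>

lemma Fa_in_proj_R:
  assumes V: "V \<in> Fa_variety n"
  shows "V \<in> proj_R n ` R_variety n"
proof -
  have V0: "V \<in> (\<Pi>\<^sub>E d\<in>{1..n-1}. Gr d n)" using V by (auto simp: Fa_variety_def Gr_prod_def)
  \<comment> \<open>Here \<open>d\<close> stands for j - i. With j = i + d, the sets
    \<open>D\<close> and \<open>D1\<close> are V_(i,j) and V_(i+1,j+1), and \<open>S\<close> is a
    candidate for V_(i,j+1).\<close>
  define good where "good D D1 i d S \<longleftrightarrow> cfun.subspace S \<and> pr (i + d + 1) ` D \<subseteq> S \<and>
    S \<subseteq> {v \<in> D1. v (i + 1) = 0} \<and> cfun.dim S = i"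
    for D D1 :: "(nat \<Rightarrow> complex) set" and i d S
  define T where "T = rec_nat V (\<lambda>d Td i. SOME S. good (Td i) (Td (i + 1)) i d S)"
  have T0: "T 0 i = V i" and TS: "T (Suc d) i = (SOME S. good (T d i) (T d (i + 1)) i d S)" for d i
    by (simp_all add: T_def)
  have good_T: "good (T d i) (T d (i + 1)) i d (T (Suc d) i)"
    if Gr: "T d i \<in> Gr i n" "T d (i + 1) \<in> Gr (i + 1) n"
      and sub: "pr (i + d + 1) ` T d i \<subseteq> {v \<in> T d (i + 1). v (i + 1) = 0}" for d i
  proof -
    let ?A = "pr (i + d + 1) ` T d i" and ?C = "{v \<in> T d (i + 1). v (i + 1) = 0}"
    have "cfun.subspace ?C" using Gr_D(1)[OF Gr(2)] by (auto simp: subspace_iff)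
    \<comment> \<open>A projection cannot raise the dimension above \<open>i\<close>, and a
      coordinate section lowers \<open>i + 1\<close> by at most one, so dimension \<open>i\<close>
      fits between.\<close>
    moreover have "cfun.dim ?A \<le> i"
      using dim_linear_image_le[OF pr.linear_axioms, of "T d i" n] Gr_D[OF Gr(1)] by simp
    moreover have "i \<le> cfun.dim ?C"
      using dim_hyperplane_section[of "T d (i + 1)" n "i + 1"] Gr_D[OF Gr(2)] by simp
    ultimately obtain S where "cfun.subspace S" "?A \<subseteq> S" "S \<subseteq> ?C" "cfun.dim S = i"
      using exists_subspace_between[of ?A ?C n i] sub pr.subspace_image Gr_D[OF Gr(1)] Gr_D[OF Gr(2)]
      by blast
    then have "good (T d i) (T d (i + 1)) i d S" by (simp add: good_def)
    then show ?thesis unfolding TS by (rule someI)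
  qed
  \<comment> \<open>The inclusion of the projected \<open>T d i\<close> in
    \<open>T d (i + 1)\<close> belongs to the induction, because it leaves room for the next
    choice.\<close>
  have main: "\<forall>i. 1 \<le> i \<and> i + d < n \<longrightarrow> T d i \<in> Gr i n \<and>
       T d i \<subseteq> coord_space ({1..i} \<union> {i+d+1..n}) \<and>
       (i + d + 1 < n \<longrightarrow> pr (i + d + 1) ` T d i \<subseteq> T d (i + 1) \<and>
          good (T d i) (T d (i + 1)) i d (T (Suc d) i))" for d
  proof (induction d)
    case 0
    have good: "good (V i) (V (i + 1)) i 0 (T (Suc 0) i)" if i: "1 \<le> i" "i + 1 < n" for i
    proof -
      have Gr: "V i \<in> Gr i n" "V (i + 1) \<in> Gr (i + 1) n"
        using PiE_mem[OF V0, of i] PiE_mem[OF V0, of "i + 1"] i by auto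
      have "pr (i + 1) ` V i \<subseteq> V (i + 1)" using V i by (auto simp: Fa_variety_def)
      then have "pr (i + 1) ` V i \<subseteq> {v \<in> V (i + 1). v (i + 1) = 0}" by (auto simp: pr_apply)
      then show ?thesis using good_T[of 0 i] Gr by (simp add: T0)
    qed
    have "{1..i} \<union> {i+1..n} = {1..n}" if "i < n" for i using that by auto
    then show ?case
      using V0 V good by (auto simp: T0 Fa_variety_def Gr_def W_space_eq dest!: PiE_mem)
  next
    case (Suc d)
    have props: "T (Suc d) i \<in> Gr i n" "T (Suc d) i \<subseteq> coord_space ({1..i} \<union> {i+Suc d+1..n})"
      "T (Suc d) i \<subseteq> T d (i + 1)" "pr (i + d + 1) ` T d i \<subseteq> T (Suc d) i"
      if i: "1 \<le> i" "i + Suc d < n" for i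
    proof -
      have g: "good (T d i) (T d (i + 1)) i d (T (Suc d) i)" and
        G: "T d (i + 1) \<in> Gr (i + 1) n" and
        W: "T d (i + 1) \<subseteq> coord_space ({1..i + 1} \<union> {i+1+d+1..n})"
        using Suc.IH[rule_format, of i] Suc.IH[rule_format, of "i + 1"] i by simp_all
      show "T (Suc d) i \<in> Gr i n" using g Gr_D[OF G] by (auto simp: good_def Gr_def)
      show "T (Suc d) i \<subseteq> T d (i + 1)" "pr (i + d + 1) ` T d i \<subseteq> T (Suc d) i"
        using g by (auto simp: good_def)
      show "T (Suc d) i \<subseteq> coord_space ({1..i} \<union> {i+Suc d+1..n})"
      proof
        fix v assume "v \<in> T (Suc d) i"
        then have "v \<in> T d (i + 1)" "v (i + 1) = 0" using g by (auto simp: good_def)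
        then have v: "v l = 0" if "l \<notin> {1..i + 1} \<union> {i+1+d+1..n}" for l
          using W that by (auto simp: coord_space_def)
        show "v \<in> coord_space ({1..i} \<union> {i+Suc d+1..n})"
          unfolding coord_space_def
        proof (intro CollectI allI impI)
          fix l assume "l \<notin> {1..i} \<union> {i+Suc d+1..n}"
          then show "v l = 0" using v[of l] \<open>v (i + 1) = 0\<close> by (cases "l = i + 1") auto
        qed
      qed
    qed
    have "pr (i + Suc d + 1) ` T (Suc d) i \<subseteq> T (Suc d) (i + 1) \<and>
       good (T (Suc d) i) (T (Suc d) (i + 1)) i (Suc d) (T (Suc (Suc d)) i)"
      if i: "1 \<le> i" "i + Suc d + 1 < n" for i
    proof -
      note p = props[OF i(1)] and p1 = props[of "i + 1"]
      \<comment> \<open>The link is \<open>T d (i + 1)\<close>: it contains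
        \<open>T (Suc d) i\<close> by the choice for \<open>i\<close>, and it projects into
        \<open>T (Suc d) (i + 1)\<close> by the choice for \<open>i + 1\<close>.\<close>
      have sub: "pr (i + Suc d + 1) ` T (Suc d) i \<subseteq> T (Suc d) (i + 1)"
        using p(3) p1(4) i by fastforce
      have "v (i + 1) = 0" if "v \<in> T (Suc d) i" for v
        using p(2) i that by (force simp: coord_space_def)
      then have "pr (i + Suc d + 1) ` T (Suc d) i \<subseteq> {v \<in> T (Suc d) (i + 1). v (i + 1) = 0}"
        using sub by (auto simp: pr_apply)
      then show ?thesis using good_T[OF p(1) p1(1)] sub i by simp
    qed
    then show ?case using props by auto
  qed
  define V' where "V' = (\<lambda>(i, j)\<in>R_index n. T (j - i) i)"
  have V': "V' (i, j) = T (j - i) i" if "1 \<le> i" "i \<le> j" "j < n" for i j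
  proof -
    have "(i, j) \<in> R_index n" using that by (auto simp: R_index_def)
    then show ?thesis by (simp add: V'_def)
  qed
  have "V' \<in> R_variety n"
  proof (rule R_variety_I)
    have "V' (i, j) \<in> Gr i n" if "1 \<le> i" "i \<le> j" "j < n" for i j
      unfolding V'[OF that] using main[of "j - i"] that by simp
    then have "V' p \<in> Gr (fst p) n" if "p \<in> R_index n" for p
      using that by (cases p) (auto simp: R_index_def)
    then show "V' \<in> Gr_prod n (R_index n) fst"
      by (auto simp: Gr_prod_def V'_def)
  next
    fix i j assume ij: "1 \<le> i" "i \<le> j" "j < n"
    then show "V' (i, j) \<subseteq> coord_space ({1..i} \<union> {j+1..n})"
      unfolding V'[OF ij] using main[of "j - i", rule_format, of i] by simp
  next
    fix i j v assume ij: "1 \<le> i" "i \<le> j" "j + 1 < n" 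
    have g: "good (T (j - i) i) (T (j - i) (i + 1)) i (j - i) (T (Suc (j - i)) i)"
      using main[of "j - i"] ij by simp
    have eqs: "V' (i, j) = T (j - i) i" "V' (i, j + 1) = T (Suc (j - i)) i"
      "V' (i + 1, j + 1) = T (j - i) (i + 1)" using ij by (auto simp: V' Suc_diff_le)
    show "v \<in> V' (i, j) \<Longrightarrow> pr (j + 1) v \<in> V' (i, j + 1)"
      using g ij unfolding eqs good_def by auto
    show "v \<in> V' (i, j + 1) \<Longrightarrow> v \<in> V' (i + 1, j + 1)"
      using g unfolding eqs good_def by auto
  qed
  moreover have "proj_R n V' = V"
  proof
    fix i show "proj_R n V' i = V i"
      using V0 by (cases "i \<in> {1..n-1}") (auto simp: proj_R_def V' T0 PiE_def extensional_def)
  qed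
  ultimately show ?thesis by blast
qed

section \<open>The tower of projective lines\<close>

definition ext_fam :: "nat \<Rightarrow> (nat \<times> nat \<Rightarrow> (nat \<Rightarrow> complex) set) \<Rightarrow> nat \<Rightarrow> nat \<Rightarrow> (nat \<Rightarrow> complex) set" where
  "ext_fam n V i j = (if i = 0 then {0} else if j = n then coord_space {1..i} else V (i, j))"

text \<open>The conditions V_(i,j) in W_(i,j) are absorbed: descending from V_(i,n), each step back
  over \<open>pr (m + 1)\<close> frees only coordinate m + 1. Conversely, W_(i,n-1) is what makes
  the last projection land in V_(i,n).\<close>

lemma R_iff_tower:
  assumes V: "V \<in> Gr_prod n (R_index n) fst"
  shows "V \<in> R_variety n \<longleftrightarrow> (\<forall>i j. 1 \<le> i \<and> i \<le> j \<and> j < n \<longrightarrow>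
    ext_fam n V (i - 1) j \<subseteq> ext_fam n V i j \<and> (\<forall>v\<in>ext_fam n V i j. pr (j + 1) v \<in> ext_fam n V i (j + 1)))"
    (is "_ \<longleftrightarrow> ?tower")
proof
  assume R: "V \<in> R_variety n"
  show ?tower
  proof (intro allI impI conjI ballI)
    fix i j assume ij: "1 \<le> i \<and> i \<le> j \<and> j < n"
    show "ext_fam n V (i - 1) j \<subseteq> ext_fam n V i j"
    proof (cases "i = 1")
      case True
      then show ?thesis using R_D(1)[OF R, of i j] ij
        by (auto simp: ext_fam_def Gr_def cfun.subspace_0)
    next
      case False
      then have "1 \<le> i - 1" "i - 1 \<le> j - 1" "j - 1 < n" "j - 1 + 1 < n" "i - 1 + 1 = i" "j - 1 + 1 = j"
        using ij by linarith+
      then show ?thesis using R_D(4)[OF R, of "i - 1" "j - 1"] False ij by (simp add: ext_fam_def)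
    qed
    fix v assume "v \<in> ext_fam n V i j"
    then have v: "v \<in> V (i, j)" using ij by (simp add: ext_fam_def)
    show "pr (j + 1) v \<in> ext_fam n V i (j + 1)"
    proof (cases "j + 1 = n")
      case True
      then show ?thesis using R_D(2)[OF R, of i j] ij v
        by (force simp: ext_fam_def coord_space_def pr_apply)
    next
      case False
      then show ?thesis using R_D(3)[OF R, of i j] ij v by (simp add: ext_fam_def)
    qed
  qed
next
  assume tower: ?tower
  have t1: "ext_fam n V (i - 1) j \<subseteq> ext_fam n V i j" if "1 \<le> i" "i \<le> j" "j < n" for i j
    using tower that by blast
  have t2: "pr (j + 1) v \<in> ext_fam n V i (j + 1)" if "1 \<le> i" "i \<le> j" "j < n" "v \<in> V (i, j)" for i j v
    using tower that by (simp add: ext_fam_def)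
  show "V \<in> R_variety n"
  proof (rule R_variety_I[OF V])
    fix i j assume ij: "1 \<le> i" "i \<le> j" "j < n"
    have "ext_fam n V i j \<subseteq> coord_space ({1..i} \<union> {j+1..n})" if "j \<le> n"
      using that
    proof (induction j rule: inc_induct)
      case base
      then show ?case using ij by (simp add: ext_fam_def)
    next
      case (step m)
      show ?case
      proof
        fix v assume v: "v \<in> ext_fam n V i m"
        have m: "m < n" "i \<le> m" using step.hyps ij by auto
        have "pr (m + 1) v \<in> coord_space ({1..i} \<union> {m+1+1..n})"
          using step.IH tower v m ij(1) by auto
        then have "v l = 0" if "l \<notin> {1..i} \<union> {m+1+1..n}" "l \<noteq> m + 1" for l
          using that by (auto simp: coord_space_def pr_apply)
        then show "v \<in> coord_space ({1..i} \<union> {m+1..n})"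
          using m by (force simp: coord_space_def)
      qed
    qed
    then show "V (i, j) \<subseteq> coord_space ({1..i} \<union> {j+1..n})" using ij by (simp add: ext_fam_def)
  next
    fix i j v assume ij: "1 \<le> i" "i \<le> j" "j + 1 < n"
    show "v \<in> V (i, j) \<Longrightarrow> pr (j + 1) v \<in> V (i, j + 1)"
      using t2[of i j v] ij by (simp add: ext_fam_def)
    show "v \<in> V (i, j + 1) \<Longrightarrow> v \<in> V (i + 1, j + 1)"
      using t1[of "i + 1" "j + 1"] ij by (auto simp: ext_fam_def)
  qed
qed

section \<open>Charts adapted to the tower\<close>

text \<open>Such data record a point of R_n made of coordinate subspaces, V_(i,j) being spanned by
  the \<open>w_vec a\<close> with \<open>a\<close> in \<open>J i j\<close>, with the boundary values
  of \<open>ext_fam\<close>.\<close>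

locale tower_chart =
  fixes n :: nat and J :: "nat \<Rightarrow> nat \<Rightarrow> nat set"
  assumes J_0: "J 0 j = {}"
    and J_n: "J i n = {1..i}"
    and J_mono: "1 \<le> i \<Longrightarrow> i \<le> j \<Longrightarrow> j < n \<Longrightarrow> J (i - 1) j \<subseteq> J i j"
    and J_step: "1 \<le> i \<Longrightarrow> i \<le> j \<Longrightarrow> j < n \<Longrightarrow> J i j \<subseteq> insert (j + 1) (J i (j + 1))"
    and card_J: "i \<le> j \<Longrightarrow> j \<le> n \<Longrightarrow> card (J i j) = i"
    and J_W: "i \<le> j \<Longrightarrow> j \<le> n \<Longrightarrow> J i j \<subseteq> {1..i} \<union> {j+1..n}"

text \<open>When \<open>card A\<close> equals the dimension of a subspace \<open>S\<close> of W,
  this says that \<open>S\<close> lies in the Grassmannian chart of \<open>A\<close>, without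
  forming determinants.\<close>

definition inj_coords :: "(nat \<Rightarrow> complex) set \<Rightarrow> nat set \<Rightarrow> bool" where
  "inj_coords S A \<longleftrightarrow> (\<forall>v\<in>S. (\<forall>a\<in>A. v a = 0) \<longrightarrow> v = 0)"

text \<open>Every vanishing coordinate costs at most one dimension.\<close>

lemma exists_nonzero_vanishing:
  assumes "cfun.subspace B" "B \<subseteq> W_space n" "finite A" "card A < cfun.dim B"
  obtains v where "v \<in> B" "v \<noteq> 0" "\<And>a. a \<in> A \<Longrightarrow> v a = 0"
proof -
  have "cfun.dim B \<le> cfun.dim {v \<in> B. \<forall>a\<in>A. v a = 0} + card A"
    using assms(3)
  proof (induction A)
    case empty
    then show ?case by simp
  next
    case (insert a A)
    let ?C = "{v \<in> B. \<forall>a\<in>A. v a = 0}"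
    have "cfun.subspace ?C" using assms(1) by (auto simp: subspace_iff)
    then have "cfun.dim ?C \<le> Suc (cfun.dim {v \<in> ?C. v a = 0})"
      using assms(2) by (intro dim_hyperplane_section[of _ n]) auto
    moreover have "{v \<in> ?C. v a = 0} = {v \<in> B. \<forall>b\<in>insert a A. v b = 0}" by auto
    ultimately show ?case using insert by simp
  qed
  then have "cfun.dim {v \<in> B. \<forall>a\<in>A. v a = 0} \<noteq> 0" using assms(4) by simp
  then have "\<not> {v \<in> B. \<forall>a\<in>A. v a = 0} \<subseteq> cfun.span {}"
    using cfun.dim_le_card[of "{v \<in> B. \<forall>a\<in>A. v a = 0}" "{}"] by auto
  then show ?thesis using that by auto
qed

text \<open>\<open>B\<close> is \<open>A'\<close> plus the line of \<open>v\<close>. If u = a' + c v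
  vanishes on \<open>A\<close>, then so does a', which is therefore 0; coordinate \<open>k\<close>
  then forces c = 0.\<close>

lemma inj_coords_insert:
  assumes "cfun.subspace A'" "cfun.subspace B" "A' \<subseteq> B" "B \<subseteq> W_space n"
    and "cfun.dim B = Suc (cfun.dim A')" "inj_coords A' A"
    and "v \<in> B" "\<And>a. a \<in> A \<Longrightarrow> v a = 0" "v k \<noteq> 0"
  shows "inj_coords B (insert k A)"
  unfolding inj_coords_def
proof (intro ballI impI)
  fix u assume u: "u \<in> B" "\<forall>a\<in>insert k A. u a = 0"
  obtain b where b: "b \<subseteq> A'" "cfun.independent b" "A' \<subseteq> cfun.span b" "card b = cfun.dim A'"
    by (rule cfun.basis_exists)
  have sp: "cfun.span b = A'" using cfun.span_minimal[OF b(1) assms(1)] b(3) by blast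
  have "v \<notin> A'" using assms(6,8,9) by (auto simp: inj_coords_def)
  then have v: "v \<notin> b" "v \<notin> cfun.span b" using b(1) sp by auto
  have fin: "finite b" using b(1,2) assms(3,4) by (intro finite_independent_W) auto
  have ind: "cfun.independent (insert v b)" using v b(2) by (simp add: cfun.independent_insert)
  have "cfun.dim (cfun.span (insert v b)) = card (insert v b)"
    using cfun.dim_eq_card_independent[OF ind] by simp
  also have "\<dots> = cfun.dim B" using v fin b(4) assms(5) by simp
  finally have "cfun.span (insert v b) = B"
    using assms(2-4,7) b(1)
    by (intro subspace_dim_equal[where n = n] cfun.span_minimal) auto
  then obtain c where c: "u - (\<lambda>i. c * v i) \<in> A'"
    using u(1) cfun.span_breakdown_eq[of u v b] sp by auto
  moreover have "(u - (\<lambda>i. c * v i)) a = 0" if "a \<in> A" for a using that u(2) assms(8) by simp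
  ultimately have "u - (\<lambda>i. c * v i) = 0" using assms(6) unfolding inj_coords_def by blast
  then have eq: "u l = c * v l" for l by (auto simp: fun_eq_iff)
  have "c = 0" using eq[of k] u(2) assms(9) by simp
  then show "u = 0" using eq by (auto simp: fun_eq_iff)
qed

text \<open>The second argument is \<open>n - j\<close>.\<close>

fun adapted :: "nat \<Rightarrow> (nat \<times> nat \<Rightarrow> (nat \<Rightarrow> complex) set) \<Rightarrow> nat \<Rightarrow> nat \<Rightarrow> nat set" where
  "adapted n V 0 m = {}"
| "adapted n V (Suc i) 0 = {1..Suc i}"
| "adapted n V (Suc i) (Suc m) =
     (let A = adapted n V i (Suc m); C = insert (n - m) (adapted n V (Suc i) m)
      in insert (SOME k. k \<in> C - A \<and> inj_coords (V (Suc i, n - Suc m)) (insert k A)) A)"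

lemma ext_fam_subspace:
  assumes "V \<in> R_variety n" "i \<le> j" "j \<le> n"
  shows "cfun.subspace (ext_fam n V i j)" "ext_fam n V i j \<subseteq> W_space n" "cfun.dim (ext_fam n V i j) = i"
proof -
  consider "i = 0" | "1 \<le> i" "j = n" | "1 \<le> i" "j < n" using assms by linarith
  then have "cfun.subspace (ext_fam n V i j) \<and> ext_fam n V i j \<subseteq> W_space n \<and> cfun.dim (ext_fam n V i j) = i"
  proof cases
    case 1
    have "cfun.dim {0::nat \<Rightarrow> complex} = 0" using cfun.dim_le_card[of "{0}" "{}"] by simp
    then show ?thesis using 1 by (auto simp: ext_fam_def cfun.subspace_0 W_space_def cfun.subspace_single_0)
  next
    case 2
    then have "{1..i} \<subseteq> {1..n}" using assms by auto
    then show ?thesis using 2 dim_coord_space[of "{1..i}" n] coord_space_eq_graph[of "{1..i}" n]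
      by (auto simp: ext_fam_def subspace_graph_space dest: subsetD[OF graph_space_subset_W])
  next
    case 3
    then show ?thesis using R_D(1)[OF assms(1) 3(1) assms(2)] by (auto simp: ext_fam_def Gr_def)
  qed
  then show "cfun.subspace (ext_fam n V i j)" "ext_fam n V i j \<subseteq> W_space n" "cfun.dim (ext_fam n V i j) = i"
    by auto
qed

text \<open>An exchange argument: by dimension, some nonzero \<open>v\<close> in V_(i,j) vanishes on
  \<open>J (i - 1) j\<close>. Were it also zero on \<open>J i (j + 1)\<close> and at j + 1, then
  \<open>pr (j + 1) v\<close>, lying in V_(i,j+1), would be 0, and so would \<open>v\<close>. Hence
  a new index can be chosen inside that larger set.\<close>

lemma exists_tower_chart:
  assumes V: "V \<in> R_variety n"
  obtains J where "tower_chart n J"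
    "\<And>i j. 1 \<le> i \<Longrightarrow> i \<le> j \<Longrightarrow> j < n \<Longrightarrow> inj_coords (V (i, j)) (J i j)"
proof -
  let ?J = "adapted n V"
  have VG: "V \<in> Gr_prod n (R_index n) fst" using V by (simp add: R_variety_def)
  note tower = R_iff_tower[OF VG, THEN iffD1, OF V, rule_format]
  \<comment> \<open>The last two conjuncts refer to neighbours already treated: \<open>i\<close> is
    the outer induction, and \<open>m\<close>, standing for n - j, the inner one.\<close>
  define Inv where "Inv i m \<longleftrightarrow> inj_coords (ext_fam n V i (n - m)) (?J i m) \<and>
     ?J i m \<subseteq> {1..i} \<union> {n-m+1..n} \<and> card (?J i m) = i \<and>
     (1 \<le> i \<longrightarrow> ?J (i - 1) m \<subseteq> ?J i m) \<and>
     (1 \<le> m \<longrightarrow> ?J i m \<subseteq> insert (n - (m - 1)) (?J i (m - 1)))" for i m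
  have Inv: "i + m \<le> n \<Longrightarrow> Inv i m" for i m
  proof (induction i arbitrary: m)
    case 0
    then show ?case by (simp add: Inv_def inj_coords_def ext_fam_def)
  next
    case (Suc i)
    note IH = Suc.IH
    show ?case using Suc.prems
    proof (induction m)
      case 0
      have "adapted n V i 0 \<subseteq> {1..Suc i}" by (cases i) auto
      then show ?case using 0 by (auto simp: Inv_def inj_coords_def ext_fam_def coord_space_def fun_eq_iff)
    next
      case (Suc m)
      define A where "A = ?J i (Suc m)"
      define D where "D = ?J (Suc i) m"
      define j where "j = n - Suc m"
      have m: "n - m = j + 1" "j < n" "Suc i \<le> j" "n - Suc m = j" using Suc.prems by (auto simp: j_def)
      define C where "C = insert (j + 1) D"
      have I1: "Inv i (Suc m)" and I2: "Inv (Suc i) m"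
        using IH[of "Suc m"] Suc by auto
      have A: "inj_coords (ext_fam n V i j) A" "A \<subseteq> {1..i} \<union> {j+1..n}" "card A = i"
        "A \<subseteq> insert (j + 1) (?J i m)"
        using I1 m by (auto simp: Inv_def A_def)
      have D: "inj_coords (ext_fam n V (Suc i) (j + 1)) D" "D \<subseteq> {1..Suc i} \<union> {j+1+1..n}"
        "card D = Suc i" "?J i m \<subseteq> D"
        using I2 m by (auto simp: Inv_def D_def)
      \<comment> \<open>The square of neighbours closes: up to j + 1, \<open>A\<close> lies in
        \<open>?J i m\<close>, and this lies in \<open>D\<close>.\<close>
      have AC: "A \<subseteq> C" using A(4) D(4) by (auto simp: C_def)
      have fin: "finite A" using A(2) finite_subset by blast
      have i1: "1 \<le> Suc i" by simp
      note e = ext_fam_subspace[OF V m(3) less_imp_le[OF m(2)]]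
      have "i \<le> j" using m by simp
      note e' = ext_fam_subspace[OF V \<open>i \<le> j\<close> less_imp_le[OF m(2)]]
      obtain v where v: "v \<in> ext_fam n V (Suc i) j" "v \<noteq> 0" "\<And>a. a \<in> A \<Longrightarrow> v a = 0"
        using exists_nonzero_vanishing[OF e(1,2) fin] e(3) A(3) by auto
      have "\<exists>k\<in>C - A. v k \<noteq> 0"
      proof (rule ccontr)
        assume "\<not> ?thesis"
        then have z: "v k = 0" if "k \<in> C" for k using v(3) that by blast
        have "pr (j + 1) v \<in> ext_fam n V (Suc i) (j + 1)" using tower m v(1) by auto
        moreover have "pr (j + 1) v k = 0" if "k \<in> D" for k using z that by (auto simp: pr_apply C_def)
        ultimately have "pr (j + 1) v = 0" using D(1) by (auto simp: inj_coords_def)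
        then have "pr (j + 1) v k = 0" for k by simp
        from this[unfolded pr_apply] have "v k = 0" for k
          using z[of "j + 1"] by (metis C_def insertI1)
        then show False using v(2) by auto
      qed
      then obtain k0 where k0: "k0 \<in> C - A" "v k0 \<noteq> 0" by blast
      have ext: "ext_fam n V (Suc i) j = V (Suc i, j)" using m by (simp add: ext_fam_def)
      have "ext_fam n V i j \<subseteq> ext_fam n V (Suc i) j" using tower[of "Suc i" j] m by auto
      then have "inj_coords (V (Suc i, j)) (insert k0 A)"
        using inj_coords_insert[OF e'(1) e(1) _ e(2) _ A(1) v(1,3) k0(2)] e(3) e'(3) ext by auto
      then have ex: "\<exists>k. k \<in> C - A \<and> inj_coords (V (Suc i, j)) (insert k A)" using k0 by blast
      define k where "k = (SOME k. k \<in> C - A \<and> inj_coords (V (Suc i, j)) (insert k A))"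
      have k: "k \<in> C - A" "inj_coords (V (Suc i, j)) (insert k A)"
        using someI_ex[OF ex] by (auto simp: k_def)
      have J: "?J (Suc i) (Suc m) = insert k A"
        unfolding adapted.simps Let_def k_def C_def D_def A_def using m by simp
      have "insert k A \<subseteq> {1..Suc i} \<union> {j+1..n}" using k(1) A(2) D(2) m by (fastforce simp: C_def)
      moreover have "card (insert k A) = Suc i" using k(1) fin A(3) by simp
      moreover have "insert k A \<subseteq> insert (j + 1) D" using k(1) AC by (auto simp: C_def)
      ultimately show "Inv (Suc i) (Suc m)"
        unfolding Inv_def J m(4) ext using k(2) m(1) by (auto simp: A_def D_def)
    qed
  qed
  let ?T = "\<lambda>i j. ?J i (n - j)"
  have T: "Inv i (n - j)" if "i \<le> j" "j \<le> n" for i j using Inv[of i "n - j"] that by simp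
  have "tower_chart n ?T"
  proof
    show "?T 0 j = {}" for j by simp
    show "?T i n = {1..i}" for i by (cases i) auto
    show "?T (i - 1) j \<subseteq> ?T i j" if "1 \<le> i" "i \<le> j" "j < n" for i j
      using T[of i j] that by (simp add: Inv_def)
    show "?T i j \<subseteq> insert (j + 1) (?T i (j + 1))" if "1 \<le> i" "i \<le> j" "j < n" for i j
    proof -
      have "n - j - 1 = n - (j + 1)" "n - (n - j - 1) = j + 1" using that by auto
      then show ?thesis using T[of i j] that by (simp add: Inv_def)
    qed
    show "card (?T i j) = i" "?T i j \<subseteq> {1..i} \<union> {j+1..n}" if "i \<le> j" "j \<le> n" for i j
      using T[OF that] that by (auto simp: Inv_def)
  qed
  moreover have "inj_coords (V (i, j)) (?T i j)" if "1 \<le> i" "i \<le> j" "j < n" for i j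
    using T[of i j] that by (auto simp: Inv_def ext_fam_def)
  ultimately show ?thesis using that by blast
qed

lemma in_Gr_chart:
  assumes "V \<in> Gr_prod n K d" "chart_index n K d I" "\<And>k. k \<in> K \<Longrightarrow> inj_coords (V k) (I k)"
  obtains y where "y \<in> affine_space (Gr_chart_vars n K I)" "V = Gr_chart n K I y"
proof -
  have "\<exists>m. V k = graph_space n (I k) m" if k: "k \<in> K" for k
  proof -
    have Vk: "V k \<in> Gr (d k) n" using assms(1) k by (auto simp: Gr_prod_def dest: PiE_mem)
    have I: "I k \<subseteq> {1..n}" "card (I k) = d k" using assms(2) k by (auto simp: chart_index_def)
    show ?thesis
      by (rule graph_space_if_injective[OF Gr_D(1,2)[OF Vk] I(1)])
        (use Gr_D(3)[OF Vk] I(2) assms(3)[OF k] in \<open>auto simp: inj_coords_def\<close>)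
  qed
  then obtain m where m: "\<And>k. k \<in> K \<Longrightarrow> V k = graph_space n (I k) (m k)" by metis
  define y where "y = (\<lambda>(k, i, j). if (k, i, j) \<in> Gr_chart_vars n K I then m k i j else 0)"
  have "V k = Gr_chart n K I y k" for k
  proof (cases "k \<in> K")
    case True
    have "graph_space n (I k) (m k) = graph_space n (I k) (\<lambda>i j. y (k, i, j))"
      using True by (intro graph_space_cong) (auto simp: y_def Gr_chart_vars_def)
    then show ?thesis using m[OF True] Gr_chart_apply[OF assms(2) True] by simp
  next
    case False
    then show ?thesis using assms(1) by (auto simp: Gr_prod_def Gr_chart_def PiE_def extensional_def)
  qed
  then have "V = Gr_chart n K I y" by blast
  moreover have "y \<in> affine_space (Gr_chart_vars n K I)"
    by (auto simp: y_def affine_space_def)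
  ultimately show ?thesis using that by blast
qed

text \<open>It suffices to test the rows of the smaller graph. Among the coordinates in
  \<open>B\<close>, the row of \<open>a\<close> has a 1 at \<open>a\<close> and the entries
  \<open>\<alpha> a p\<close> at \<open>p\<close> in \<open>B - A\<close>.\<close>

lemma graph_space_subset_iff:
  assumes "A \<subseteq> B" "B \<subseteq> {1..n}"
  shows "graph_space n A \<alpha> \<subseteq> graph_space n B \<beta> \<longleftrightarrow>
    (\<forall>a\<in>A. \<forall>b\<in>{1..n} - B. \<alpha> a b = \<beta> a b + (\<Sum>p\<in>B - A. \<alpha> a p * \<beta> p b))"
proof -
  have fin: "finite B" "finite A"
    using assms finite_subset[of B "{1..n}"] finite_subset[of A B] by auto
  have A: "A \<subseteq> {1..n}" using assms by auto
  have row: "graph_row n A \<alpha> a \<in> graph_space n B \<beta> \<longleftrightarrow>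
      (\<forall>b\<in>{1..n} - B. \<alpha> a b = \<beta> a b + (\<Sum>p\<in>B - A. \<alpha> a p * \<beta> p b))" if a: "a \<in> A" for a
  proof -
    have "(\<Sum>p\<in>B. graph_row n A \<alpha> a p * \<beta> p b) = \<beta> a b + (\<Sum>p\<in>B - A. \<alpha> a p * \<beta> p b)" for b
    proof -
      have "(\<Sum>p\<in>B. graph_row n A \<alpha> a p * \<beta> p b)
          = (\<Sum>p\<in>A. graph_row n A \<alpha> a p * \<beta> p b) + (\<Sum>p\<in>B - A. graph_row n A \<alpha> a p * \<beta> p b)"
        using sum.subset_diff[OF assms(1) fin(1)] by (simp add: add.commute)
      also have "(\<Sum>p\<in>A. graph_row n A \<alpha> a p * \<beta> p b) = (\<Sum>p\<in>A. if p = a then \<beta> p b else 0)"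
        by (intro sum.cong) (auto simp: graph_row_def)
      also have "\<dots> = \<beta> a b" using fin a by simp
      also have "(\<Sum>p\<in>B - A. graph_row n A \<alpha> a p * \<beta> p b) = (\<Sum>p\<in>B - A. \<alpha> a p * \<beta> p b)"
        using assms a by (intro sum.cong) (auto simp: graph_row_def)
      finally show ?thesis .
    qed
    moreover have "graph_row n A \<alpha> a b = \<alpha> a b" if "b \<in> {1..n} - B" for b
      using that a assms by (auto simp: graph_row_def)
    moreover have "graph_row n A \<alpha> a l = 0" if "l \<notin> {1..n}" for l
      using that a A by (auto simp: graph_row_def)
    ultimately show ?thesis by (auto simp: graph_space_def)
  qed
  have "graph_space n A \<alpha> \<subseteq> graph_space n B \<beta> \<longleftrightarrow> (\<forall>a\<in>A. graph_row n A \<alpha> a \<in> graph_space n B \<beta>)"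
  proof
    assume "\<forall>a\<in>A. graph_row n A \<alpha> a \<in> graph_space n B \<beta>"
    then have "cfun.span (graph_row n A \<alpha> ` A) \<subseteq> graph_space n B \<beta>"
      by (intro cfun.span_minimal subspace_graph_space) auto
    then show "graph_space n A \<alpha> \<subseteq> graph_space n B \<beta>" by (simp add: span_graph_rows[OF A])
  qed (use graph_row_in[OF A] in blast)
  then show ?thesis using row by simp
qed

text \<open>A subspace between a codimension-two pair is determined by its one entry at \<open>(k, l)\<close>.\<close>

lemma graph_space_between:
  fixes \<alpha> \<beta> \<gamma> :: "nat \<Rightarrow> nat \<Rightarrow> complex" and k l :: nat
  assumes C: "insert l (insert k A) \<subseteq> {1..n}" and k: "k \<notin> A" and l: "l \<notin> insert k A"
    and AC: "graph_space n A \<alpha> \<subseteq> graph_space n (insert l (insert k A)) \<gamma>"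
  defines "t \<equiv> \<lambda>b. if b = l then \<beta> k l else \<gamma> k b + \<beta> k l * \<gamma> l b"
  shows "graph_space n A \<alpha> \<subseteq> graph_space n (insert k A) \<beta> \<and>
      graph_space n (insert k A) \<beta> \<subseteq> graph_space n (insert l (insert k A)) \<gamma> \<longleftrightarrow>
    (\<forall>b\<in>{1..n} - insert k A. \<beta> k b = t b \<and> (\<forall>a\<in>A. \<beta> a b = \<alpha> a b - \<alpha> a k * t b))"
    (is "?L \<longleftrightarrow> ?R")
proof -
  let ?C = "{1..n} - insert l (insert k A)" and ?B = "{1..n} - insert k A"
  have fin: "finite A" using C finite_subset[of A "{1..n}"] by simp
  have diffs: "insert k A - A = {k}" "insert l (insert k A) - insert k A = {l}"
    "insert l (insert k A) - A = {k, l}" "k \<noteq> l" using k l by auto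
  have B: "?B = insert l ?C" using C l by auto
  have AC': "\<alpha> a b = \<gamma> a b + (\<alpha> a k * \<gamma> k b + \<alpha> a l * \<gamma> l b)" if "a \<in> A" "b \<in> ?C" for a b
    using AC that diffs(4) unfolding graph_space_subset_iff[OF _ C, of A, OF subset_insertI2[OF subset_insertI]] diffs
    by simp
  have AB: "graph_space n A \<alpha> \<subseteq> graph_space n (insert k A) \<beta> \<longleftrightarrow>
      (\<forall>a\<in>A. \<forall>b\<in>?B. \<alpha> a b = \<beta> a b + \<alpha> a k * \<beta> k b)"
    using C by (subst graph_space_subset_iff) (auto simp: diffs)
  have BC: "graph_space n (insert k A) \<beta> \<subseteq> graph_space n (insert l (insert k A)) \<gamma> \<longleftrightarrow>
      (\<forall>p\<in>insert k A. \<forall>b\<in>?C. \<beta> p b = \<gamma> p b + \<beta> p l * \<gamma> l b)"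
    using C by (subst graph_space_subset_iff) (auto simp: diffs)
  show ?thesis
  proof
    assume ?L
    then have ab: "\<And>a b. a \<in> A \<Longrightarrow> b \<in> ?B \<Longrightarrow> \<alpha> a b = \<beta> a b + \<alpha> a k * \<beta> k b"
      and bc: "\<And>b. b \<in> ?C \<Longrightarrow> \<beta> k b = \<gamma> k b + \<beta> k l * \<gamma> l b"
      unfolding AB BC by blast+
    have "\<beta> k b = t b" if "b \<in> ?B" for b using that bc unfolding B t_def by auto
    then show ?R using ab by (metis add_diff_cancel_right')
  next
    assume R: ?R
    have kb: "\<beta> k b = t b" if "b \<in> ?B" for b using R that by blast
    have ab: "\<beta> a b = \<alpha> a b - \<alpha> a k * t b" if "a \<in> A" "b \<in> ?B" for a b using R that by blast
    \<comment> \<open>Only row \<open>k\<close> has to be checked: row \<open>p\<close> of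
      \<open>\<beta>\<close> is row \<open>p\<close> of \<open>\<alpha>\<close> minus
      \<open>\<alpha> p k\<close> times row \<open>k\<close>, and the rows of
      \<open>\<alpha>\<close> lie in the larger space by \<open>AC'\<close>.\<close>
    have "\<beta> p b = \<gamma> p b + \<beta> p l * \<gamma> l b" if "p \<in> insert k A" "b \<in> ?C" for p b
    proof (cases "p = k")
      case True
      then show ?thesis using kb[of b] that by (auto simp: t_def)
    next
      case False
      then have p: "p \<in> A" using that by blast
      have tb: "t b = \<gamma> k b + \<beta> k l * \<gamma> l b" "t l = \<beta> k l" using that by (auto simp: t_def)
      have \<beta>: "\<beta> p b = \<alpha> p b - \<alpha> p k * t b" "\<beta> p l = \<alpha> p l - \<alpha> p k * t l"
        using ab[OF p] that B by blast+
      show ?thesis unfolding \<beta> tb AC'[OF p that(2)] by (simp add: algebra_simps)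
    qed
    moreover have "\<alpha> a b = \<beta> a b + \<alpha> a k * \<beta> k b" if "a \<in> A" "b \<in> ?B" for a b
      using ab[OF that] kb[OF that(2)] by simp
    ultimately show ?L unfolding AB BC by blast
  qed
qed

text \<open>Within \<open>W_space n\<close> the preimage adds the line of \<open>w_vec d\<close>, so
  index \<open>d\<close> joins with a zero row. The premise on \<open>m p d\<close> places the given
  space in the hyperplane where coordinate \<open>d\<close> vanishes.\<close>

lemma pr_vimage_graph_space:
  assumes "d \<in> {1..n}" "d \<notin> D" "D \<subseteq> {1..n}" "\<And>p. p \<in> D \<Longrightarrow> m p d = 0"
  shows "graph_space n (insert d D) (\<lambda>p b. if p = d then 0 else m p b)
    = {v \<in> W_space n. pr d v \<in> graph_space n D m}"
proof -
  have fin: "finite D" using assms(3) finite_subset[of D "{1..n}"] by simp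
  have "(\<Sum>p\<in>insert d D. v p * (if p = d then 0 else m p b)) = (\<Sum>p\<in>D. v p * m p b)" for v b
    using fin assms(2) by simp (intro sum.cong, auto)
  moreover have "(\<Sum>p\<in>D. pr d v p * m p b) = (\<Sum>p\<in>D. v p * m p b)" for v b
    using assms(2) by (intro sum.cong) (auto simp: pr_apply)
  moreover have "(\<Sum>p\<in>D. v p * m p d) = 0" for v using assms(4) by simp
  ultimately show ?thesis
    using assms(1,2) by (auto simp: graph_space_def W_space_eq coord_space_def pr_apply)
qed

lemma exists_insert:
  assumes "A \<subseteq> B" "card B = Suc (card A)" "finite B"
  shows "\<exists>k. k \<notin> A \<and> B = insert k A"
proof -
  have "finite A" using assms finite_subset by blast
  then have "card (B - A) = 1" using assms by (simp add: card_Diff_subset)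
  then obtain k where "B - A = {k}" by (rule card_1_singletonE)
  then show ?thesis using assms(1) by blast
qed

section \<open>Equations of R_n in an adapted chart\<close>

context tower_chart
begin

abbreviation "K \<equiv> R_index n"
definition "I = (\<lambda>(i, j). J i j)"
abbreviation "E \<equiv> Gr_chart_vars n K I"
abbreviation "\<phi> \<equiv> Gr_chart n K I"

lemma K_iff: "(i, j) \<in> K \<longleftrightarrow> 1 \<le> i \<and> i \<le> j \<and> j < n"
  by (auto simp: R_index_def)

lemma J_sub: "i \<le> j \<Longrightarrow> j \<le> n \<Longrightarrow> J i j \<subseteq> {1..n}"
  using J_W[of i j] by auto

lemma chart_index_I: "chart_index n K fst I"
proof -
  have "J i j \<subseteq> {1..n} \<and> card (J i j) = i" if "(i, j) \<in> K" for i j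
    using that J_sub[of i j] card_J[of i j] by (simp add: K_iff)
  then show ?thesis by (auto simp: chart_index_def I_def)
qed

lemma E_iff: "((i, j), a, b) \<in> E \<longleftrightarrow> 1 \<le> i \<and> i \<le> j \<and> j < n \<and> a \<in> J i j \<and> b \<in> {1..n} - J i j"
  by (auto simp: Gr_chart_vars_def K_iff I_def)

definition "X y i j = graph_space n (J i j) (\<lambda>a b. y ((i, j), a, b))"

text \<open>Points of \<open>affine_space E\<close> vanish off \<open>E\<close>, so the index sets
  alone produce the boundary spaces, and the cases i = 0 and j = n follow the general
  formula.\<close>

lemma ext_fam_chart:
  assumes "y \<in> affine_space E" "i \<le> j" "j \<le> n"
  shows "ext_fam n (\<phi> y) i j = X y i j"
proof -
  consider "i = 0" | "1 \<le> i" "j = n" | "1 \<le> i" "j < n" using assms by linarith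
  then show ?thesis
  proof cases
    case 1
    then show ?thesis
      using graph_space_eqI_zero[of "{}" n] cfun.subspace_0[OF subspace_graph_space, of n "{}"]
      by (auto simp: ext_fam_def X_def J_0)
  next
    case 2
    then have "{1..i} \<subseteq> {1..n}" using assms by auto
    moreover have "y ((i, j), a, b) = 0" for a b
      using assms(1) 2 E_iff[of i j a b] by (auto simp: affine_space_def)
    ultimately show ?thesis using 2 coord_space_eq_graph[of "{1..i}" n] by (simp add: ext_fam_def X_def J_n)
  next
    case 3
    then have "(i, j) \<in> K" using assms by (simp add: K_iff)
    then show ?thesis using 3 Gr_chart_apply[OF chart_index_I, of "(i, j)"]
      by (simp add: ext_fam_def X_def I_def)
  qed
qed

text \<open>The entry at (\<open>\<kappa> i j\<close>, \<open>\<mu> i j\<close>) is the affine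
  coordinate on the projective line of spaces between V_(i-1,j) and the preimage of V_(i,j+1) under
  \<open>pr (j + 1)\<close>.\<close>

definition "\<kappa> i j = (SOME k. k \<notin> J (i - 1) j \<and> J i j = insert k (J (i - 1) j))"
definition "\<mu> i j = (SOME l. l \<notin> J i j \<and> insert (j + 1) (J i (j + 1)) = insert l (J i j))"

lemma \<kappa>\<mu>:
  assumes "1 \<le> i" "i \<le> j" "j < n"
  shows "\<kappa> i j \<notin> J (i - 1) j" "J i j = insert (\<kappa> i j) (J (i - 1) j)"
    and "\<mu> i j \<notin> J i j" "insert (j + 1) (J i (j + 1)) = insert (\<mu> i j) (J i j)"
    and "j + 1 \<notin> J i (j + 1)"
proof -
  have fin: "finite (J i j)" if "i \<le> j" "j \<le> n" for i j
    using finite_subset[OF J_sub[OF that]] by simp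
  have "\<exists>k. k \<notin> J (i - 1) j \<and> J i j = insert k (J (i - 1) j)"
    using assms J_mono[of i j] card_J[of i j] card_J[of "i - 1" j] fin[of i j] by (intro exists_insert) auto
  from someI_ex[OF this] show "\<kappa> i j \<notin> J (i - 1) j" "J i j = insert (\<kappa> i j) (J (i - 1) j)"
    by (auto simp: \<kappa>_def)
  show *: "j + 1 \<notin> J i (j + 1)" using J_W[of i "j + 1"] assms by auto
  have "\<exists>l. l \<notin> J i j \<and> insert (j + 1) (J i (j + 1)) = insert l (J i j)"
    using assms J_step[of i j] card_J[of i j] card_J[of i "j + 1"] fin[of i "j + 1"] *
    by (intro exists_insert) auto
  from someI_ex[OF this] show "\<mu> i j \<notin> J i j" "insert (j + 1) (J i (j + 1)) = insert (\<mu> i j) (J i j)"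
    by (auto simp: \<mu>_def)
qed

text \<open>\<open>\<gamma> y i j\<close> are the coordinates of \<open>V\<^sub>i\<^sub>,\<^sub>j\<^sub>+\<^sub>1 \<oplus> \<langle>w\<^sub>j\<^sub>+\<^sub>1\<rangle>\<close>.\<close>

definition "\<gamma> y i j p b = (if p = j + 1 then 0 else y ((i, j + 1), p, b) :: complex)"

text \<open>The row \<open>t\<close> of \<open>graph_space_between\<close>: row
  \<open>\<kappa> i j\<close> as forced by the free entry and the larger space.\<close>

definition "\<tau> y i j b = (if b = \<mu> i j then y ((i, j), \<kappa> i j, \<mu> i j)
  else \<gamma> y i j (\<kappa> i j) b + y ((i, j), \<kappa> i j, \<mu> i j) * \<gamma> y i j (\<mu> i j) b :: complex)"

text \<open>One round of the tower equations, solved for the entries at each (i, j) and keeping the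
  free ones. The points of R_n in the chart are its fixed points.\<close>

definition "S y = (\<lambda>((i, j), a, b). if ((i, j), a, b) \<in> E
  then (if a = \<kappa> i j then \<tau> y i j b else y ((i - 1, j), a, b) - y ((i - 1, j), a, \<kappa> i j) * \<tau> y i j b)
  else (0::complex))"

definition "F = {((i, j), \<kappa> i j, \<mu> i j) | i j. (i, j) \<in> K}"

lemma F_sub: "F \<subseteq> E"
proof
  fix e assume "e \<in> F"
  then obtain i j where e: "e = ((i, j), \<kappa> i j, \<mu> i j)" "(i, j) \<in> K" by (auto simp: F_def)
  then have ij: "1 \<le> i" "i \<le> j" "j < n" by (auto simp: K_iff)
  have "\<mu> i j \<in> insert (j + 1) (J i (j + 1))" using \<kappa>\<mu>(4)[OF ij] by blast
  then have "\<mu> i j \<in> {1..n}" using J_sub[of i "j + 1"] ij by auto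
  then show "e \<in> E" using e ij \<kappa>\<mu>[OF ij] by (auto simp: E_iff)
qed

text \<open>An instance of \<open>graph_space_between\<close> between V_(i-1,j) and the preimage of
  V_(i,j+1). The premises \<open>zero\<close> and \<open>AC\<close> are what must be known about
  these neighbours: the preimage has graph form, and it contains V_(i-1,j).\<close>

lemma system_local:
  assumes y: "y \<in> affine_space E" and ij: "1 \<le> i" "i \<le> j" "j < n"
    and zero: "\<And>p. p \<in> J i (j + 1) \<Longrightarrow> y ((i, j + 1), p, j + 1) = 0"
    and AC: "\<And>v. v \<in> X y (i - 1) j \<Longrightarrow> pr (j + 1) v \<in> X y i (j + 1)"
  shows "X y (i - 1) j \<subseteq> X y i j \<and> (\<forall>v\<in>X y i j. pr (j + 1) v \<in> X y i (j + 1)) \<longleftrightarrow>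
    (\<forall>a b. ((i, j), a, b) \<in> E \<longrightarrow> S y ((i, j), a, b) = y ((i, j), a, b))"
proof -
  let ?A = "J (i - 1) j" and ?k = "\<kappa> i j" and ?l = "\<mu> i j" and ?\<alpha> = "\<lambda>a b. y ((i - 1, j), a, b)"
    and ?\<beta> = "\<lambda>a b. y ((i, j), a, b)"
  note km = \<kappa>\<mu>[OF ij]
  let ?C = "graph_space n (insert ?l (insert ?k ?A)) (\<gamma> y i j)"
  have C: "?C = {v \<in> W_space n. pr (j + 1) v \<in> X y i (j + 1)}"
    unfolding X_def km(2)[symmetric] km(4)[symmetric] \<gamma>_def
    using pr_vimage_graph_space[of "j + 1" n "J i (j + 1)" "\<lambda>a b. y ((i, j + 1), a, b)"] km(5) zero
      J_sub[of i "j + 1"] ij by simp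
  have W: "X y i j \<subseteq> W_space n" for i j unfolding X_def by (rule graph_space_subset_W)
  have sub: "insert ?l (insert ?k ?A) \<subseteq> {1..n}"
    unfolding km(2)[symmetric] km(4)[symmetric] using J_sub[of i "j + 1"] ij by auto
  have "graph_space n ?A ?\<alpha> \<subseteq> ?C" unfolding C using AC W unfolding X_def by blast
  note between = graph_space_between[OF sub km(1) km(3)[unfolded km(2)] this, of ?\<beta>]
  have "(\<forall>v\<in>X y i j. pr (j + 1) v \<in> X y i (j + 1)) \<longleftrightarrow> graph_space n (insert ?k ?A) ?\<beta> \<subseteq> ?C"
    unfolding C using W[of i j] unfolding X_def km(2)[symmetric] by blast
  moreover have "X y (i - 1) j \<subseteq> X y i j \<longleftrightarrow> graph_space n ?A ?\<alpha> \<subseteq> graph_space n (insert ?k ?A) ?\<beta>"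
    unfolding X_def km(2)[symmetric] ..
  moreover have "(\<forall>b\<in>{1..n} - insert ?k ?A. ?\<beta> ?k b = \<tau> y i j b \<and> (\<forall>a\<in>?A. ?\<beta> a b = ?\<alpha> a b - ?\<alpha> a ?k * \<tau> y i j b))
      \<longleftrightarrow> (\<forall>a b. ((i, j), a, b) \<in> E \<longrightarrow> S y ((i, j), a, b) = y ((i, j), a, b))"
  proof -
    have "((i, j), a, b) \<in> E \<longleftrightarrow> a \<in> insert ?k ?A \<and> b \<in> {1..n} - insert ?k ?A" for a b
      using ij by (simp add: E_iff km(2))
    moreover have "S y ((i, j), ?k, b) = \<tau> y i j b" if "b \<in> {1..n} - insert ?k ?A" for b
      using that ij by (simp add: S_def E_iff km(2))
    moreover have "S y ((i, j), a, b) = ?\<alpha> a b - ?\<alpha> a ?k * \<tau> y i j b"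
      if "a \<in> ?A" "b \<in> {1..n} - insert ?k ?A" for a b
      using that ij km(1) by (auto simp: S_def E_iff km(2))
    ultimately show ?thesis by (metis insert_iff)
  qed
  ultimately show ?thesis using between unfolding \<tau>_def by simp
qed

text \<open>\<open>system_local\<close> presupposes good neighbours (i, j + 1) and (i - 1, j). For
  the converse direction this forces an induction on i + (n - j), which both decrease, with the
  condition on W_(i,j) carried along.\<close>

lemma chart_in_R_iff:
  assumes y: "y \<in> affine_space E"
  shows "\<phi> y \<in> R_variety n \<longleftrightarrow> S y = y"
proof -
  have S_eq: "S y = y \<longleftrightarrow> (\<forall>i j. 1 \<le> i \<and> i \<le> j \<and> j < n \<longrightarrow>
      (\<forall>a b. ((i, j), a, b) \<in> E \<longrightarrow> S y ((i, j), a, b) = y ((i, j), a, b)))"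
  proof
    assume eq: "\<forall>i j. 1 \<le> i \<and> i \<le> j \<and> j < n \<longrightarrow>
      (\<forall>a b. ((i, j), a, b) \<in> E \<longrightarrow> S y ((i, j), a, b) = y ((i, j), a, b))"
    show "S y = y"
    proof
      fix e :: "(nat \<times> nat) \<times> nat \<times> nat"
      obtain i j a b where e: "e = ((i, j), a, b)" by (metis surj_pair)
      show "S y e = y e"
      proof (cases "e \<in> E")
        case True
        then show ?thesis using eq E_iff[of i j a b] unfolding e by blast
      next
        case False
        then show ?thesis using y by (simp add: S_def e affine_space_def)
      qed
    qed
  qed simp
  have "\<phi> y \<in> Gr_prod n K fst" using chart_index_I by (rule Gr_chart_in_Gr_prod)
  note R_iff_tower[OF this]
  moreover have "(ext_fam n (\<phi> y) (i - 1) j \<subseteq> ext_fam n (\<phi> y) i j \<and>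
      (\<forall>v\<in>ext_fam n (\<phi> y) i j. pr (j + 1) v \<in> ext_fam n (\<phi> y) i (j + 1))) \<longleftrightarrow>
      (X y (i - 1) j \<subseteq> X y i j \<and> (\<forall>v\<in>X y i j. pr (j + 1) v \<in> X y i (j + 1)))"
    if "1 \<le> i \<and> i \<le> j \<and> j < n" for i j
    using ext_fam_chart[OF y, of i j] ext_fam_chart[OF y, of "i - 1" j] ext_fam_chart[OF y, of i "j + 1"] that
    by (simp add: le_diff_conv)
  ultimately have R_iff: "\<phi> y \<in> R_variety n \<longleftrightarrow> (\<forall>i j. 1 \<le> i \<and> i \<le> j \<and> j < n \<longrightarrow>
      X y (i - 1) j \<subseteq> X y i j \<and> (\<forall>v\<in>X y i j. pr (j + 1) v \<in> X y i (j + 1)))" by simp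
  have Xn: "X y i n = coord_space {1..i}" if "1 \<le> i" "i \<le> n" for i
    using ext_fam_chart[OF y, of i n] that by (simp add: ext_fam_def)
  have X0: "X y 0 j = {0}" if "j \<le> n" for j
    using ext_fam_chart[OF y, of 0 j] that by (simp add: ext_fam_def)
  \<comment> \<open>For i < j the space W_(i,j) omits coordinate \<open>j\<close>, so column
    \<open>j\<close> of the matrix is zero.\<close>
  have zero: "y ((i, j), p, j) = 0"
    if "1 \<le> i" "i < j" "j \<le> n" "X y i j \<subseteq> coord_space ({1..i} \<union> {j+1..n})" "p \<in> J i j" for i j p
  proof -
    have "graph_row n (J i j) (\<lambda>a b. y ((i, j), a, b)) p \<in> X y i j"
      unfolding X_def using that J_sub[of i j] by (intro graph_row_in) auto
    then have "graph_row n (J i j) (\<lambda>a b. y ((i, j), a, b)) p j = 0"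
      using that(2,4) by (auto simp: coord_space_def)
    moreover have "j \<notin> J i j" using J_W[of i j] that by auto
    ultimately show ?thesis using that by (auto simp: graph_row_def split: if_splits)
  qed
  have local: "X y (i - 1) j \<subseteq> X y i j \<and> (\<forall>v\<in>X y i j. pr (j + 1) v \<in> X y i (j + 1)) \<longleftrightarrow>
      (\<forall>a b. ((i, j), a, b) \<in> E \<longrightarrow> S y ((i, j), a, b) = y ((i, j), a, b))"
    if ij: "1 \<le> i" "i \<le> j" "j < n" and W: "X y i (j + 1) \<subseteq> coord_space ({1..i} \<union> {j+1+1..n})"
      and AC: "\<And>v. v \<in> X y (i - 1) j \<Longrightarrow> pr (j + 1) v \<in> X y i (j + 1)" for i j
    using system_local[OF y ij zero AC] W ij by simp
  show ?thesis
  proof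
    assume R: "\<phi> y \<in> R_variety n"
    have "\<forall>a b. ((i, j), a, b) \<in> E \<longrightarrow> S y ((i, j), a, b) = y ((i, j), a, b)"
      if ij: "1 \<le> i" "i \<le> j" "j < n" for i j
    proof -
      have good: "X y (i - 1) j \<subseteq> X y i j \<and> (\<forall>v\<in>X y i j. pr (j + 1) v \<in> X y i (j + 1))"
        using R R_iff ij by blast
      have "X y i (j + 1) \<subseteq> coord_space ({1..i} \<union> {j+1+1..n})"
      proof (cases "j + 1 = n")
        case True
        then show ?thesis using Xn[of i] ij by simp
      next
        case False
        then show ?thesis using R_D(2)[OF R, of i "j + 1"] ext_fam_chart[OF y, of i "j + 1"] ij
          by (simp add: ext_fam_def)
      qed
      from local[OF ij this] good show ?thesis by blast
    qed
    then show "S y = y" unfolding S_eq by blast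
  next
    assume Sy: "S y = y"
    have "X y (i - 1) j \<subseteq> X y i j \<and> (\<forall>v\<in>X y i j. pr (j + 1) v \<in> X y i (j + 1)) \<and>
        X y i j \<subseteq> coord_space ({1..i} \<union> {j+1..n})" if "1 \<le> i" "i \<le> j" "j < n" for i j
      using that
    proof (induction "i + (n - j)" arbitrary: i j rule: less_induct)
      case less
      note ij = less.prems
      have W: "X y i (j + 1) \<subseteq> coord_space ({1..i} \<union> {j+1+1..n})"
        using less.hyps[of i "j + 1"] ij Xn[of i] by (cases "j + 1 = n") auto
      \<comment> \<open>Around the square: V_(i-1,j) projects into V_(i-1,j+1), which lies in
        V_(i,j+1).\<close>
      have AC: "pr (j + 1) v \<in> X y i (j + 1)" if v: "v \<in> X y (i - 1) j" for v
      proof (cases "i = 1")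
        case True
        then have "v = 0" using v X0[of j] ij by simp
        then show ?thesis by (simp add: pr.zero X_def cfun.subspace_0[OF subspace_graph_space])
      next
        case False
        then have "pr (j + 1) v \<in> X y (i - 1) (j + 1)" using less.hyps[of "i - 1" j] v ij by auto
        moreover have "X y (i - 1) (j + 1) \<subseteq> X y i (j + 1)"
        proof (cases "j + 1 = n")
          case True
          then show ?thesis using Xn[of i] Xn[of "i - 1"] ij False by (auto simp: coord_space_def)
        next
          case False
          then show ?thesis using less.hyps[of i "j + 1"] ij by auto
        qed
        ultimately show ?thesis by blast
      qed
      have good: "X y (i - 1) j \<subseteq> X y i j \<and> (\<forall>v\<in>X y i j. pr (j + 1) v \<in> X y i (j + 1))"
        using local[OF ij W AC] Sy by simp
      have "X y i j \<subseteq> coord_space ({1..i} \<union> {j+1..n})"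
      proof
        fix v assume "v \<in> X y i j"
        then have v: "v \<in> W_space n"
          using subsetD[OF graph_space_subset_W] unfolding X_def by blast
        have v': "pr (j + 1) v \<in> coord_space ({1..i} \<union> {j+1+1..n})"
          using good W \<open>v \<in> X y i j\<close> by blast
        show "v \<in> coord_space ({1..i} \<union> {j+1..n})"
          unfolding coord_space_def
        proof (intro CollectI allI impI)
          fix l assume "l \<notin> {1..i} \<union> {j+1..n}"
          then show "v l = 0" using v v' ij by (cases "l = j + 1") (auto simp: W_space_eq coord_space_def pr_apply split: if_splits)
        qed
      qed
      then show ?case using good by blast
    qed
    then show "\<phi> y \<in> R_variety n" unfolding R_iff by blast
  qed
qed

definition "rk = (\<lambda>((i, j), a :: nat, b :: nat). i + (n - j))"

text \<open>Entries at (i, j) are computed from (i, j + 1), (i - 1, j) and the free entry, and both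
  neighbours have smaller \<open>rk\<close>.\<close>

lemma S_triangular:
  assumes u: "u \<in> affine_space E" and v: "v \<in> affine_space E" and e: "e \<in> E"
    and uv: "\<And>e'. e' \<in> F \<Longrightarrow> u e' = v e'" "\<And>e'. e' \<in> E \<Longrightarrow> rk e' < rk e \<Longrightarrow> u e' = v e'"
  shows "S u e = S v e"
proof -
  obtain i j a b where eq: "e = ((i, j), a, b)" by (metis surj_pair)
  have ij: "1 \<le> i" "i \<le> j" "j < n" using e by (auto simp: eq E_iff)
  have lower: "u ((i', j'), a', b') = v ((i', j'), a', b')" if "i' + (n - j') < i + (n - j)" for i' j' a' b'
  proof (cases "((i', j'), a', b') \<in> E")
    case True
    then show ?thesis using uv(2) that by (simp add: eq rk_def)
  next
    case False
    then show ?thesis using u v by (simp add: affine_space_def)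
  qed
  have "u ((i, j + 1), p, b') = v ((i, j + 1), p, b')" "u ((i - 1, j), p, b') = v ((i - 1, j), p, b')" for p b'
    using lower ij by auto
  moreover have "u ((i, j), \<kappa> i j, \<mu> i j) = v ((i, j), \<kappa> i j, \<mu> i j)"
    using uv(1) ij by (auto simp: F_def K_iff)
  ultimately show "S u e = S v e" by (simp add: eq S_def \<tau>_def \<gamma>_def)
qed

text \<open>The polynomial parametrization of R_n in the chart by its free entries, used for
  smoothness and again for density.\<close>

lemma exists_graph:
  obtains r where "\<And>e. (\<lambda>y. r y e) \<in> polyfun F" "\<And>y. r y \<in> affine_space E"
    "\<And>y e. e \<in> F \<Longrightarrow> r y e = y e"
    "\<And>y. y \<in> affine_space E \<Longrightarrow> \<phi> y \<in> R_variety n \<longleftrightarrow> r y = y"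
proof (rule triangular_system[of F E S rk "2 * n + 1"])
  show "F \<subseteq> E" by (rule F_sub)
  show "S y \<in> affine_space E" for y
    by (auto simp: affine_space_def S_def)
  show "S y e = y e" if e: "e \<in> F" for y e
  proof -
    obtain i j where "e = ((i, j), \<kappa> i j, \<mu> i j)" using e unfolding F_def by blast
    then show ?thesis using subsetD[OF F_sub e] by (simp add: S_def \<tau>_def)
  qed
next
  show "S u e = S v e" if "u \<in> affine_space E" "v \<in> affine_space E" "e \<in> E"
    "\<And>e'. e' \<in> F \<Longrightarrow> u e' = v e'" "\<And>e'. e' \<in> E \<Longrightarrow> rk e' < rk e \<Longrightarrow> u e' = v e'" for u v e
    using S_triangular[OF that] .
next
  fix \<rho> :: "((nat \<times> nat) \<times> nat \<times> nat \<Rightarrow> complex) \<Rightarrow> (nat \<times> nat) \<times> nat \<times> nat \<Rightarrow> complex"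
    and e :: "(nat \<times> nat) \<times> nat \<times> nat"
  assume \<rho>: "\<And>e. (\<lambda>y. \<rho> y e) \<in> polyfun F"
  obtain i j a b where eq: "e = ((i, j), a, b)" by (metis surj_pair)
  have \<gamma>: "(\<lambda>y. \<gamma> (\<rho> y) i j p b) \<in> polyfun F" for p b
    unfolding \<gamma>_def by (cases "p = j + 1") (auto intro: \<rho> polyfun.const)
  have \<tau>: "(\<lambda>y. \<tau> (\<rho> y) i j b) \<in> polyfun F" for b
    unfolding \<tau>_def by (cases "b = \<mu> i j") (auto intro!: \<rho> \<gamma> polyfun.add polyfun.mult)
  show "(\<lambda>y. S (\<rho> y) e) \<in> polyfun F"
    unfolding eq S_def prod.case
    by (cases "((i, j), a, b) \<in> E"; cases "a = \<kappa> i j")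
      (auto intro!: \<rho> \<tau> polyfun_minus polyfun.mult intro: polyfun.const)
next
  fix e assume "e \<in> E"
  then show "rk e < 2 * n + 1"
    by (auto simp: rk_def Gr_chart_vars_def K_iff split: prod.splits)
next
  fix r assume "\<And>e. (\<lambda>y. r y e) \<in> polyfun F" "\<And>y. r y \<in> affine_space E"
    "\<And>y e. e \<in> F \<Longrightarrow> r y e = y e" "\<And>y. y \<in> affine_space E \<Longrightarrow> S y = y \<longleftrightarrow> r y = y"
  then show thesis using that chart_in_R_iff by metis
qed

lemma finite_E: "finite E"
proof -
  have "E \<subseteq> ({0..n} \<times> {0..n}) \<times> {0..n} \<times> {0..n}"
    using J_sub by (auto simp: Gr_chart_vars_def I_def K_iff) (meson atLeastAtMost_iff less_imp_le subsetD)
  then show ?thesis by (rule finite_subset) simp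
qed

lemma atlas: "(E, \<phi>) \<in> Gr_atlas n K fst"
  unfolding Gr_atlas_iff using chart_index_I by blast

lemma smooth_chart:
  assumes y: "y \<in> affine_space E" "\<phi> y \<in> R_variety n"
  shows "smooth_at (Gr_atlas n K fst) (R_variety n) (\<phi> y)"
proof -
  obtain r where r: "\<And>e. (\<lambda>y. r y e) \<in> polyfun F" "\<And>y. r y \<in> affine_space E"
    "\<And>y e. e \<in> F \<Longrightarrow> r y e = y e"
    "\<And>y. y \<in> affine_space E \<Longrightarrow> \<phi> y \<in> R_variety n \<longleftrightarrow> r y = y" using exists_graph by blast
  then have "r y = y" using y by blast
  then show ?thesis
    by (intro smooth_at_graph[where r = r and F = F and E = E] atlas finite_E F_sub r)
qed

end

section \<open>A point in all adapted charts\<close>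

text \<open>\<open>p\<close> is the numerator of the sum of c a / (a + x). Its degree is below
  \<open>card A\<close> while all of \<open>B\<close> are roots, so it is 0; at x = - a0 only the
  term of \<open>a0\<close> survives.\<close>

lemma cauchy_kernel_zero:
  fixes c :: "nat \<Rightarrow> complex"
  assumes "finite A" "finite B" "card A \<le> card B" "0 \<notin> B"
    and sum0: "\<And>b. b \<in> B \<Longrightarrow> (\<Sum>a\<in>A. c a * (1 / of_nat (a + b))) = 0"
    and "a0 \<in> A"
  shows "c a0 = 0"
proof -
  define p where "p = (\<Sum>a\<in>A. smult (c a) (\<Prod>a'\<in>A - {a}. [:of_nat a', 1:]))"
  have poly_p: "poly p x = (\<Sum>a\<in>A. c a * (\<Prod>a'\<in>A - {a}. of_nat a' + x))" for x
    by (simp add: p_def poly_sum poly_prod)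
  have root: "poly p (of_nat b) = 0" if "b \<in> B" for b
  proof -
    let ?N = "\<Prod>a\<in>A. of_nat a + of_nat b :: complex"
    have nz: "of_nat a + of_nat b \<noteq> (0::complex)" for a
      using that assms(4) by (metis add_eq_0_iff_both_eq_0 of_nat_add of_nat_eq_0_iff)
    have "c a * (\<Prod>a'\<in>A - {a}. of_nat a' + of_nat b) = ?N * (c a * (1 / of_nat (a + b)))" if "a \<in> A" for a
      using prod.remove[OF assms(1) that, of "\<lambda>a. of_nat a + of_nat b :: complex"] nz[of a] by simp
    then have "poly p (of_nat b) = ?N * (\<Sum>a\<in>A. c a * (1 / of_nat (a + b)))"
      unfolding poly_p sum_distrib_left by (intro sum.cong) auto
    then show ?thesis using sum0[OF that] by simp
  qed
  have "p = 0"
  proof (rule ccontr)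
    assume p: "p \<noteq> 0"
    have "card B = card (of_nat ` B :: complex set)" by (simp add: card_image inj_on_def)
    also have "\<dots> \<le> card {x. poly p x = 0}"
      using root poly_roots_finite[OF p] by (intro card_mono) auto
    also have "\<dots> \<le> degree p" by (rule card_poly_roots_bound[OF p])
    also have "\<dots> \<le> card A - 1"
      unfolding p_def
    proof (rule degree_sum_le[OF assms(1)])
      fix a assume "a \<in> A"
      have "degree (smult (c a) (\<Prod>a'\<in>A - {a}. [:of_nat a', 1:])) \<le> degree (\<Prod>a'\<in>A - {a}. [:of_nat a', 1::complex:])"
        by (rule degree_smult_le)
      also have "\<dots> \<le> (\<Sum>a'\<in>A - {a}. degree [:of_nat a', 1::complex:])"
        using degree_prod_sum_le[of "A - {a}" "\<lambda>a'. [:of_nat a', 1::complex:]"] assms(1) by (simp add: o_def)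
      also have "\<dots> = card A - 1" using \<open>a \<in> A\<close> assms(1) by simp
      finally show "degree (smult (c a) (\<Prod>a'\<in>A - {a}. [:of_nat a', 1:])) \<le> card A - 1" .
    qed
    finally show False using assms(1,3,6) by (metis One_nat_def Suc_pred card_gt_0_iff empty_iff not_less_eq_eq order.trans)
  qed
  then have "0 = (\<Sum>a\<in>A. c a * (\<Prod>a'\<in>A - {a}. of_nat a' - of_nat a0 :: complex))"
    using poly_p[of "- of_nat a0"] by simp
  also have "\<dots> = (\<Sum>a\<in>A. if a = a0 then c a * (\<Prod>a'\<in>A - {a}. of_nat a' - of_nat a0) else 0)"
    using assms(1,6) by (intro sum.cong) (auto intro!: prod_zero)
  also have "\<dots> = c a0 * (\<Prod>a'\<in>A - {a0}. of_nat a' - of_nat a0)" using assms(1,6) by simp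
  finally show ?thesis using assms(1) by auto
qed

text \<open>If \<open>v\<close> vanishes on \<open>T\<close>, its coordinates in
  \<open>{1..i} - T\<close> solve a square Cauchy system with one equation for each index in
  \<open>T - {1..i}\<close>. These indices exceed \<open>j\<close>, so they avoid the zero
  columns.\<close>

lemma inj_coords_cauchy:
  assumes "i \<le> j" "j \<le> n" "T \<subseteq> {1..i} \<union> {j+1..n}" "card T = i"
  shows "inj_coords (graph_space n {1..i} (\<lambda>a b. if j < b then 1 / of_nat (a + b) else 0)) T"
  unfolding inj_coords_def
proof (intro ballI impI)
  fix v assume v: "v \<in> graph_space n {1..i} (\<lambda>a b. if j < b then 1 / of_nat (a + b) else 0)"
    and z: "\<forall>a\<in>T. v a = 0"
  have fin: "finite T" using assms(3) finite_subset by blast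
  have "card ({1..i} - T) = card (T - {1..i})"
  proof -
    have "card ({1..i} - T) + card ({1..i} \<inter> T) = i" "card (T - {1..i}) + card ({1..i} \<inter> T) = i"
      using card_Int_Diff[of "{1..i}" T] card_Int_Diff[of T "{1..i}"] fin assms(4) by (auto simp: Int_commute)
    then show ?thesis by simp
  qed
  moreover have "(\<Sum>a\<in>{1..i} - T. v a * (1 / of_nat (a + b))) = 0" if b: "b \<in> T - {1..i}" for b
  proof -
    have "b \<in> {1..n} - {1..i}" "j < b" using b assms by auto
    then have "v b = (\<Sum>a\<in>{1..i}. v a * (1 / of_nat (a + b)))" using v by (simp add: graph_space_def)
    also have "\<dots> = (\<Sum>a\<in>{1..i} - T. v a * (1 / of_nat (a + b)))"
      using z by (intro sum.mono_neutral_right) auto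
    finally show ?thesis using z b by simp
  qed
  moreover have "0 \<notin> T - {1..i}" using assms(3) by auto
  ultimately have "v a = 0" if "a \<in> {1..i} - T" for a
    using cauchy_kernel_zero[of "{1..i} - T" "T - {1..i}" v a] fin that by simp
  then have "v a = 0" if "a \<in> {1..i}" for a using z that by blast
  then show "v = 0" using graph_space_eqI_zero[OF _ v] assms(1,2) by auto
qed

section \<open>The standard chart\<close>

lemma tower_chart_std: "tower_chart n (\<lambda>i j. {1..i})"
  by unfold_locales auto

abbreviation "std_index \<equiv> (\<lambda>(i, j). {1..i}) :: nat \<times> nat \<Rightarrow> nat set"
definition "std_vars n = Gr_chart_vars n (R_index n) std_index"
definition "std_chart n = Gr_chart n (R_index n) std_index"
definition "std_vars' n = Gr_chart_vars n {1..n-1} (\<lambda>i. {1..i})"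
definition "std_chart' n = Gr_chart n {1..n-1} (\<lambda>i. {1..i})"

lemma chart_index_std: "chart_index n (R_index n) fst std_index"
  by (auto simp: chart_index_def R_index_def)

lemma chart_index_std': "chart_index n {1..n-1} (\<lambda>d. d) (\<lambda>i. {1..i})"
  by (auto simp: chart_index_def)

lemma atlas_std: "(std_vars n, std_chart n) \<in> Gr_atlas n (R_index n) fst"
  unfolding Gr_atlas_iff std_vars_def std_chart_def using chart_index_std by blast

lemma atlas_std': "(std_vars' n, std_chart' n) \<in> Gr_atlas n {1..n-1} (\<lambda>d. d)"
  unfolding Gr_atlas_iff std_vars'_def std_chart'_def using chart_index_std' by blast

lemma std_chart_apply:
  assumes "1 \<le> i" "i \<le> j" "j < n"
  shows "std_chart n y (i, j) = graph_space n {1..i} (\<lambda>a b. y ((i, j), a, b))"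
proof -
  have "(i, j) \<in> R_index n" using assms by (auto simp: R_index_def)
  then show ?thesis unfolding std_chart_def using Gr_chart_apply[OF chart_index_std] by simp
qed

lemma std_chart'_apply:
  "1 \<le> i \<Longrightarrow> i < n \<Longrightarrow> std_chart' n x i = graph_space n {1..i} (\<lambda>a b. x (i, a, b))"
  unfolding std_chart'_def using Gr_chart_apply[OF chart_index_std'] by simp

lemma std_vars_iff:
  "((i, j), a, b) \<in> std_vars n \<longleftrightarrow> 1 \<le> i \<and> i \<le> j \<and> j < n \<and> 1 \<le> a \<and> a \<le> i \<and> i < b \<and> b \<le> n"
  by (auto simp: std_vars_def Gr_chart_vars_def R_index_def)

lemma std_vars'_iff:
  "(i, a, b) \<in> std_vars' n \<longleftrightarrow> 1 \<le> i \<and> i < n \<and> 1 \<le> a \<and> a \<le> i \<and> i < b \<and> b \<le> n"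
  by (auto simp: std_vars'_def Gr_chart_vars_def)

text \<open>All V_(i,j) come from one matrix \<open>z\<close>: take its first \<open>i\<close> rows
  and clear the columns i + 1 to j. Then \<open>pr (j + 1)\<close> clears one more column, and
  raising \<open>i\<close> adds a row.\<close>

lemma std_chart_in_R:
  fixes z :: "nat \<Rightarrow> nat \<Rightarrow> complex"
  assumes y: "\<And>i j a b. ((i, j), a, b) \<in> std_vars n \<Longrightarrow> y ((i, j), a, b) = (if j < b then z a b else 0)"
  shows "std_chart n y \<in> R_variety n"
proof (rule R_variety_I)
  show "std_chart n y \<in> Gr_prod n (R_index n) fst"
    unfolding std_chart_def by (rule Gr_chart_in_Gr_prod[OF chart_index_std])
  have eq: "std_chart n y (i, j) = graph_space n {1..i} (\<lambda>a b. if j < b then z a b else 0)"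
    if "1 \<le> i" "i \<le> j" "j < n" for i j
    unfolding std_chart_apply[OF that]
    by (rule graph_space_cong, rule y) (use that in \<open>auto simp: std_vars_iff\<close>)
  fix i j :: nat assume ij: "1 \<le> i" "i \<le> j"
  show "std_chart n y (i, j) \<subseteq> coord_space ({1..i} \<union> {j+1..n})" if "j < n"
  proof
    fix v assume "v \<in> std_chart n y (i, j)"
    then have v: "v \<in> graph_space n {1..i} (\<lambda>a b. if j < b then z a b else 0)" using eq ij that by simp
    have "v l = 0" if "l \<notin> {1..i} \<union> {j+1..n}" for l
      using v that by (cases "l \<in> {1..n}") (auto simp: graph_space_def)
    then show "v \<in> coord_space ({1..i} \<union> {j+1..n})" by (simp add: coord_space_def)
  qed
  assume j: "j + 1 < n"
  have eqs: "std_chart n y (i, j) = graph_space n {1..i} (\<lambda>a b. if j < b then z a b else 0)"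
    "std_chart n y (i, j + 1) = graph_space n {1..i} (\<lambda>a b. if j + 1 < b then z a b else 0)"
    "std_chart n y (i + 1, j + 1) = graph_space n {1..i+1} (\<lambda>a b. if j + 1 < b then z a b else 0)"
    using eq ij j by simp_all
  show "pr (j + 1) v \<in> std_chart n y (i, j + 1)" if "v \<in> std_chart n y (i, j)" for v
  proof -
    have v: "v \<in> graph_space n {1..i} (\<lambda>a b. if j < b then z a b else 0)" using that eqs by simp
    have s: "(\<Sum>a\<in>{1..i}. pr (j + 1) v a * m a) = (\<Sum>a\<in>{1..i}. v a * m a)" for m
      using ij by (intro sum.cong) (auto simp: pr_apply)
    have "pr (j + 1) v l = (\<Sum>a\<in>{1..i}. v a * (if j + 1 < l then z a l else 0))" if "l \<in> {1..n} - {1..i}" for l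
    proof (cases "l = j + 1")
      case True
      then show ?thesis by (simp add: pr_apply)
    next
      case False
      then have "j < l \<longleftrightarrow> j + 1 < l" by auto
      then show ?thesis using False v that by (simp add: pr_apply graph_space_def)
    qed
    moreover have "pr (j + 1) v l = 0" if "l \<notin> {1..n}" for l
      using v that by (simp add: pr_apply graph_space_def)
    ultimately show ?thesis unfolding eqs graph_space_def mem_Collect_eq s by blast
  qed
  show "v \<in> std_chart n y (i + 1, j + 1)" if "v \<in> std_chart n y (i, j + 1)" for v
  proof -
    have v: "v \<in> graph_space n {1..i} (\<lambda>a b. if j + 1 < b then z a b else 0)" using that eqs by simp
    have "v (i + 1) = 0" using v ij j by (auto simp: graph_space_def)
    then have s: "(\<Sum>a\<in>{1..i+1}. v a * m a) = (\<Sum>a\<in>{1..i}. v a * m a)" for m by simp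
    have "{1..n} - {1..i+1} \<subseteq> {1..n} - {1..i}" by auto
    then show ?thesis using v unfolding eqs graph_space_def mem_Collect_eq s by blast
  qed
qed

lemma graph_space_std_eqI:
  assumes v: "graph_row n {1..i} m a \<in> graph_space n {1..i} m'" and "i \<le> n" "1 \<le> a" "a \<le> i" "i < b" "b \<le> n"
  shows "m a b = m' a b"
proof -
  let ?v = "graph_row n {1..i} m a"
  have "m a b = ?v b" using assms by (simp add: graph_row_def)
  also have "\<dots> = (\<Sum>p\<in>{1..i}. ?v p * m' p b)" using v assms by (simp add: graph_space_def)
  also have "\<dots> = (\<Sum>p\<in>{1..i}. if p = a then m' p b else 0)"
    by (intro sum.cong) (auto simp: graph_row_def)
  also have "\<dots> = m' a b" using assms by simp
  finally show ?thesis .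
qed

text \<open>Passing from m to m + 1 in the second index alters column m + 1 only, so column
  \<open>b\<close> is constant below \<open>b\<close>; once \<open>j\<close> reaches
  \<open>b\<close>, it is zero by W_(i,j).\<close>

lemma R_std_coords:
  assumes R: "std_chart n y \<in> R_variety n" and ij: "1 \<le> i" "i \<le> j" "j < n"
    and ab: "1 \<le> a" "a \<le> i" "i < b" "b \<le> n"
  shows "y ((i, j), a, b) = (if j < b then y ((i, i), a, b) else 0)"
proof (cases "j < b")
  case False
  have "graph_row n {1..i} (\<lambda>a b. y ((i, j), a, b)) a \<in> std_chart n y (i, j)"
    unfolding std_chart_apply[OF ij] using ij ab by (intro graph_row_in) auto
  then have "graph_row n {1..i} (\<lambda>a b. y ((i, j), a, b)) a b = 0"
    using R_D(2)[OF R ij] False ab by (auto simp: coord_space_def)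
  then show ?thesis using False ab by (simp add: graph_row_def)
next
  case True
  have "y ((i, j), a, b) = y ((i, i), a, b)" if "j < b"
    using ij(2) that
  proof (induction j rule: dec_induct)
    case (step m)
    have m: "m + 1 < n" "m < n" using step.prems ab by auto
    let ?v = "graph_row n {1..i} (\<lambda>a b. y ((i, m), a, b)) a"
    have "?v \<in> std_chart n y (i, m)"
      unfolding std_chart_apply[OF ij(1) step.hyps(1) m(2)] using ij ab by (intro graph_row_in) auto
    then have "pr (m + 1) ?v \<in> std_chart n y (i, m + 1)"
      using R_D(3)[OF R ij(1) step.hyps(1) m(2,1)] by blast
    moreover have "pr (m + 1) ?v = graph_row n {1..i} (\<lambda>a b. if b = m + 1 then 0 else y ((i, m), a, b)) a"
      using ab step.hyps by (auto simp: fun_eq_iff pr_apply graph_row_def)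
    ultimately have "graph_row n {1..i} (\<lambda>a b. if b = m + 1 then 0 else y ((i, m), a, b)) a
        \<in> graph_space n {1..i} (\<lambda>a b. y ((i, m + 1), a, b))"
      using std_chart_apply[of i "m + 1" n y] ij step.hyps m by simp
    from graph_space_std_eqI[OF this _ ab] have "y ((i, m), a, b) = y ((i, m + 1), a, b)"
      using step.prems ij by (auto split: if_splits)
    then show ?case using step by simp
  qed simp
  then show ?thesis using True by simp
qed

text \<open>\<open>pr (m + 1)\<close> does not touch column \<open>b\<close> when m + 1 < b, so the
  entry does not depend on \<open>i\<close> and may be read off at the last index b - 1. This
  provides the matrix \<open>z\<close> for \<open>std_chart_in_R\<close>.\<close>

lemma Fa_std_coords:
  assumes Fa: "std_chart' n x \<in> Fa_variety n" and i: "1 \<le> i" "i < b" "b \<le> n" and a: "1 \<le> a" "a \<le> i"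
  shows "x (i, a, b) = x (b - 1, a, b)"
proof -
  have "x (i, a, b) = x (m, a, b)" if "i \<le> m" "m < b" for m
    using that
  proof (induction m rule: dec_induct)
    case (step m)
    have m: "m \<in> {1..n-2}" "1 \<le> m" "m < n" "m + 1 < n" using step i by auto
    let ?v = "graph_row n {1..m} (\<lambda>a b. x (m, a, b)) a"
    have "?v \<in> std_chart' n x m"
      unfolding std_chart'_apply[OF m(2,3)] using m a step.hyps by (intro graph_row_in) auto
    moreover have "pr (m + 1) ` std_chart' n x m \<subseteq> std_chart' n x (m + 1)"
      using Fa m(1) unfolding Fa_variety_def by blast
    ultimately have "pr (m + 1) ?v \<in> std_chart' n x (m + 1)" by blast
    then have v: "pr (m + 1) ?v \<in> graph_space n {1..m+1} (\<lambda>a b. x (m + 1, a, b))"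
      using std_chart'_apply[of "m + 1" n x] m by simp
    \<comment> \<open>After the projection, coordinate m + 1 is zero, as a row for the larger index
      set \<open>{1..m+1}\<close> requires.\<close>
    have "pr (m + 1) ?v = graph_row n {1..m+1} (\<lambda>a b. x (m, a, b)) a"
      using a step.hyps by (auto simp: fun_eq_iff pr_apply graph_row_def)
    then have "x (m, a, b) = x (m + 1, a, b)"
      using graph_space_std_eqI[of n "m + 1" "\<lambda>a b. x (m, a, b)" a "\<lambda>a b. x (m + 1, a, b)" b] v m a step i
      by auto
    then show ?case using step by simp
  qed simp
  from this[of "b - 1"] show ?thesis using i by auto
qed

section \<open>The birational isomorphism\<close>

lemma R_in_chart:
  assumes "P \<in> R_variety n"
  obtains J y where "tower_chart n J" "y \<in> affine_space (Gr_chart_vars n (R_index n) (tower_chart.I J))"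
    "P = Gr_chart n (R_index n) (tower_chart.I J) y"
proof -
  obtain J where J: "tower_chart n J"
    "\<And>i j. 1 \<le> i \<Longrightarrow> i \<le> j \<Longrightarrow> j < n \<Longrightarrow> inj_coords (P (i, j)) (J i j)"
    using exists_tower_chart[OF assms] by blast
  interpret tower_chart n J by fact
  have "P \<in> Gr_prod n K fst" using assms by (simp add: R_variety_def)
  moreover have "inj_coords (P k) (I k)" if "k \<in> K" for k
    using that J(2) by (cases k) (auto simp: I_def R_index_def)
  ultimately obtain y where "y \<in> affine_space E" "P = \<phi> y"
    using in_Gr_chart[OF _ chart_index_I] by blast
  then show ?thesis using that J(1) by blast
qed

lemma smooth_R: "smooth_variety (Gr_atlas n (R_index n) fst) (R_variety n)"
  unfolding smooth_variety_def
proof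
  fix P assume P: "P \<in> R_variety n"
  obtain J y where J: "tower_chart n J" "y \<in> affine_space (Gr_chart_vars n (R_index n) (tower_chart.I J))"
    "P = Gr_chart n (R_index n) (tower_chart.I J) y" using R_in_chart[OF P] by blast
  show "smooth_at (Gr_atlas n (R_index n) fst) (R_variety n) P"
    using tower_chart.smooth_chart[OF J(1,2)] P J(3) by simp
qed

lemma R_in_topspace: "R_variety n \<subseteq> topspace (zariski (Gr_atlas n (R_index n) fst))"
proof
  fix P assume P: "P \<in> R_variety n"
  obtain J y where J: "tower_chart n J" "y \<in> affine_space (Gr_chart_vars n (R_index n) (tower_chart.I J))"
    "P = Gr_chart n (R_index n) (tower_chart.I J) y" using R_in_chart[OF P] by blast
  show "P \<in> topspace (zariski (Gr_atlas n (R_index n) fst))"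
    unfolding J(3) using tower_chart.chart_index_I[OF J(1)] J(2) by (rule Gr_chart_in_topspace)
qed

text \<open>With the index sets \<open>J i i\<close> on the target, the projection merely forgets
  the coordinates with i < j.\<close>

lemma proj_R_chart:
  assumes J: "tower_chart n J"
  shows "chart_index n {1..n-1} (\<lambda>d. d) (\<lambda>i. J i i)"
    and "proj_R n (Gr_chart n (R_index n) (tower_chart.I J) y) = Gr_chart n {1..n-1} (\<lambda>i. J i i)
      (\<lambda>(i, a, b). if (i, a, b) \<in> Gr_chart_vars n {1..n-1} (\<lambda>i. J i i) then y ((i, i), a, b) else 0)"
proof -
  interpret tower_chart n J by fact
  have "J i i \<subseteq> {1..n} \<and> card (J i i) = i" if "i \<in> {1..n-1}" for i
  proof -
    have "i \<le> n" using that by auto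
    then show ?thesis using J_sub[of i i] card_J[of i i] by simp
  qed
  then show ci: "chart_index n {1..n-1} (\<lambda>d. d) (\<lambda>i. J i i)" by (simp add: chart_index_def)
  show "proj_R n (\<phi> y) = Gr_chart n {1..n-1} (\<lambda>i. J i i)
      (\<lambda>(i, a, b). if (i, a, b) \<in> Gr_chart_vars n {1..n-1} (\<lambda>i. J i i) then y ((i, i), a, b) else 0)"
    (is "_ = Gr_chart _ _ _ ?x")
  proof
    fix i
    show "proj_R n (\<phi> y) i = Gr_chart n {1..n-1} (\<lambda>i. J i i) ?x i"
    proof (cases "i \<in> {1..n-1}")
      case True
      then have ii: "(i, i) \<in> K" by (auto simp: K_iff)
      have "graph_space n (J i i) (\<lambda>a b. y ((i, i), a, b)) = graph_space n (J i i) (\<lambda>a b. ?x (i, a, b))"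
        using True by (intro graph_space_cong) (auto simp: Gr_chart_vars_def)
      moreover have "I (i, i) = J i i" by (simp add: I_def)
      ultimately show ?thesis
        unfolding proj_R_def restrict_apply if_P[OF True] Gr_chart_apply[OF chart_index_I ii]
          Gr_chart_apply[OF ci True] by simp
    next
      case False
      show ?thesis unfolding proj_R_def Gr_chart_def restrict_apply if_not_P[OF False] ..
    qed
  qed
qed

text \<open>Stated for arbitrary \<open>X\<close> and \<open>Y\<close> in order to cover both R_n
  itself and its open piece.\<close>

lemma proj_R_morphism:
  assumes X: "X \<subseteq> R_variety n" "proj_R n ` X \<subseteq> Y"
  shows "morphism (Gr_atlas n (R_index n) fst) X (Gr_atlas n {1..n-1} (\<lambda>d. d)) Y (proj_R n)"
proof (rule morphism_chartwise)
  fix P assume P: "P \<in> X"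
  obtain J y where J: "tower_chart n J" "y \<in> affine_space (Gr_chart_vars n (R_index n) (tower_chart.I J))"
    "P = Gr_chart n (R_index n) (tower_chart.I J) y" using R_in_chart P X(1) by blast
  interpret tower_chart n J by fact
  let ?E' = "Gr_chart_vars n {1..n-1} (\<lambda>i. J i i)"
  define \<rho> where "\<rho> = (\<lambda>(i, a, b) y. if (i, a, b) \<in> ?E' then y ((i, i), a, b) else (0::complex))"
  have "\<rho> e \<in> polyfun E" for e
  proof -
    obtain i a b where e: "e = (i, a, b)" by (metis surj_pair)
    show ?thesis
      by (cases "e \<in> ?E'") (auto simp: \<rho>_def e Gr_chart_vars_def I_def K_iff intro!: polyfun.intros)
  qed
  moreover have "(\<lambda>e. \<rho> e y) \<in> affine_space ?E'" for y
    by (auto simp: affine_space_def \<rho>_def)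
  moreover have "proj_R n (\<phi> y) = Gr_chart n {1..n-1} (\<lambda>i. J i i) (\<lambda>e. \<rho> e y)" for y
  proof -
    have "(\<lambda>e. \<rho> e y) = (\<lambda>(i, a, b). if (i, a, b) \<in> ?E' then y ((i, i), a, b) else 0)"
      by (auto simp: \<rho>_def fun_eq_iff)
    then show ?thesis using proj_R_chart(2)[OF J(1)] by simp
  qed
  ultimately show "\<exists>(E, \<phi>)\<in>Gr_atlas n (R_index n) fst. \<exists>x\<in>affine_space E. \<exists>I \<rho>. P = \<phi> x \<and>
      chart_index n {1..n-1} (\<lambda>d. d) I \<and> (\<forall>e. \<rho> e \<in> polyfun E) \<and>
      (\<forall>y. (\<lambda>e. \<rho> e y) \<in> affine_space (Gr_chart_vars n {1..n-1} I)) \<and>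
      (\<forall>y\<in>affine_space E. \<phi> y \<in> X \<longrightarrow> proj_R n (\<phi> y) = Gr_chart n {1..n-1} I (\<lambda>e. \<rho> e y))"
    using atlas J(2,3) proj_R_chart(1)[OF J(1)]
    by (intro bexI[of _ "(E, \<phi>)"] case_prodI bexI[of _ y] exI[of _ "\<lambda>i. J i i"] exI[of _ \<rho>]) auto
qed (use X in auto)

section \<open>The open pieces and the inverse map\<close>

definition R_open :: "nat \<Rightarrow> (nat \<times> nat \<Rightarrow> (nat \<Rightarrow> complex) set) set" where
  "R_open n = R_variety n \<inter> std_chart n ` affine_space (std_vars n)"

definition Fa_open :: "nat \<Rightarrow> (nat \<Rightarrow> (nat \<Rightarrow> complex) set) set" where
  "Fa_open n = Fa_variety n \<inter> std_chart' n ` affine_space (std_vars' n)"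

text \<open>On \<open>Fa_open\<close>, the spaces \<open>V\<^sub>i\<^sub>,\<^sub>j = pr\<^sub>i\<^sub>+\<^sub>1 \<cdots> pr\<^sub>j V\<^sub>i\<close> form the only preimage; in coordinates,
  the entries in the columns \<open>i + 1, \<dots>, j\<close> are replaced by zero.\<close>

definition lift_coords :: "nat \<Rightarrow> (nat \<times> nat) \<times> nat \<times> nat \<Rightarrow> (nat \<times> nat \<times> nat \<Rightarrow> complex) \<Rightarrow> complex" where
  "lift_coords n = (\<lambda>((i, j), a, b) x. if ((i, j), a, b) \<in> std_vars n \<and> j < b then x (i, a, b) else 0)"

definition lift_Fa :: "nat \<Rightarrow> (nat \<Rightarrow> (nat \<Rightarrow> complex) set) \<Rightarrow> nat \<times> nat \<Rightarrow> (nat \<Rightarrow> complex) set" where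
  "lift_Fa n V = std_chart n (\<lambda>e. lift_coords n e (inv_into (affine_space (std_vars' n)) (std_chart' n) V))"

lemma lift_Fa_chart:
  "x \<in> affine_space (std_vars' n) \<Longrightarrow> lift_Fa n (std_chart' n x) = std_chart n (\<lambda>e. lift_coords n e x)"
  using inj_on_Gr_chart[OF chart_index_std', of n, folded std_chart'_def std_vars'_def] by (simp add: lift_Fa_def)

lemma lift_coords_affine: "(\<lambda>e. lift_coords n e x) \<in> affine_space (std_vars n)"
  by (auto simp: affine_space_def lift_coords_def)

lemma proj_R_std:
  "proj_R n (std_chart n y) = std_chart' n (\<lambda>(i, a, b). if (i, a, b) \<in> std_vars' n then y ((i, i), a, b) else 0)"
proof -
  have "tower_chart.I (\<lambda>i j. {1..i}) = std_index" by (rule tower_chart.I_def[OF tower_chart_std])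
  then show ?thesis
    using proj_R_chart(2)[OF tower_chart_std, of n y] unfolding std_chart_def std_chart'_def std_vars'_def by simp
qed

lemma proj_R_open: "proj_R n ` R_open n \<subseteq> Fa_open n"
proof
  fix Q assume "Q \<in> proj_R n ` R_open n"
  then obtain y where y: "std_chart n y \<in> R_variety n" "Q = proj_R n (std_chart n y)"
    by (auto simp: R_open_def)
  have "(\<lambda>(i, a, b). if (i, a, b) \<in> std_vars' n then y ((i, i), a, b) else 0) \<in> affine_space (std_vars' n)"
    by (auto simp: affine_space_def)
  then have "Q \<in> std_chart' n ` affine_space (std_vars' n)" unfolding y(2) proj_R_std by (rule imageI)
  moreover have "Q \<in> Fa_variety n" using proj_R_in_Fa[OF y(1)] y(2) by simp
  ultimately show "Q \<in> Fa_open n" by (simp add: Fa_open_def)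
qed

lemma lift_Fa_open: "lift_Fa n ` Fa_open n \<subseteq> R_open n"
proof
  fix P assume "P \<in> lift_Fa n ` Fa_open n"
  then obtain x where x: "x \<in> affine_space (std_vars' n)" "std_chart' n x \<in> Fa_variety n"
    "P = lift_Fa n (std_chart' n x)" by (auto simp: Fa_open_def)
  have "std_chart n (\<lambda>e. lift_coords n e x) \<in> R_variety n"
  \<comment> \<open>By \<open>Fa_std_coords\<close>, x (b - 1, a, b) is the common value of all x
    (i, a, b).\<close>
  proof (rule std_chart_in_R[where z = "\<lambda>a b. x (b - 1, a, b)"])
    fix i j a b assume e: "((i, j), a, b) \<in> std_vars n"
    then have "x (i, a, b) = x (b - 1, a, b)"
      by (intro Fa_std_coords[OF x(2)]) (simp_all add: std_vars_iff)
    then show "lift_coords n ((i, j), a, b) x = (if j < b then x (b - 1, a, b) else 0)"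
      using e by (simp add: lift_coords_def)
  qed
  then show "P \<in> R_open n" using lift_coords_affine[of n x] x lift_Fa_chart[OF x(1)] by (auto simp: R_open_def)
qed

lemma proj_R_lift:
  assumes "Q \<in> Fa_open n"
  shows "proj_R n (lift_Fa n Q) = Q"
proof -
  obtain x where x: "x \<in> affine_space (std_vars' n)" "Q = std_chart' n x" using assms by (auto simp: Fa_open_def)
  have "(\<lambda>(i, a, b). if (i, a, b) \<in> std_vars' n then lift_coords n ((i, i), a, b) x else 0) = x"
    using x(1) by (auto simp: fun_eq_iff lift_coords_def std_vars_iff std_vars'_iff affine_space_def)
  then show ?thesis unfolding x(2) lift_Fa_chart[OF x(1)] proj_R_std by simp
qed

lemma lift_proj_R:
  assumes "P \<in> R_open n"
  shows "lift_Fa n (proj_R n P) = P"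
proof -
  obtain y where y: "y \<in> affine_space (std_vars n)" "P = std_chart n y" "std_chart n y \<in> R_variety n"
    using assms by (auto simp: R_open_def)
  let ?x = "\<lambda>(i, a, b). if (i, a, b) \<in> std_vars' n then y ((i, i), a, b) else 0"
  have x: "?x \<in> affine_space (std_vars' n)" by (auto simp: affine_space_def)
  have "lift_coords n ((i, j), a, b) ?x = y ((i, j), a, b)" for i j a b
  proof (cases "((i, j), a, b) \<in> std_vars n")
    case True
    then show ?thesis using R_std_coords[OF y(3), of i j a b]
      by (auto simp: lift_coords_def std_vars_iff std_vars'_iff)
  next
    case False
    then show ?thesis using y(1) by (simp add: lift_coords_def affine_space_def)
  qed
  then have "(\<lambda>e. lift_coords n e ?x) = y" by (auto simp: fun_eq_iff)
  then show ?thesis unfolding y(2) proj_R_std lift_Fa_chart[OF x] by simp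
qed

lemma lift_Fa_morphism:
  "morphism (Gr_atlas n {1..n-1} (\<lambda>d. d)) (Fa_open n) (Gr_atlas n (R_index n) fst) (R_open n) (lift_Fa n)"
proof (rule morphism_chartwise)
  have "R_index n \<subseteq> {0..n} \<times> {0..n}" by (auto simp: R_index_def)
  then show "finite (R_index n)" by (rule finite_subset) simp
  show "lift_Fa n ` Fa_open n \<subseteq> R_open n" by (rule lift_Fa_open)
  fix Q assume "Q \<in> Fa_open n"
  then obtain x where x: "x \<in> affine_space (std_vars' n)" "Q = std_chart' n x" by (auto simp: Fa_open_def)
  have "lift_coords n e \<in> polyfun (std_vars' n)" for e
  proof -
    obtain i j a b where e: "e = ((i, j), a, b)" by (metis surj_pair)
    show ?thesis
      by (cases "e \<in> std_vars n \<and> j < b")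
        (auto simp: lift_coords_def e std_vars_iff std_vars'_iff intro!: polyfun.intros)
  qed
  then show "\<exists>(E, \<phi>)\<in>Gr_atlas n {1..n-1} (\<lambda>d. d). \<exists>x\<in>affine_space E. \<exists>I \<rho>. Q = \<phi> x \<and>
      chart_index n (R_index n) fst I \<and> (\<forall>e. \<rho> e \<in> polyfun E) \<and>
      (\<forall>y. (\<lambda>e. \<rho> e y) \<in> affine_space (Gr_chart_vars n (R_index n) I)) \<and>
      (\<forall>y\<in>affine_space E. \<phi> y \<in> Fa_open n \<longrightarrow> lift_Fa n (\<phi> y) = Gr_chart n (R_index n) I (\<lambda>e. \<rho> e y))"
    using x chart_index_std lift_coords_affine[unfolded std_vars_def] lift_Fa_chart[unfolded std_chart_def] atlas_std'
    by (intro bexI[of _ "(std_vars' n, std_chart' n)"] case_prodI bexI[of _ x] exI[of _ std_index]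
        exI[of _ "lift_coords n"]) auto
qed

text \<open>In an adapted chart around a point of \<open>U\<close>, polynomials whose nonvanishing
  ensures membership in \<open>U\<close> and in the standard chart are composed with
  \<open>r\<close>. One is nonzero at the given point, the other at the Cauchy point
  \<open>q\<close>; where both are nonzero, \<open>r\<close> returns a point of R_n.\<close>

lemma R_open_dense: "dense_open (Gr_atlas n (R_index n) fst) (R_variety n) (R_open n)"
proof -
  let ?Z = "zariski (Gr_atlas n (R_index n) fst)"
  let ?S = "std_chart n ` {y \<in> affine_space (std_vars n). (1::complex) \<noteq> 0}"
  have S: "openin ?Z ?S" by (rule openin_zariski_basic[OF atlas_std polyfun.const])
  have "openin (subtopology ?Z (R_variety n)) (R_open n)"
    using S by (auto simp: openin_subtopology R_open_def)
  moreover have "subtopology ?Z (R_variety n) closure_of (R_open n) = topspace (subtopology ?Z (R_variety n))"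
    unfolding dense_intersects_open
  proof (intro allI impI)
    fix U assume "openin (subtopology ?Z (R_variety n)) U \<and> U \<noteq> {}"
    then obtain G P where G: "openin ?Z G" "U = G \<inter> R_variety n" and P: "P \<in> G" "P \<in> R_variety n"
      by (auto simp: openin_subtopology)
    obtain J y where J: "tower_chart n J" "y \<in> affine_space (Gr_chart_vars n (R_index n) (tower_chart.I J))"
      "P = Gr_chart n (R_index n) (tower_chart.I J) y" using R_in_chart P(2) by blast
    interpret tower_chart n J by fact
    have finK: "finite K"
      by (rule finite_subset[of _ "{0..n} \<times> {0..n}"]) (auto simp: R_index_def)
    \<comment> \<open>The Cauchy matrix, with the columns up to \<open>j\<close> cleared as in
      \<open>std_chart_in_R\<close>.\<close>
    define q where "q = (\<lambda>((i, j), a, b). if ((i, j), a, b) \<in> std_vars n \<and> j < b then 1 / of_nat (a + b) else (0::complex))"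
    have q: "q \<in> affine_space (std_vars n)" by (auto simp: q_def affine_space_def)
    have QR: "std_chart n q \<in> R_variety n"
      by (rule std_chart_in_R[where z = "\<lambda>a b. 1 / of_nat (a + b)"]) (auto simp: q_def)
    have "inj_coords (std_chart n q k) (I k)" if k: "k \<in> K" for k
    proof -
      obtain i j where ij: "k = (i, j)" "1 \<le> i" "i \<le> j" "j < n" using k by (cases k) (auto simp: K_iff)
      have "std_chart n q k = graph_space n {1..i} (\<lambda>a b. if j < b then 1 / of_nat (a + b) else 0)"
        unfolding ij(1) std_chart_apply[OF ij(2-)]
        using ij by (intro graph_space_cong) (auto simp: q_def std_vars_iff)
      then show ?thesis using inj_coords_cauchy[of i j n "J i j"] J_W[of i j] card_J[of i j] ij
        by (simp add: I_def)
    qed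
    moreover have "std_chart n q \<in> Gr_prod n K fst" using QR by (simp add: R_variety_def)
    ultimately obtain z where z: "z \<in> affine_space E" "std_chart n q = \<phi> z"
      using in_Gr_chart[OF _ chart_index_I] by blast
    obtain r where r: "\<And>e. (\<lambda>y. r y e) \<in> polyfun F" "\<And>y. r y \<in> affine_space E"
      "\<And>y e. e \<in> F \<Longrightarrow> r y e = y e"
      "\<And>y. y \<in> affine_space E \<Longrightarrow> \<phi> y \<in> R_variety n \<longleftrightarrow> r y = y" using exists_graph by blast
    have ry: "r y = y" "r z = z" using r(4) J(2,3) P(2) z QR by auto
    have rr: "r (r x) = r x" for x
    proof
      fix e show "r (r x) e = r x e"
        by (rule polyfun_cong_vars[OF r(1)]) (rule r(3))
    qed
    obtain g where g: "g \<in> polyfun E" "g y \<noteq> 0" "\<And>x. g x \<noteq> 0 \<Longrightarrow> \<phi> x \<in> G"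
      using zariski_open_chart[OF finK chart_index_I G(1)] P(1) J(3) by blast
    have "\<phi> z \<in> ?S" using q z(2) by (metis (mono_tags, lifting) imageI mem_Collect_eq zero_neq_one)
    then obtain h where h: "h \<in> polyfun E" "h z \<noteq> 0" "\<And>x. h x \<noteq> 0 \<Longrightarrow> \<phi> x \<in> ?S"
      using zariski_open_chart[OF finK chart_index_I S] by blast
    have "(\<lambda>x. g (\<lambda>e. r x e)) \<in> polyfun F" "(\<lambda>x. h (\<lambda>e. r x e)) \<in> polyfun F"
      by (rule polyfun_comp[OF g(1) r(1)], rule polyfun_comp[OF h(1) r(1)])
    then obtain x where "g (r x) \<noteq> 0" "h (r x) \<noteq> 0"
      by (rule polyfun_common_nonzero[of _ _ _ y z]) (use ry g h in auto)
    then have "\<phi> (r x) \<in> G \<inter> R_variety n \<inter> ?S" using g(3) h(3) r(4)[OF r(2)] rr by blast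
    then show "R_open n \<inter> U \<noteq> {}" unfolding G(2) R_open_def by auto
  qed
  ultimately show ?thesis using R_in_topspace by (auto simp: dense_open_def)
qed

text \<open>Density descends along the surjection: the preimage of a nonempty open set is open and
  nonempty, so it meets \<open>R_open n\<close>, whose image lies in
  \<open>Fa_open n\<close>.\<close>

lemma Fa_open_dense: "dense_open (Gr_atlas n {1..n-1} (\<lambda>d. d)) (Fa_variety n) (Fa_open n)"
proof -
  let ?ZR = "subtopology (zariski (Gr_atlas n (R_index n) fst)) (R_variety n)"
  let ?ZF = "subtopology (zariski (Gr_atlas n {1..n-1} (\<lambda>d. d))) (Fa_variety n)"
  have onto: "proj_R n ` R_variety n = Fa_variety n" using proj_R_in_Fa Fa_in_proj_R by blast
  have topR: "topspace ?ZR = R_variety n" using R_in_topspace by auto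
  have "morphism (Gr_atlas n (R_index n) fst) (R_variety n) (Gr_atlas n {1..n-1} (\<lambda>d. d)) (Fa_variety n) (proj_R n)"
    using onto by (intro proj_R_morphism) auto
  then have cont: "continuous_map ?ZR ?ZF (proj_R n)" by (simp add: morphism_def)
  have "Fa_variety n \<subseteq> topspace ?ZF"
    using continuous_map_image_subset_topspace[OF cont] unfolding topR onto .
  then have topF: "topspace ?ZF = Fa_variety n" by (simp add: subset_antisym)
  from openin_zariski_basic[OF atlas_std' polyfun.const[of 1]]
  have "openin ?ZF (Fa_open n)" by (auto simp: openin_subtopology Fa_open_def)
  moreover have "?ZF closure_of (Fa_open n) = topspace ?ZF"
    unfolding dense_intersects_open
  proof (intro allI impI)
    fix U assume U: "openin ?ZF U \<and> U \<noteq> {}"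
    let ?U = "{P \<in> topspace ?ZR. proj_R n P \<in> U}"
    have "openin ?ZR ?U" using cont U openin_continuous_map_preimage by blast
    moreover obtain Q where Q: "Q \<in> U" using U by blast
    then have "Q \<in> Fa_variety n" using U openin_subset topF by blast
    then obtain P0 where "P0 \<in> R_variety n" "Q = proj_R n P0" using onto by auto
    then have "P0 \<in> ?U" using Q topR by simp
    then have "?U \<noteq> {}" by blast
    moreover have "?ZR closure_of (R_open n) = topspace ?ZR"
      using R_open_dense[of n] topR by (simp add: dense_open_def)
    ultimately obtain P where "P \<in> R_open n" "P \<in> ?U" unfolding dense_intersects_open by blast
    then show "Fa_open n \<inter> U \<noteq> {}" using proj_R_open[of n] by blast
  qed
  ultimately show ?thesis unfolding dense_open_def topF by blast
qed

theorem proposition2p4: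
  fixes n :: nat
  assumes "n \<ge> 1"
  shows "proj_R n ` R_variety n = Fa_variety n \<and>
    smooth_variety (Gr_atlas n (R_index n) fst) (R_variety n) \<and>
    birational_isomorphism (Gr_atlas n (R_index n) fst) (R_variety n)
      (Gr_atlas n {1..n-1} (\<lambda>d. d)) (Fa_variety n) (proj_R n)"
proof (intro conjI)
  show onto: "proj_R n ` R_variety n = Fa_variety n" using proj_R_in_Fa Fa_in_proj_R by blast
  show "smooth_variety (Gr_atlas n (R_index n) fst) (R_variety n)" by (rule smooth_R)
  have "isomorphism (Gr_atlas n (R_index n) fst) (R_open n) (Gr_atlas n {1..n-1} (\<lambda>d. d)) (Fa_open n) (proj_R n)"
    unfolding isomorphism_def
  proof (intro conjI exI[of _ "lift_Fa n"] ballI)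
    show "morphism (Gr_atlas n (R_index n) fst) (R_open n) (Gr_atlas n {1..n-1} (\<lambda>d. d)) (Fa_open n) (proj_R n)"
      by (rule proj_R_morphism) (use proj_R_open R_open_def in auto)
  qed (rule lift_Fa_morphism lift_proj_R proj_R_lift; assumption?)+
  then show "birational_isomorphism (Gr_atlas n (R_index n) fst) (R_variety n)
      (Gr_atlas n {1..n-1} (\<lambda>d. d)) (Fa_variety n) (proj_R n)"
    unfolding birational_isomorphism_def
    using onto proj_R_morphism[of "R_variety n" n "Fa_variety n"] R_open_dense Fa_open_dense
    by (intro conjI exI[of _ "R_open n"] exI[of _ "Fa_open n"]) simp_all
qed

end
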